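(* Let $A$ be an Artin algebra and $n\ge 2$ an integer. Then $\mathcal S_n(A)={}^\perp\mathbf m(D(A_A))$ (as full subcategories of $T_n(A)\text{-mod}=\operatorname{Mor}_n(A)$).
   Context: For an Artin algebra $B$, $B\text{-mod}$ is the category of finitely generated left $B$-modules; for $M\in B\text{-mod}$, ${}^\perp M=\{X\in B\text{-mod}\mid \operatorname{Ext}^i_B(X,M)=0\ \forall i\ge 1\}$. $D: A^{op}\text{-mod}\to A\text{-mod}$ is the standard duality. $T_n(A)$ is the algebra of upper triangular $n\times n$ matrices over $A$. $\operatorname{Mor}_n(A)$ is the category whose objects $X_{(\phi_i)}$ are sequences $X_n\xrightarrow{\phi_{n-1}}X_{n-1}\to\cdots\xrightarrow{\phi_1}X_1$ of $A$-maps in $A\text{-mod}$, and whose morphisms are $n$-tuples of $A$-maps commuting with the structure maps. It is identified with $T_n(A)\text{-mod}$: $X_{(\phi_i)}$ corresponds to $\bigoplus_i X_i$, where $(a_{ij})$ sends $(x_i)_i$ to the column with $i$-th entry $a_{ii}x_i+\sum_{j>i}a_{ij}\phi_i\cdots\phi_{j-1}(x_j)$. $\mathcal S_n(A)$ is the full subcategory of objects with all $\phi_i$ ($1\le i\le n-1$) monomorphisms. For $M\in A\text{-mod}$ and $1\le i\le n$, $\mathbf m_i(M)\in\operatorname{Mor}_n(A)$ has $j$-th branch $M$ for $j\le i$ and $0$ for $j>i$, with $j$-th structure map $\operatorname{id}_M$ for $j<i$ and $0$ for $j\ge i$; $\mathbf m(M)=\bigoplus_{1\le i\le n}\mathbf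 m_i(M)$. *)

theory Defs
  imports "HOL-Algebra.Module" "HOL-Algebra.QuotRing" "HOL-Algebra.Elementary_Groups"
begin

text \<open>
  The library locale \<open>module\<close> is restricted to commutative base rings.  It is used below for modules
  over the commutative ground ring of an Artin algebra; left modules over an arbitrary ring are
  introduced here on the same record type, with the same axioms.  The fields \<open>mult\<close> and \<open>one\<close> of a
  record regarded as a module are never used.
\<close>

locale left_module = R?: ring R + M?: abelian_group M
  for R :: "('a, 'p) ring_scheme" (structure) and M :: "('a, 'x, 'q) module_scheme" (structure) +
  assumes smult_closed [simp, intro]:
      "\<lbrakk>a \<in> carrier R; x \<in> carrier M\<rbrakk> \<Longrightarrow> a \<odot>\<^bsub>M\<^esub> x \<in> carrier M"
    and smult_l_distr:
      "\<lbrakk>a \<in> carrier R; b \<in> carrier R; x \<in> carrier M\<rbrakk> \<Longrightarrow>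
        (a \<oplus> b) \<odot>\<^bsub>M\<^esub> x = a \<odot>\<^bsub>M\<^esub> x \<oplus>\<^bsub>M\<^esub> b \<odot>\<^bsub>M\<^esub> x"
    and smult_r_distr:
      "\<lbrakk>a \<in> carrier R; x \<in> carrier M; y \<in> carrier M\<rbrakk> \<Longrightarrow>
        a \<odot>\<^bsub>M\<^esub> (x \<oplus>\<^bsub>M\<^esub> y) = a \<odot>\<^bsub>M\<^esub> x \<oplus>\<^bsub>M\<^esub> a \<odot>\<^bsub>M\<^esub> y"
    and smult_assoc1:
      "\<lbrakk>a \<in> carrier R; b \<in> carrier R; x \<in> carrier M\<rbrakk> \<Longrightarrow>
        (a \<otimes> b) \<odot>\<^bsub>M\<^esub> x = a \<odot>\<^bsub>M\<^esub> (b \<odot>\<^bsub>M\<^esub> x)"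
    and smult_one [simp]:
      "x \<in> carrier M \<Longrightarrow> \<one> \<odot>\<^bsub>M\<^esub> x = x"

lemma module_iff_left_module: "module R M \<longleftrightarrow> cring R \<and> left_module R M"
  by (auto simp: module_def left_module_def module_axioms_def left_module_axioms_def cring.axioms(1))

definition fin_gen :: "('a, 'p) ring_scheme \<Rightarrow> ('a, 'x, 'q) module_scheme \<Rightarrow> bool" where
  "fin_gen B M \<longleftrightarrow> (\<exists>G. finite G \<and> G \<subseteq> carrier M \<and>
     (\<forall>x \<in> carrier M. \<exists>c \<in> G \<rightarrow> carrier B. x = (\<Oplus>\<^bsub>M\<^esub> g \<in> G. c g \<odot>\<^bsub>M\<^esub> g)))"

definition lin_maps ::
    "('a, 'p) ring_scheme \<Rightarrow> ('a, 'x, 'q) module_scheme \<Rightarrow> ('a, 'y, 's) module_scheme \<Rightarrow> ('x \<Rightarrow> 'y) set"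
  where
  "lin_maps B M N = {f. f \<in> carrier M \<rightarrow> carrier N \<and>
     (\<forall>x \<in> carrier M. \<forall>y \<in> carrier M. f (x \<oplus>\<^bsub>M\<^esub> y) = f x \<oplus>\<^bsub>N\<^esub> f y) \<and>
     (\<forall>a \<in> carrier B. \<forall>x \<in> carrier M. f (a \<odot>\<^bsub>M\<^esub> x) = a \<odot>\<^bsub>N\<^esub> f x)}"

text \<open>Hom is restricted to extensional functions, so that equal homomorphisms are equal elements.\<close>

definition Hom ::
    "('a, 'p) ring_scheme \<Rightarrow> ('a, 'x, 'q) module_scheme \<Rightarrow> ('a, 'y, 's) module_scheme \<Rightarrow> ('x \<Rightarrow> 'y) monoid"
  where
  "Hom B M N = \<lparr>carrier = lin_maps B M N \<inter> extensional (carrier M),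
     monoid.mult = (\<lambda>f g. \<lambda>x \<in> carrier M. f x \<oplus>\<^bsub>N\<^esub> g x),
     monoid.one = (\<lambda>x \<in> carrier M. \<zero>\<^bsub>N\<^esub>)\<rparr>"

definition regular :: "('a, 'p) ring_scheme \<Rightarrow> ('a, 'a) module" where
  "regular B = \<lparr>carrier = carrier B, monoid.mult = monoid.mult B, monoid.one = monoid.one B,
     ring.zero = ring.zero B, ring.add = ring.add B, smult = monoid.mult B\<rparr>"

definition dsum :: "'i set \<Rightarrow> ('i \<Rightarrow> ('a, 'x, 'q) module_scheme) \<Rightarrow> ('a, 'i \<Rightarrow> 'x) module" where
  "dsum I M = \<lparr>carrier = (\<Pi>\<^sub>E i \<in> I. carrier (M i)), monoid.mult = undefined, monoid.one = undefined,
     ring.zero = (\<lambda>i \<in> I. \<zero>\<^bsub>M i\<^esub>),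
     ring.add = (\<lambda>x y. \<lambda>i \<in> I. x i \<oplus>\<^bsub>M i\<^esub> y i),
     smult = (\<lambda>a x. \<lambda>i \<in> I. a \<odot>\<^bsub>M i\<^esub> x i)\<rparr>"

definition free :: "('a, 'p) ring_scheme \<Rightarrow> nat \<Rightarrow> ('a, nat \<Rightarrow> 'a) module" where
  "free B k = dsum {..<k} (\<lambda>_. regular B)"


section \<open>Ext\<close>

text \<open>
  \<open>free_resolution B Y (k, d, e)\<close>: the sequence
  \<open>\<dots> \<rightarrow> B^(k 2) \<rightarrow> B^(k 1) \<rightarrow> B^(k 0) \<rightarrow> Y \<rightarrow> 0\<close> with maps \<open>d i : B^(k (i + 1)) \<rightarrow> B^(k i)\<close> and
  augmentation \<open>e\<close> is exact.  Over a left noetherian ring, every finitely generated module has such a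
  projective resolution.
\<close>

type_synonym ('b, 'x) resolution =
  "(nat \<Rightarrow> nat) \<times> (nat \<Rightarrow> (nat \<Rightarrow> 'b) \<Rightarrow> (nat \<Rightarrow> 'b)) \<times> ((nat \<Rightarrow> 'b) \<Rightarrow> 'x)"

definition free_resolution ::
    "('b, 'p) ring_scheme \<Rightarrow> ('b, 'x, 'q) module_scheme \<Rightarrow> ('b, 'x) resolution \<Rightarrow> bool" where
  "free_resolution B Y = (\<lambda>(k, d, e).
     e \<in> lin_maps B (free B (k 0)) Y \<and>
     e ` carrier (free B (k 0)) = carrier Y \<and>
     (\<forall>i. d i \<in> lin_maps B (free B (k (Suc i))) (free B (k i))) \<and>
     d 0 ` carrier (free B (k 1)) = a_kernel (free B (k 0)) Y e \<and>
     (\<forall>i. d (Suc i) ` carrier (free B (k (Suc (Suc i)))) =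
       a_kernel (free B (k (Suc i))) (free B (k i)) (d i)))"

text \<open>
  \<open>Ext B i Y M\<close> is the \<open>i\<close>-th cohomology group of the complex obtained by applying \<open>Hom(-, M)\<close> to a
  chosen resolution of \<open>Y\<close>.
\<close>

definition Ext ::
    "('b, 'p) ring_scheme \<Rightarrow> nat \<Rightarrow> ('b, 'x, 'q) module_scheme \<Rightarrow> ('b, 'm, 's) module_scheme \<Rightarrow>
     ((nat \<Rightarrow> 'b) \<Rightarrow> 'm) set monoid" where
  "Ext B i Y M =
    (let (k, d, e) = (SOME P. free_resolution B Y P);
         C = (\<lambda>j. Hom B (free B (k j)) M);
         \<delta> = (\<lambda>j f. compose (carrier (free B (k (Suc j)))) f (d j))
     in (C i)\<lparr>carrier := kernel (C i) (C (Suc i)) (\<delta> i)\<rparr>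
        Mod (case i of 0 \<Rightarrow> {\<one>\<^bsub>C 0\<^esub>} | Suc j \<Rightarrow> \<delta> j ` carrier (C j)))"

definition left_perp ::
    "('b, 'p) ring_scheme \<Rightarrow> ('b, 'm, 's) module_scheme \<Rightarrow> ('b, 'x) module set" where
  "left_perp B M =
    {Y. left_module B Y \<and> fin_gen B Y \<and> (\<forall>i \<ge> 1. trivial_group (Ext B i Y M))}"


section \<open>Artin algebras and the standard duality\<close>

definition artinian :: "('r, 'p) ring_scheme \<Rightarrow> bool" where
  "artinian R \<longleftrightarrow> (\<forall>I :: nat \<Rightarrow> 'r set.
     (\<forall>k. ideal (I k) R \<and> I (Suc k) \<subseteq> I k) \<longrightarrow> (\<exists>N. \<forall>k \<ge> N. I k = I N))"

text \<open>
  The record \<open>A\<close> carries both the ring structure of the algebra and the scalar multiplication by the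
  commutative ground ring.  The library locale \<open>algebra\<close> would force \<open>A\<close> to be commutative.
\<close>

locale artin_algebra = module R A + A: ring A
  for R :: "('r, 'p) ring_scheme" (structure) and A :: "('r, 'a, 'q) module_scheme" (structure) +
  assumes smult_mult_left:
      "\<lbrakk>r \<in> carrier R; a \<in> carrier A; b \<in> carrier A\<rbrakk> \<Longrightarrow>
        (r \<odot>\<^bsub>A\<^esub> a) \<otimes>\<^bsub>A\<^esub> b = r \<odot>\<^bsub>A\<^esub> (a \<otimes>\<^bsub>A\<^esub> b)"
    and smult_mult_right:
      "\<lbrakk>r \<in> carrier R; a \<in> carrier A; b \<in> carrier A\<rbrakk> \<Longrightarrow>
        a \<otimes>\<^bsub>A\<^esub> (r \<odot>\<^bsub>A\<^esub> b) = r \<odot>\<^bsub>A\<^esub> (a \<otimes>\<^bsub>A\<^esub> b)"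
    and artinian_ground: "artinian R"
    and fin_gen_ground: "fin_gen R A"

text \<open>The intersection is taken inside the carrier, so it is the carrier if there is no maximal ideal.\<close>

definition jacobson_radical :: "('r, 'p) ring_scheme \<Rightarrow> 'r set" where
  "jacobson_radical R = {x \<in> carrier R. \<forall>I. maximalideal I R \<longrightarrow> x \<in> I}"

definition quotient_module :: "('r, 'p) ring_scheme \<Rightarrow> 'r set \<Rightarrow> ('r, 'r set) module" where
  "quotient_module R I =
    ring.extend (R Quot I) (module.fields (\<lambda>r Y. (I +>\<^bsub>R\<^esub> r) \<otimes>\<^bsub>R Quot I\<^esub> Y))"

text \<open>
  A formula cannot quantify over all modules of all types.  The test modules here live on the type
  \<open>(nat \<Rightarrow> 'r) set\<close>, which contains a copy of every quotient of every \<open>R^k\<close>, hence of every finitely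
  generated \<open>R\<close>-module and in particular of \<open>R\<close> and its ideals; by Baer's criterion the property is
  therefore injectivity with respect to all \<open>R\<close>-modules.
\<close>

definition injective_module :: "('r, 'p) ring_scheme \<Rightarrow> ('r, 'j, 's) module_scheme \<Rightarrow> bool" where
  "injective_module R J \<longleftrightarrow> module R J \<and>
    (\<forall>(M :: ('r, (nat \<Rightarrow> 'r) set) module) (N :: ('r, (nat \<Rightarrow> 'r) set) module) f g.
       module R M \<and> module R N \<and> f \<in> lin_maps R M N \<and> inj_on f (carrier M) \<and> g \<in> lin_maps R M J
       \<longrightarrow> (\<exists>h \<in> lin_maps R N J. \<forall>x \<in> carrier M. h (f x) = g x))"

definition injective_envelope ::
    "('r, 'p) ring_scheme \<Rightarrow> ('r, 's, 'q) module_scheme \<Rightarrow> ('r, 'j, 't) module_scheme \<Rightarrow> bool" where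
  "injective_envelope R S J \<longleftrightarrow> injective_module R J \<and>
    (\<exists>e \<in> lin_maps R S J. inj_on e (carrier S) \<and>
       (\<forall>N. submodule N R J \<and> N \<noteq> {\<zero>\<^bsub>J\<^esub>} \<longrightarrow> N \<inter> e ` carrier S \<noteq> {\<zero>\<^bsub>J\<^esub>}))"

definition op_ring :: "('r, 'a, 'q) module_scheme \<Rightarrow> ('r, 'a, 'q) module_scheme" where
  "op_ring A = A\<lparr>monoid.mult := (\<lambda>x y. y \<otimes>\<^bsub>A\<^esub> x)\<rparr>"

definition restrict_scalars ::
    "('r, 'a, 'q) module_scheme \<Rightarrow> ('a, 'x, 's) module_scheme \<Rightarrow> ('r, 'x) module" where
  "restrict_scalars A M = \<lparr>carrier = carrier M, monoid.mult = monoid.mult M, monoid.one = monoid.one M,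
     ring.zero = ring.zero M, ring.add = ring.add M, smult = (\<lambda>r x. (r \<odot>\<^bsub>A\<^esub> \<one>\<^bsub>A\<^esub>) \<odot>\<^bsub>M\<^esub> x)\<rparr>"

text \<open>
  A right \<open>A\<close>-module \<open>M\<close> is a left module over \<open>op_ring A\<close>, so \<open>a \<odot>\<^bsub>M\<^esub> x\<close> below is \<open>x a\<close> in right-module
  notation.  Its dual is \<open>Hom_R(M, J)\<close> with \<open>(a f)(x) = f(x a)\<close>, where \<open>J\<close> is to be an injective
  envelope of \<open>R / rad R\<close>.
\<close>

definition dual ::
    "('r, 'p) ring_scheme \<Rightarrow> ('r, 'a, 'q) module_scheme \<Rightarrow> ('r, 'j, 't) module_scheme \<Rightarrow>
     ('a, 'x, 's) module_scheme \<Rightarrow> ('a, 'x \<Rightarrow> 'j) module" where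
  "dual R A J M =
    (let H = Hom R (restrict_scalars (op_ring A) M) J
     in \<lparr>carrier = carrier H, monoid.mult = undefined, monoid.one = undefined,
         ring.zero = \<one>\<^bsub>H\<^esub>, ring.add = monoid.mult H,
         smult = (\<lambda>a f. \<lambda>x \<in> carrier M. f (a \<odot>\<^bsub>M\<^esub> x))\<rparr>)"


section \<open>Triangular matrix rings and the morphism category\<close>

text \<open>Matrices are indexed by \<open>1, \<dots>, n\<close> and padded with zeros outside this range.\<close>

definition T_ring :: "nat \<Rightarrow> ('a, 'p) ring_scheme \<Rightarrow> (nat \<Rightarrow> nat \<Rightarrow> 'a) ring" where
  "T_ring n A = \<lparr>carrier = {a. \<forall>i j. if 1 \<le> i \<and> i \<le> j \<and> j \<le> n then a i j \<in> carrier A else a i j = \<zero>\<^bsub>A\<^esub>},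
     monoid.mult = (\<lambda>a b i j. \<Oplus>\<^bsub>A\<^esub> k \<in> {1..n}. a i k \<otimes>\<^bsub>A\<^esub> b k j),
     monoid.one = (\<lambda>i j. if i = j \<and> i \<in> {1..n} then \<one>\<^bsub>A\<^esub> else \<zero>\<^bsub>A\<^esub>),
     ring.zero = (\<lambda>i j. \<zero>\<^bsub>A\<^esub>),
     ring.add = (\<lambda>a b i j. a i j \<oplus>\<^bsub>A\<^esub> b i j)\<rparr>"

text \<open>
  An object \<open>Y n \<rightarrow> \<dots> \<rightarrow> Y 1\<close> of the morphism category consists of its branches \<open>branch Y i\<close>
  and structure maps \<open>str Y i : branch Y (i + 1) \<rightarrow> branch Y i\<close>; the values of \<open>branch Y\<close> outside
  \<open>1, \<dots>, n\<close> and of \<open>str Y\<close> outside \<open>1, \<dots>, n - 1\<close> are irrelevant.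
\<close>

record ('a, 'x) mor_obj =
  branch :: "nat \<Rightarrow> ('a, 'x) module"
  str :: "nat \<Rightarrow> 'x \<Rightarrow> 'x"

definition Mor :: "nat \<Rightarrow> ('a, 'p) ring_scheme \<Rightarrow> ('a, 'x) mor_obj set" where
  "Mor n A = {Y.
     (\<forall>i \<in> {1..n}. left_module A (branch Y i) \<and> fin_gen A (branch Y i)) \<and>
     (\<forall>i \<in> {1..<n}. str Y i \<in> lin_maps A (branch Y (Suc i)) (branch Y i))}"

definition S_cat :: "nat \<Rightarrow> ('a, 'p) ring_scheme \<Rightarrow> ('a, 'x) mor_obj set" where
  "S_cat n A = {Y \<in> Mor n A. \<forall>i \<in> {1..<n}. inj_on (str Y i) (carrier (branch Y (Suc i)))}"

definition str_comp :: "('a, 'x) mor_obj \<Rightarrow> nat \<Rightarrow> nat \<Rightarrow> 'x \<Rightarrow> 'x" where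
  "str_comp Y i j = foldr (\<lambda>k f. str Y k \<circ> f) [i..<j] id"  \<comment> \<open>\<open>\<phi>\<^sub>i \<circ> \<dots> \<circ> \<phi>\<^sub>j\<^sub>-\<^sub>1\<close>\<close>

text \<open>The identification of objects of the morphism category with modules over \<open>T_ring n A\<close>.\<close>

definition T_module :: "nat \<Rightarrow> ('a, 'x) mor_obj \<Rightarrow> (nat \<Rightarrow> nat \<Rightarrow> 'a, nat \<Rightarrow> 'x) module" where
  "T_module n Y = (let B = dsum {1..n} (branch Y) in
     \<lparr>carrier = carrier B, monoid.mult = undefined, monoid.one = undefined,
      ring.zero = ring.zero B, ring.add = ring.add B,
      smult = (\<lambda>a x. \<lambda>i \<in> {1..n}. a i i \<odot>\<^bsub>branch Y i\<^esub> x i \<oplus>\<^bsub>branch Y i\<^esub>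
        (\<Oplus>\<^bsub>branch Y i\<^esub> j \<in> {i<..n}. a i j \<odot>\<^bsub>branch Y i\<^esub> str_comp Y i j (x j)))\<rparr>)"

definition m_obj :: "('a, 'x) module \<Rightarrow> nat \<Rightarrow> ('a, 'x) mor_obj" where
  "m_obj M i = \<lparr>branch = (\<lambda>j. if j \<le> i then M else M\<lparr>carrier := {\<zero>\<^bsub>M\<^esub>}\<rparr>),
     str = (\<lambda>j. if j < i then id else (\<lambda>_. \<zero>\<^bsub>M\<^esub>))\<rparr>"

definition mor_dsum :: "'i set \<Rightarrow> ('i \<Rightarrow> ('a, 'x) mor_obj) \<Rightarrow> ('a, 'i \<Rightarrow> 'x) mor_obj" where
  "mor_dsum I F = \<lparr>branch = (\<lambda>j. dsum I (\<lambda>i. branch (F i) j)),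
     str = (\<lambda>j x. \<lambda>i \<in> I. str (F i) j (x i))\<rparr>"

definition m_sum :: "nat \<Rightarrow> ('a, 'x) module \<Rightarrow> ('a, nat \<Rightarrow> 'x) mor_obj" where
  "m_sum n M = mor_dsum {1..n} (m_obj M)"

end

theory Submission
  imports Defs
begin

text \<open>
  Let \<open>T\<close> be the ring of triangular matrices, with matrix units \<open>e\<^sub>i\<^sub>j\<close>, let \<open>D\<close> be the dual of the
  regular right \<open>A\<close>-module and \<open>N\<close> the \<open>T\<close>-module belonging to the direct sum of the \<open>m\<^sub>i(D)\<close>.  The
  \<open>i\<close>-th branch of a \<open>T\<close>-module \<open>P\<close> is \<open>P\<^sub>i = e\<^sub>i\<^sub>i P\<close>, and multiplication by \<open>e\<^sub>1\<^sub>i\<close> is the composite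
  structure map \<open>P\<^sub>i \<rightarrow> P\<^sub>1\<close>.  A morphism \<open>P \<rightarrow> m\<^sub>i(D)\<close> is determined by its first component \<open>P\<^sub>1 \<rightarrow> D\<close>,
  which is subject to the single condition that it vanishes on the image of \<open>P\<^sub>i\<^sub>+\<^sub>1\<close>.  Since
  \<open>Hom\<^sub>A(-, D) = Hom\<^sub>R(-, J)\<close>, this gives \<open>Hom\<^sub>T(P, m\<^sub>i(D)) = Hom\<^sub>R(C\<^sub>i(P), J)\<close>, where \<open>C\<^sub>i(P)\<close> is the
  cokernel of \<open>P\<^sub>i\<^sub>+\<^sub>1 \<rightarrow> P\<^sub>1\<close> and \<open>P\<^sub>n\<^sub>+\<^sub>1 = 0\<close>.

  Let \<open>P\<close> be a free resolution of the \<open>T\<close>-module \<open>X\<close>.  As \<open>J\<close> is injective, \<open>Ext\<^sup>k(X, m\<^sub>i(D))\<close> is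
  \<open>Hom\<^sub>R(H\<^sub>k(C\<^sub>i(P)), J)\<close>.  Free modules have injective structure maps, so
  \<open>0 \<rightarrow> P\<^sub>i\<^sub>+\<^sub>1 \<rightarrow> P\<^sub>1 \<rightarrow> C\<^sub>i(P) \<rightarrow> 0\<close> is an exact sequence of complexes whose first two terms resolve
  \<open>X\<^sub>i\<^sub>+\<^sub>1\<close> and \<open>X\<^sub>1\<close>.  Hence the homology of \<open>C\<^sub>i(P)\<close> vanishes in degrees above one, and in degree one
  it is the kernel of \<open>X\<^sub>i\<^sub>+\<^sub>1 \<rightarrow> X\<^sub>1\<close>.  As \<open>J\<close> is a cogenerator, all extension groups vanish if and
  only if all composites \<open>X\<^sub>i\<^sub>+\<^sub>1 \<rightarrow> X\<^sub>1\<close> are injective, that is, if and only if all structure maps are.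

  The two directions are \<open>Hom_N_exact\<close> and \<open>mono_type_if_cocycles_are_coboundaries\<close>, where the
  homological argument is carried out on elements.  The correspondence between maps into \<open>N\<close> and
  functionals is given by \<open>functional_unit\<close> and \<open>from_functionals_lin\<close>.  That \<open>J\<close> is injective with
  respect to all modules is \<open>injective_extend_graph\<close>, and that it is a cogenerator is
  \<open>injective_envelope_cogenerator\<close>; the latter uses that every simple \<open>R\<close>-module embeds into
  \<open>R / rad R\<close>.  Finally, Ext is computed from a resolution by free modules of finite rank.  It exists
  because an artinian commutative ring is noetherian (\<open>artinian_imp_fg_ideals\<close>) and \<open>T\<close> is finitely
  generated over \<open>R\<close>.
\<close>

section \<open>Submodules and linear spans\<close>

context left_module
begin

lemma left_module: "left_module R M" ..

lemma smult_l_null [simp]: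
  assumes "x \<in> carrier M" shows "\<zero> \<odot>\<^bsub>M\<^esub> x = \<zero>\<^bsub>M\<^esub>"
proof -
  have "\<zero> \<odot>\<^bsub>M\<^esub> x \<oplus>\<^bsub>M\<^esub> \<zero> \<odot>\<^bsub>M\<^esub> x = \<zero> \<odot>\<^bsub>M\<^esub> x"
    using smult_l_distr[of \<zero> \<zero> x] assms by simp
  then show ?thesis using assms by (metis M.add.r_cancel_one R.zero_closed smult_closed)
qed

lemma smult_r_null [simp]:
  assumes "a \<in> carrier R" shows "a \<odot>\<^bsub>M\<^esub> \<zero>\<^bsub>M\<^esub> = \<zero>\<^bsub>M\<^esub>"
proof -
  have "a \<odot>\<^bsub>M\<^esub> \<zero>\<^bsub>M\<^esub> \<oplus>\<^bsub>M\<^esub> a \<odot>\<^bsub>M\<^esub> \<zero>\<^bsub>M\<^esub> = a \<odot>\<^bsub>M\<^esub> \<zero>\<^bsub>M\<^esub>"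
    using smult_r_distr[of a "\<zero>\<^bsub>M\<^esub>" "\<zero>\<^bsub>M\<^esub>"] assms by simp
  then show ?thesis using assms by (metis M.add.r_cancel_one M.zero_closed smult_closed)
qed

lemma smult_l_minus:
  assumes "a \<in> carrier R" "x \<in> carrier M" shows "(\<ominus> a) \<odot>\<^bsub>M\<^esub> x = \<ominus>\<^bsub>M\<^esub> (a \<odot>\<^bsub>M\<^esub> x)"
  using assms smult_l_distr[of "\<ominus> a" a x]
  by (metis M.minus_equality R.add.inv_closed R.l_neg smult_closed smult_l_null)

lemma smult_r_minus:
  assumes "a \<in> carrier R" "x \<in> carrier M" shows "a \<odot>\<^bsub>M\<^esub> (\<ominus>\<^bsub>M\<^esub> x) = \<ominus>\<^bsub>M\<^esub> (a \<odot>\<^bsub>M\<^esub> x)"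
  using assms smult_r_distr[of a "\<ominus>\<^bsub>M\<^esub> x" x]
  by (metis M.minus_equality M.a_inv_closed M.l_neg smult_closed smult_r_null)

lemma smult_minus_one: "x \<in> carrier M \<Longrightarrow> (\<ominus> \<one>) \<odot>\<^bsub>M\<^esub> x = \<ominus>\<^bsub>M\<^esub> x"
  by (simp add: smult_l_minus)

lemma finsum_smult:
  assumes "finite I" "a \<in> carrier R" "f \<in> I \<rightarrow> carrier M"
  shows "a \<odot>\<^bsub>M\<^esub> (\<Oplus>\<^bsub>M\<^esub> i \<in> I. f i) = (\<Oplus>\<^bsub>M\<^esub> i \<in> I. a \<odot>\<^bsub>M\<^esub> f i)"
  using assms by (induct set: finite) (simp_all add: Pi_def smult_r_distr)

text \<open>
  Closure under negation is automatic, because negation is multiplication by \<open>- 1\<close>.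
\<close>

lemma submodule_iff:
  "submodule H R M \<longleftrightarrow> H \<subseteq> carrier M \<and> \<zero>\<^bsub>M\<^esub> \<in> H \<and>
     (\<forall>x \<in> H. \<forall>y \<in> H. x \<oplus>\<^bsub>M\<^esub> y \<in> H) \<and> (\<forall>a \<in> carrier R. \<forall>x \<in> H. a \<odot>\<^bsub>M\<^esub> x \<in> H)"
  (is "_ \<longleftrightarrow> ?rhs")
proof
  assume "submodule H R M"
  then interpret submodule H R M .
  show ?rhs using subset one_closed m_closed by auto
next
  assume r: ?rhs
  have "\<ominus>\<^bsub>M\<^esub> x \<in> H" if "x \<in> H" for x
    using that r smult_minus_one[of x] R.add.inv_closed[OF R.one_closed] by (metis subsetD)
  with r show "submodule H R M"
    by (intro submodule.intro subgroup.intro submodule_axioms.intro) (auto simp: a_inv_def)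
qed

lemmas submoduleI = submodule_iff[THEN iffD2, OF conjI, OF _ conjI, OF _ _ conjI, rule_format]

lemma submoduleD:
  assumes "submodule H R M"
  shows "H \<subseteq> carrier M" and "\<zero>\<^bsub>M\<^esub> \<in> H"
    and "x \<in> H \<Longrightarrow> x \<in> carrier M"
    and "x \<in> H \<Longrightarrow> y \<in> H \<Longrightarrow> x \<oplus>\<^bsub>M\<^esub> y \<in> H"
    and "a \<in> carrier R \<Longrightarrow> x \<in> H \<Longrightarrow> a \<odot>\<^bsub>M\<^esub> x \<in> H"
    and "x \<in> H \<Longrightarrow> \<ominus>\<^bsub>M\<^esub> x \<in> H"
proof -
  note s = assms[unfolded submodule_iff]
  show H: "H \<subseteq> carrier M" and "\<zero>\<^bsub>M\<^esub> \<in> H"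
    and "x \<in> H \<Longrightarrow> x \<in> carrier M"
    and "x \<in> H \<Longrightarrow> y \<in> H \<Longrightarrow> x \<oplus>\<^bsub>M\<^esub> y \<in> H"
    and sm: "\<And>a. a \<in> carrier R \<Longrightarrow> x \<in> H \<Longrightarrow> a \<odot>\<^bsub>M\<^esub> x \<in> H" for x
    using s by blast+
  show "\<ominus>\<^bsub>M\<^esub> x \<in> H" if "x \<in> H"
    using sm[OF R.add.inv_closed[OF R.one_closed] that] smult_minus_one[of x] that H by auto
qed

lemma submodule_finsum:
  assumes "submodule H R M" "finite I" "f \<in> I \<rightarrow> H"
  shows "(\<Oplus>\<^bsub>M\<^esub> i \<in> I. f i) \<in> H"
  using assms(2,3)
proof (induct set: finite)
  case empty then show ?case using submoduleD(2)[OF assms(1)] by simp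
next
  case (insert i I)
  then show ?case using submoduleD(3,4)[OF assms(1)] by (simp add: Pi_iff)
qed

lemma left_module_submodule:
  assumes "submodule H R M" shows "left_module R (M\<lparr>carrier := H\<rparr>)"
proof -
  note h = submoduleD[OF assms]
  show ?thesis
  proof (intro left_module.intro abelian_groupI left_module_axioms.intro R.ring_axioms)
    show "\<exists>y \<in> carrier (M\<lparr>carrier := H\<rparr>). y \<oplus>\<^bsub>M\<lparr>carrier := H\<rparr>\<^esub> x = \<zero>\<^bsub>M\<lparr>carrier := H\<rparr>\<^esub>"
      if "x \<in> carrier (M\<lparr>carrier := H\<rparr>)" for x
      using that h(3,6)[of x] by (intro bexI[of _ "\<ominus>\<^bsub>M\<^esub> x"]) (auto simp: M.l_neg)
  qed (auto simp: h M.a_ac smult_l_distr smult_r_distr smult_assoc1)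
qed

lemma submodule_carrier: "submodule (carrier M) R M"
  by (rule submoduleI) auto

lemma submodule_zero: "submodule {\<zero>\<^bsub>M\<^esub>} R M"
  by (rule submoduleI) auto

lemma submodule_inter: "submodule H R M \<Longrightarrow> submodule K R M \<Longrightarrow> submodule (H \<inter> K) R M"
  by (rule submoduleI) (auto simp: submoduleD)

text \<open>
  Adjoining one element is the induction step in the finiteness results and in Baer's criterion.
\<close>

lemma submodule_add_cyclic:
  assumes S: "submodule S R M" and g: "g \<in> carrier M"
  shows "submodule {s \<oplus>\<^bsub>M\<^esub> a \<odot>\<^bsub>M\<^esub> g | s a. s \<in> S \<and> a \<in> carrier R} R M" (is "submodule ?H R M")
proof (rule submoduleI)
  note s = submoduleD[OF S]
  show "?H \<subseteq> carrier M" using s(1) g by auto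
  show "\<zero>\<^bsub>M\<^esub> \<in> ?H" using s(2) g R.zero_closed
    by (auto intro!: exI[of _ "\<zero>\<^bsub>M\<^esub>"] exI[of _ "\<zero>"])
  show "x \<oplus>\<^bsub>M\<^esub> y \<in> ?H" if xy: "x \<in> ?H" "y \<in> ?H" for x y
  proof -
    obtain u a v b where u: "u \<in> S" "a \<in> carrier R" "x = u \<oplus>\<^bsub>M\<^esub> a \<odot>\<^bsub>M\<^esub> g"
      and v: "v \<in> S" "b \<in> carrier R" "y = v \<oplus>\<^bsub>M\<^esub> b \<odot>\<^bsub>M\<^esub> g" using xy by blast
    have "x \<oplus>\<^bsub>M\<^esub> y = (u \<oplus>\<^bsub>M\<^esub> v) \<oplus>\<^bsub>M\<^esub> (a \<oplus> b) \<odot>\<^bsub>M\<^esub> g"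
      using u v g s(3) by (simp add: smult_l_distr M.a_ac)
    then show ?thesis using s(4) u(1,2) v(1,2) R.a_closed by blast
  qed
  show "b \<odot>\<^bsub>M\<^esub> x \<in> ?H" if b: "b \<in> carrier R" and x: "x \<in> ?H" for b x
  proof -
    obtain u a where u: "u \<in> S" "a \<in> carrier R" "x = u \<oplus>\<^bsub>M\<^esub> a \<odot>\<^bsub>M\<^esub> g" using x by blast
    have "b \<odot>\<^bsub>M\<^esub> x = b \<odot>\<^bsub>M\<^esub> u \<oplus>\<^bsub>M\<^esub> (b \<otimes> a) \<odot>\<^bsub>M\<^esub> g"
      using u b g s(3) by (simp add: smult_r_distr smult_assoc1)
    then show ?thesis using s(5) u(1,2) b R.m_closed by blast
  qed
qed

lemma submodule_Union_chain:
  assumes "\<C> \<noteq> {}" "subset.chain {H. submodule H R M} \<C>"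
  shows "submodule (\<Union>\<C>) R M"
proof (rule submoduleI)
  have s: "submodule H R M" if "H \<in> \<C>" for H using assms(2) that by (auto simp: subset.chain_def)
  show "\<Union>\<C> \<subseteq> carrier M" using submoduleD(1)[OF s] by blast
  show "\<zero>\<^bsub>M\<^esub> \<in> \<Union>\<C>" using submoduleD(2)[OF s] assms(1) by blast
  show "a \<odot>\<^bsub>M\<^esub> x \<in> \<Union>\<C>" if "a \<in> carrier R" "x \<in> \<Union>\<C>" for a x
    using submoduleD(5)[OF s that(1)] that(2) by blast
  show "x \<oplus>\<^bsub>M\<^esub> y \<in> \<Union>\<C>" if xy: "x \<in> \<Union>\<C>" "y \<in> \<Union>\<C>" for x y
  proof -
    obtain H K where HK: "H \<in> \<C>" "x \<in> H" "K \<in> \<C>" "y \<in> K" using xy by blast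
    have "H \<subseteq> K \<or> K \<subseteq> H" using subset_chain_def assms(2) HK by (metis (no_types, lifting))
    then obtain L where "L \<in> \<C>" "x \<in> L" "y \<in> L" using HK by blast
    then show ?thesis using submoduleD(4)[OF s] by blast
  qed
qed

text \<open>
  Zorn's lemma.  The property \<open>Q\<close> will say that a submodule contains, or is contained in, a given one
  and avoids certain elements; such properties pass to unions of chains.
\<close>

lemma exists_maximal_submodule:
  assumes H: "submodule H R M" "Q H"
    and union: "\<And>\<C>. \<C> \<noteq> {} \<Longrightarrow> (\<And>K. K \<in> \<C> \<Longrightarrow> Q K) \<Longrightarrow> Q (\<Union>\<C>)"
  obtains K where "submodule K R M" "Q K"
    and "\<And>L. \<lbrakk>submodule L R M; Q L; K \<subseteq> L\<rbrakk> \<Longrightarrow> L = K"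
proof -
  let ?F = "{K. submodule K R M \<and> Q K}"
  have "\<exists>K \<in> ?F. \<forall>L \<in> ?F. K \<subseteq> L \<longrightarrow> L = K"
  proof (rule subset_Zorn_nonempty)
    show "?F \<noteq> {}" using H by blast
    fix \<C> assume C: "\<C> \<noteq> {}" "subset.chain ?F \<C>"
    have "submodule (\<Union>\<C>) R M" using C by (intro submodule_Union_chain) (auto simp: subset_chain_def)
    moreover have "Q (\<Union>\<C>)" using C by (intro union) (auto simp: subset_chain_def)
    ultimately show "\<Union>\<C> \<in> ?F" by simp
  qed
  then show thesis using that by blast
qed

end


definition lin_span ::
    "('a, 'p) ring_scheme \<Rightarrow> ('a, 'x, 'q) module_scheme \<Rightarrow> 'x set \<Rightarrow> 'x set" where
  "lin_span B M G = \<Inter>{H. submodule H B M \<and> G \<subseteq> H}"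

lemma lin_span_least: "submodule H B M \<Longrightarrow> G \<subseteq> H \<Longrightarrow> lin_span B M G \<subseteq> H"
  unfolding lin_span_def by blast

lemma lin_span_incl: "G \<subseteq> lin_span B M G"
  unfolding lin_span_def by blast

context left_module
begin

lemma submodule_lin_span: "G \<subseteq> carrier M \<Longrightarrow> submodule (lin_span R M G) R M"
  
proof (rule submoduleI)
  assume G: "G \<subseteq> carrier M"
  show "lin_span R M G \<subseteq> carrier M" using lin_span_least[OF submodule_carrier G] .
qed (auto simp: lin_span_def submoduleD)

lemma lin_span_mono:
  assumes "G \<subseteq> G'" "G' \<subseteq> carrier M" shows "lin_span R M G \<subseteq> lin_span R M G'"
  using assms lin_span_least[OF submodule_lin_span] lin_span_incl by (metis subset_trans)

text \<open>
  Links spans to the linear combinations in \<open>fin_gen\<close> and, for \<open>I = {..<k}\<close>, to the images of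
  maps out of free modules.
\<close>

lemma lin_span_eq_combinations:
  assumes I: "finite I" and g: "g \<in> I \<rightarrow> carrier M"
  shows "lin_span R M (g ` I) = (\<lambda>c. \<Oplus>\<^bsub>M\<^esub> i \<in> I. c i \<odot>\<^bsub>M\<^esub> g i) ` (I \<rightarrow> carrier R)" (is "_ = ?C")
proof
  have cl: "(\<lambda>i. c i \<odot>\<^bsub>M\<^esub> g i) \<in> I \<rightarrow> carrier M" if "c \<in> I \<rightarrow> carrier R" for c
    using that g by auto
  show "lin_span R M (g ` I) \<subseteq> ?C"
  proof (rule lin_span_least)
    show "submodule ?C R M"
    proof (rule submoduleI)
      show "?C \<subseteq> carrier M" using M.finsum_closed[OF cl] by auto
      have "(\<Oplus>\<^bsub>M\<^esub> i \<in> I. \<zero> \<odot>\<^bsub>M\<^esub> g i) = \<zero>\<^bsub>M\<^esub>"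
        using g by (intro M.add.finprod_one_eqI) (simp add: Pi_iff)
      then show "\<zero>\<^bsub>M\<^esub> \<in> ?C" by (intro image_eqI[of _ _ "\<lambda>_. \<zero>"]) auto
    next
      fix x y assume "x \<in> ?C" "y \<in> ?C"
      then obtain c d where c: "c \<in> I \<rightarrow> carrier R" "x = (\<Oplus>\<^bsub>M\<^esub> i \<in> I. c i \<odot>\<^bsub>M\<^esub> g i)"
        and d: "d \<in> I \<rightarrow> carrier R" "y = (\<Oplus>\<^bsub>M\<^esub> i \<in> I. d i \<odot>\<^bsub>M\<^esub> g i)" by blast
      have "x \<oplus>\<^bsub>M\<^esub> y = (\<Oplus>\<^bsub>M\<^esub> i \<in> I. c i \<odot>\<^bsub>M\<^esub> g i \<oplus>\<^bsub>M\<^esub> d i \<odot>\<^bsub>M\<^esub> g i)"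
        unfolding c(2) d(2) using M.finsum_addf[OF cl[OF c(1)] cl[OF d(1)]] by simp
      also have "\<dots> = (\<Oplus>\<^bsub>M\<^esub> i \<in> I. (c i \<oplus> d i) \<odot>\<^bsub>M\<^esub> g i)"
        using c(1) d(1) g by (intro M.finsum_cong') (auto simp: smult_l_distr Pi_iff)
      finally show "x \<oplus>\<^bsub>M\<^esub> y \<in> ?C"
        using c(1) d(1) by (intro image_eqI[of _ _ "\<lambda>i. c i \<oplus> d i"]) auto
    next
      fix a x assume a: "a \<in> carrier R" and "x \<in> ?C"
      then obtain c where c: "c \<in> I \<rightarrow> carrier R" "x = (\<Oplus>\<^bsub>M\<^esub> i \<in> I. c i \<odot>\<^bsub>M\<^esub> g i)" by blast
      have "a \<odot>\<^bsub>M\<^esub> x = (\<Oplus>\<^bsub>M\<^esub> i \<in> I. a \<odot>\<^bsub>M\<^esub> (c i \<odot>\<^bsub>M\<^esub> g i))"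
        unfolding c(2) by (rule finsum_smult[OF I a cl[OF c(1)]])
      also have "\<dots> = (\<Oplus>\<^bsub>M\<^esub> i \<in> I. (a \<otimes> c i) \<odot>\<^bsub>M\<^esub> g i)"
        using a c(1) g by (intro M.finsum_cong') (auto simp: smult_assoc1 Pi_iff)
      finally show "a \<odot>\<^bsub>M\<^esub> x \<in> ?C"
        using c(1) a by (intro image_eqI[of _ _ "\<lambda>i. a \<otimes> c i"]) auto
    qed
    show "g ` I \<subseteq> ?C"
    proof
      fix x assume "x \<in> g ` I"
      then obtain i where i: "i \<in> I" "x = g i" by blast
      have "(\<Oplus>\<^bsub>M\<^esub> j \<in> I. (if i = j then \<one> else \<zero>) \<odot>\<^bsub>M\<^esub> g j)
          = (\<Oplus>\<^bsub>M\<^esub> j \<in> I. if i = j then g j else \<zero>\<^bsub>M\<^esub>)"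
        using g by (intro M.finsum_cong') (auto simp: Pi_iff)
      also have "\<dots> = g i" using M.finsum_singleton[OF i(1) I g] .
      finally show "x \<in> ?C"
        unfolding i(2) by (intro image_eqI[of _ _ "\<lambda>j. if i = j then \<one> else \<zero>"]) auto
    qed
  qed
  have s: "submodule (lin_span R M (g ` I)) R M" using g by (intro submodule_lin_span) auto
  show "?C \<subseteq> lin_span R M (g ` I)"
  proof
    fix x assume "x \<in> ?C"
    then obtain c where c: "c \<in> I \<rightarrow> carrier R" "x = (\<Oplus>\<^bsub>M\<^esub> i \<in> I. c i \<odot>\<^bsub>M\<^esub> g i)" by blast
    show "x \<in> lin_span R M (g ` I)"
      unfolding c(2) using submoduleD(5)[OF s] c(1) lin_span_incl[of "g ` I" R M]
      by (intro submodule_finsum I s) (simp add: Pi_iff image_subset_iff)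
  qed
qed

lemma fin_gen_iff_lin_span:
  "fin_gen R M \<longleftrightarrow> (\<exists>G. finite G \<and> G \<subseteq> carrier M \<and> lin_span R M G = carrier M)"
proof -
  have "(\<forall>x \<in> carrier M. \<exists>c \<in> G \<rightarrow> carrier R. x = (\<Oplus>\<^bsub>M\<^esub> g \<in> G. c g \<odot>\<^bsub>M\<^esub> g))
      \<longleftrightarrow> lin_span R M G = carrier M" if G: "finite G" "G \<subseteq> carrier M" for G
  proof -
    have "lin_span R M G \<subseteq> carrier M" using lin_span_least[OF submodule_carrier G(2)] .
    moreover have "lin_span R M G = (\<lambda>c. \<Oplus>\<^bsub>M\<^esub> g \<in> G. c g \<odot>\<^bsub>M\<^esub> g) ` (G \<rightarrow> carrier R)"
      using lin_span_eq_combinations[OF G(1), of "\<lambda>g. g"] G(2) by auto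
    ultimately show ?thesis by blast
  qed
  then show ?thesis unfolding fin_gen_def by (simp cong: conj_cong)
qed

end


section \<open>Linear maps\<close>

lemma lin_mapsI:
  assumes "\<And>x. x \<in> carrier M \<Longrightarrow> f x \<in> carrier N"
    and "\<And>x y. x \<in> carrier M \<Longrightarrow> y \<in> carrier M \<Longrightarrow> f (x \<oplus>\<^bsub>M\<^esub> y) = f x \<oplus>\<^bsub>N\<^esub> f y"
    and "\<And>a x. a \<in> carrier B \<Longrightarrow> x \<in> carrier M \<Longrightarrow> f (a \<odot>\<^bsub>M\<^esub> x) = a \<odot>\<^bsub>N\<^esub> f x"
  shows "f \<in> lin_maps B M N"
  using assms unfolding lin_maps_def by blast

lemma lin_mapsD:
  assumes "f \<in> lin_maps B M N"
  shows "x \<in> carrier M \<Longrightarrow> f x \<in> carrier N"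
    and "x \<in> carrier M \<Longrightarrow> y \<in> carrier M \<Longrightarrow> f (x \<oplus>\<^bsub>M\<^esub> y) = f x \<oplus>\<^bsub>N\<^esub> f y"
    and "a \<in> carrier B \<Longrightarrow> x \<in> carrier M \<Longrightarrow> f (a \<odot>\<^bsub>M\<^esub> x) = a \<odot>\<^bsub>N\<^esub> f x"
  using assms unfolding lin_maps_def by blast+

lemma lin_maps_zero:
  assumes "left_module B M" "left_module B N" "f \<in> lin_maps B M N"
  shows "f \<zero>\<^bsub>M\<^esub> = \<zero>\<^bsub>N\<^esub>"
proof -
  interpret M: left_module B M by fact
  interpret N: left_module B N by fact
  have "f (\<zero>\<^bsub>B\<^esub> \<odot>\<^bsub>M\<^esub> \<zero>\<^bsub>M\<^esub>) = \<zero>\<^bsub>B\<^esub> \<odot>\<^bsub>N\<^esub> f \<zero>\<^bsub>M\<^esub>"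
    by (rule lin_mapsD(3)[OF assms(3)]) auto
  then show ?thesis using lin_mapsD(1)[OF assms(3)] by simp
qed

lemma lin_maps_minus:
  assumes "left_module B M" "left_module B N" "f \<in> lin_maps B M N" "x \<in> carrier M"
  shows "f (\<ominus>\<^bsub>M\<^esub> x) = \<ominus>\<^bsub>N\<^esub> f x"
proof -
  interpret M: left_module B M by fact
  interpret N: left_module B N by fact
  show ?thesis
    using lin_mapsD[OF assms(3)] assms(4) by (metis M.R.add.inv_closed M.R.one_closed
      M.smult_minus_one N.smult_minus_one)
qed

lemma submodule_vimage:
  assumes "left_module B M" "left_module B N" "f \<in> lin_maps B M N" "submodule H B N"
  shows "submodule {x \<in> carrier M. f x \<in> H} B M"
proof -
  interpret M: left_module B M by fact
  interpret N: left_module B N by fact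
  show ?thesis
    by (rule M.submoduleI)
      (auto simp: lin_mapsD[OF assms(3)] lin_maps_zero[OF assms(1-3)] N.submoduleD[OF assms(4)])
qed

lemma submodule_image:
  assumes "left_module B M" "left_module B N" "f \<in> lin_maps B M N" "submodule H B M"
  shows "submodule (f ` H) B N"
proof -
  interpret M: left_module B M by fact
  interpret N: left_module B N by fact
  note H = M.submoduleD[OF assms(4)]
  show ?thesis
  proof (rule N.submoduleI)
    show "f ` H \<subseteq> carrier N" using H(1) lin_mapsD(1)[OF assms(3)] by auto
    show "\<zero>\<^bsub>N\<^esub> \<in> f ` H" using H(2) lin_maps_zero[OF assms(1-3)] by (metis imageI)
    show "x \<oplus>\<^bsub>N\<^esub> y \<in> f ` H" if xy: "x \<in> f ` H" "y \<in> f ` H" for x y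
    proof -
      obtain u v where uv: "u \<in> H" "v \<in> H" "x = f u" "y = f v" using xy by blast
      then have "x \<oplus>\<^bsub>N\<^esub> y = f (u \<oplus>\<^bsub>M\<^esub> v)" using lin_mapsD(2)[OF assms(3)] H(3) by simp
      then show ?thesis using H(4) uv by blast
    qed
    show "a \<odot>\<^bsub>N\<^esub> x \<in> f ` H" if a: "a \<in> carrier B" and x: "x \<in> f ` H" for a x
    proof -
      obtain u where u: "u \<in> H" "x = f u" using x by blast
      then have "a \<odot>\<^bsub>N\<^esub> x = f (a \<odot>\<^bsub>M\<^esub> u)" using lin_mapsD(3)[OF assms(3)] a H(3) by simp
      then show ?thesis using H(5) a u by blast
    qed
  qed
qed


section \<open>Direct sums and free modules\<close>

lemma left_module_regular:
  assumes "ring B" shows "left_module B (regular B)"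
proof -
  interpret ring B by fact
  show ?thesis
  proof (intro left_module.intro abelian_groupI left_module_axioms.intro)
    show "\<exists>y \<in> carrier (regular B). y \<oplus>\<^bsub>regular B\<^esub> x = \<zero>\<^bsub>regular B\<^esub>"
      if "x \<in> carrier (regular B)" for x
      using that l_neg[of x] by (auto simp: regular_def)
  qed (auto simp: regular_def ring_axioms a_ac l_distr r_distr m_assoc)
qed

lemma left_module_dsum:
  assumes "ring B" "\<And>i. i \<in> I \<Longrightarrow> left_module B (M i)"
  shows "left_module B (dsum I M)"
proof -
  interpret ring B by fact
  note lm = assms(2)
  have mon: "abelian_monoid (M i)" if "i \<in> I" for i
    using lm[OF that] by (simp add: left_module_def abelian_group_def)
  show ?thesis
  proof (intro left_module.intro abelian_groupI left_module_axioms.intro)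
    show "ring B" ..
  next
    fix x assume x: "x \<in> carrier (dsum I M)"
    define y where "y = (\<lambda>i \<in> I. \<ominus>\<^bsub>M i\<^esub> x i)"
    have "\<ominus>\<^bsub>M i\<^esub> x i \<in> carrier (M i) \<and> \<ominus>\<^bsub>M i\<^esub> x i \<oplus>\<^bsub>M i\<^esub> x i = \<zero>\<^bsub>M i\<^esub>" if i: "i \<in> I" for i
    proof -
      interpret left_module B "M i" by (rule assms(2)[OF i])
      show ?thesis using x i by (auto simp: dsum_def PiE_iff M.l_neg)
    qed
    then have "y \<in> carrier (dsum I M)" "y \<oplus>\<^bsub>dsum I M\<^esub> x = \<zero>\<^bsub>dsum I M\<^esub>"
      by (auto simp: y_def dsum_def intro!: restrict_ext)
    then show "\<exists>y \<in> carrier (dsum I M). y \<oplus>\<^bsub>dsum I M\<^esub> x = \<zero>\<^bsub>dsum I M\<^esub>" by blast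
  qed (auto simp: dsum_def PiE_iff lm mon
      abelian_monoid.a_closed abelian_monoid.a_assoc abelian_monoid.zero_closed abelian_monoid.l_zero
      left_module.smult_closed[OF lm] left_module.smult_l_distr[OF lm]
      left_module.smult_r_distr[OF lm] left_module.smult_assoc1[OF lm] left_module.smult_one[OF lm]
      intro: abelian_monoid.a_comm intro!: restrict_ext extensionalityI[of _ I])
qed

text \<open>
  Coordinates are filled in one at a time, starting from the zero tuple.
\<close>

lemma dsum_induct [consumes 3, case_names module zero add single]:
  assumes "ring B" and fin: "finite I" and x: "x \<in> carrier (dsum I M)"
    and lm: "\<And>i. i \<in> I \<Longrightarrow> left_module B (M i)"
    and zero: "P \<zero>\<^bsub>dsum I M\<^esub>"
    and add: "\<And>u v. \<lbrakk>P u; P v\<rbrakk> \<Longrightarrow> P (u \<oplus>\<^bsub>dsum I M\<^esub> v)"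
    and single: "\<And>i y. \<lbrakk>i \<in> I; y \<in> carrier (M i)\<rbrakk> \<Longrightarrow> P (\<lambda>k \<in> I. if k = i then y else \<zero>\<^bsub>M k\<^esub>)"
  shows "P x"
proof -
  define r where "r S = (\<lambda>k \<in> I. if k \<in> S then x k else \<zero>\<^bsub>M k\<^esub>)" for S
  have xk: "x k \<in> carrier (M k)" if "k \<in> I" for k using x that by (auto simp: dsum_def)
  have "P (r S)" if "finite S" "S \<subseteq> I" for S
    using that
  proof (induct S)
    case empty
    have "r {} = \<zero>\<^bsub>dsum I M\<^esub>" by (simp add: r_def dsum_def)
    then show ?case using zero by simp
  next
    case (insert i S)
    have "r (insert i S) = r S \<oplus>\<^bsub>dsum I M\<^esub> (\<lambda>k \<in> I. if k = i then x i else \<zero>\<^bsub>M k\<^esub>)"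
      unfolding r_def dsum_def module.simps ring.simps partial_object.simps monoid.simps
    proof (rule restrict_ext)
      fix k assume k: "k \<in> I"
      interpret left_module B "M k" by (rule lm[OF k])
      show "(if k \<in> insert i S then x k else \<zero>\<^bsub>M k\<^esub>)
        = (\<lambda>k \<in> I. if k \<in> S then x k else \<zero>\<^bsub>M k\<^esub>) k \<oplus>\<^bsub>M k\<^esub> (\<lambda>k \<in> I. if k = i then x i else \<zero>\<^bsub>M k\<^esub>) k"
      proof (cases "k = i")
        case True
        then have "\<zero>\<^bsub>M i\<^esub> \<oplus>\<^bsub>M i\<^esub> x i = x i" using M.l_zero[OF xk[OF k]] by simp
        then show ?thesis using True k insert(2) by simp
      next
        case False
        then show ?thesis using k xk[OF k] by simp
      qed
    qed
    then show ?case using add insert(3,4) single[of i "x i"] xk by simp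
  qed
  then have "P (r I)" using fin by simp
  moreover have "r I = (\<lambda>k \<in> I. x k)" unfolding r_def by (intro restrict_ext) simp
  moreover have "(\<lambda>k \<in> I. x k) = x" using x by (simp add: dsum_def PiE_restrict)
  ultimately show ?thesis by simp
qed

lemma left_module_free: "ring B \<Longrightarrow> left_module B (free B k)"
  unfolding free_def by (intro left_module_dsum left_module_regular)

lemma free_simps:
  "carrier (free B k) = {..<k} \<rightarrow>\<^sub>E carrier B"
  "\<zero>\<^bsub>free B k\<^esub> = (\<lambda>i \<in> {..<k}. \<zero>\<^bsub>B\<^esub>)"
  "x \<oplus>\<^bsub>free B k\<^esub> y = (\<lambda>i \<in> {..<k}. x i \<oplus>\<^bsub>B\<^esub> y i)"
  "a \<odot>\<^bsub>free B k\<^esub> x = (\<lambda>i \<in> {..<k}. a \<otimes>\<^bsub>B\<^esub> x i)"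
  by (simp_all add: free_def dsum_def regular_def)

lemma (in left_module) free_cover:
  assumes G: "finite G" "G \<subseteq> carrier M"
  shows "\<exists>k. \<exists>e \<in> lin_maps R (free R k) M. e ` carrier (free R k) = lin_span R M G"
proof -
  obtain k :: nat and g where g: "G = g ` {..<k}"
    using finite_imp_nat_seg_image_inj_on[OF G(1)] by (metis lessThan_def)
  have gc: "g i \<in> carrier M" if "i < k" for i using G(2) g that by auto
  \<comment> \<open>the map sending the standard basis to the generators\<close>
  define e where "e x = (\<Oplus>\<^bsub>M\<^esub> i \<in> {..<k}. x i \<odot>\<^bsub>M\<^esub> g i)" for x
  have "e \<in> lin_maps R (free R k) M"
  proof (rule lin_mapsI)
    fix x assume x: "x \<in> carrier (free R k)"
    show "e x \<in> carrier M" unfolding e_def using x gc by (intro M.finsum_closed) (auto simp: free_simps)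
    show "e (x \<oplus>\<^bsub>free R k\<^esub> y) = e x \<oplus>\<^bsub>M\<^esub> e y" if y: "y \<in> carrier (free R k)" for y
    proof -
      have "e (x \<oplus>\<^bsub>free R k\<^esub> y) = (\<Oplus>\<^bsub>M\<^esub> i \<in> {..<k}. x i \<odot>\<^bsub>M\<^esub> g i \<oplus>\<^bsub>M\<^esub> y i \<odot>\<^bsub>M\<^esub> g i)"
        unfolding e_def using x y gc
        by (intro M.finsum_cong') (auto simp: free_simps smult_l_distr PiE_iff)
      also have "\<dots> = e x \<oplus>\<^bsub>M\<^esub> e y"
        unfolding e_def using x y gc by (intro M.finsum_addf) (auto simp: free_simps PiE_iff)
      finally show ?thesis .
    qed
    show "e (a \<odot>\<^bsub>free R k\<^esub> x) = a \<odot>\<^bsub>M\<^esub> e x" if a: "a \<in> carrier R" for a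
    proof -
      have "e (a \<odot>\<^bsub>free R k\<^esub> x) = (\<Oplus>\<^bsub>M\<^esub> i \<in> {..<k}. a \<odot>\<^bsub>M\<^esub> (x i \<odot>\<^bsub>M\<^esub> g i))"
        unfolding e_def using x a gc
        by (intro M.finsum_cong') (auto simp: free_simps smult_assoc1 PiE_iff)
      also have "\<dots> = a \<odot>\<^bsub>M\<^esub> e x"
        unfolding e_def using x a gc by (intro finsum_smult[symmetric]) (auto simp: free_simps PiE_iff)
      finally show ?thesis .
    qed
  qed
  moreover have "e ` carrier (free R k) = lin_span R M G"
  proof -
    have "lin_span R M G = e ` ({..<k} \<rightarrow> carrier R)"
      unfolding g using gc by (subst lin_span_eq_combinations) (auto simp: e_def)
    also have "\<dots> = e ` ({..<k} \<rightarrow>\<^sub>E carrier R)"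
    proof -
      have "e c = e (restrict c {..<k})" if "c \<in> {..<k} \<rightarrow> carrier R" for c
        unfolding e_def using that gc by (intro M.finsum_cong') (auto simp: Pi_iff)
      moreover have "restrict c {..<k} \<in> {..<k} \<rightarrow>\<^sub>E carrier R" if "c \<in> {..<k} \<rightarrow> carrier R" for c
        using that by (simp add: restrict_PiE_iff Pi_iff)
      moreover have "{..<k} \<rightarrow>\<^sub>E carrier R \<subseteq> {..<k} \<rightarrow> carrier R" by (simp add: PiE_def)
      ultimately show ?thesis by (intro subset_antisym image_mono image_subsetI) (simp_all only: imageI)
    qed
    finally show ?thesis by (simp add: free_simps)
  qed
  ultimately show ?thesis by blast
qed


section \<open>Finitely generated submodules over artinian rings\<close>

definition fg_submodule ::
    "('a, 'p) ring_scheme \<Rightarrow> ('a, 'x, 'q) module_scheme \<Rightarrow> 'x set \<Rightarrow> bool" where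
  "fg_submodule B M H \<longleftrightarrow> (\<exists>G. finite G \<and> G \<subseteq> carrier M \<and> H = lin_span B M G)"

context left_module
begin

text \<open>
  Generators of \<open>K\<close> together with \<open>G\<close> generate \<open>H\<close>.
\<close>

lemma fg_extension:
  assumes H: "submodule H R M" and K: "fg_submodule R M K" "K \<subseteq> H"
    and G: "finite G" "G \<subseteq> H"
    and split: "\<And>x. x \<in> H \<Longrightarrow> \<exists>y \<in> lin_span R M G. \<exists>k \<in> K. x = y \<oplus>\<^bsub>M\<^esub> k"
  shows "fg_submodule R M H"
proof -
  obtain G' where G': "finite G'" "G' \<subseteq> carrier M" "K = lin_span R M G'"
    using K unfolding fg_submodule_def by blast
  have GG: "G \<union> G' \<subseteq> H" using G K(2) G'(3) lin_span_incl[of G'] by fast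
  have GM: "G \<union> G' \<subseteq> carrier M" using GG submoduleD(1)[OF H] by fast
  note s = submoduleD[OF submodule_lin_span[OF GM]]
  have "H = lin_span R M (G \<union> G')"
  proof
    show "lin_span R M (G \<union> G') \<subseteq> H" by (rule lin_span_least[OF H GG])
    show "H \<subseteq> lin_span R M (G \<union> G')"
    proof
      fix x assume "x \<in> H"
      then obtain y k where "y \<in> lin_span R M G" "k \<in> K" "x = y \<oplus>\<^bsub>M\<^esub> k" using split by blast
      then show "x \<in> lin_span R M (G \<union> G')"
        using lin_span_mono[OF _ GM, of G] lin_span_mono[OF _ GM, of G'] s(4) G'(3) by fast
    qed
  qed
  then show ?thesis using G(1) G'(1) GM unfolding fg_submodule_def by blast
qed

text \<open>
  It suffices to lift the finitely many generators of \<open>Y\<close> along \<open>\<rho>\<close>, because the elements that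
  have a lift in a given submodule form a submodule.  A relation is used instead of a map since in
  one application \<open>\<rho>\<close> relates an element to a coefficient of it that is not uniquely determined.
\<close>

lemma fg_lift:
  assumes N: "left_module R N" and H: "submodule H R M" and Y: "fg_submodule R N Y"
    and \<rho>0: "\<rho> \<zero>\<^bsub>M\<^esub> \<zero>\<^bsub>N\<^esub>"
    and \<rho>add: "\<And>x y x' y'. \<lbrakk>x \<in> H; x' \<in> H; y \<in> carrier N; y' \<in> carrier N; \<rho> x y; \<rho> x' y'\<rbrakk> \<Longrightarrow>
      \<rho> (x \<oplus>\<^bsub>M\<^esub> x') (y \<oplus>\<^bsub>N\<^esub> y')"
    and \<rho>smult: "\<And>a x y. \<lbrakk>a \<in> carrier R; x \<in> H; y \<in> carrier N; \<rho> x y\<rbrakk> \<Longrightarrow> \<rho> (a \<odot>\<^bsub>M\<^esub> x) (a \<odot>\<^bsub>N\<^esub> y)"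
    and surj: "\<And>y. y \<in> Y \<Longrightarrow> \<exists>x \<in> H. \<rho> x y"
  shows "\<exists>G. finite G \<and> G \<subseteq> H \<and> (\<forall>y \<in> Y. \<exists>x \<in> lin_span R M G. \<rho> x y)"
proof -
  interpret N: left_module R N by fact
  obtain G' where G': "finite G'" "G' \<subseteq> carrier N" "Y = lin_span R N G'"
    using Y unfolding fg_submodule_def by blast
  have "\<forall>y \<in> G'. \<exists>x \<in> H. \<rho> x y" using surj G'(3) lin_span_incl[of G' R N] by auto
  then obtain c where c: "\<forall>y \<in> G'. c y \<in> H \<and> \<rho> (c y) y" by (auto simp: Bex_def dest: bchoice)
  define G where "G = c ` G'"
  have GH: "G \<subseteq> H" using c by (auto simp: G_def)
  then have GM: "G \<subseteq> carrier M" using submoduleD(1)[OF H] by fast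
  have sub: "lin_span R M G \<subseteq> H" by (rule lin_span_least[OF H GH])
  note s = submoduleD[OF submodule_lin_span[OF GM]]
  have "submodule {y \<in> carrier N. \<exists>x \<in> lin_span R M G. \<rho> x y} R N"
  proof (rule N.submoduleI)
    show "\<zero>\<^bsub>N\<^esub> \<in> {y \<in> carrier N. \<exists>x \<in> lin_span R M G. \<rho> x y}" using \<rho>0 s(2) by auto
    fix y y' assume "y \<in> {y \<in> carrier N. \<exists>x \<in> lin_span R M G. \<rho> x y}"
      "y' \<in> {y \<in> carrier N. \<exists>x \<in> lin_span R M G. \<rho> x y}"
    then obtain x x' where x: "y \<in> carrier N" "x \<in> lin_span R M G" "\<rho> x y"
      and x': "y' \<in> carrier N" "x' \<in> lin_span R M G" "\<rho> x' y'" by blast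
    have "\<rho> (x \<oplus>\<^bsub>M\<^esub> x') (y \<oplus>\<^bsub>N\<^esub> y')" using \<rho>add x x' sub by blast
    then show "y \<oplus>\<^bsub>N\<^esub> y' \<in> {y \<in> carrier N. \<exists>x \<in> lin_span R M G. \<rho> x y}"
      using s(4)[OF x(2) x'(2)] x(1) x'(1) by auto
  next
    fix a y assume a: "a \<in> carrier R" and "y \<in> {y \<in> carrier N. \<exists>x \<in> lin_span R M G. \<rho> x y}"
    then obtain x where x: "y \<in> carrier N" "x \<in> lin_span R M G" "\<rho> x y" by blast
    have "\<rho> (a \<odot>\<^bsub>M\<^esub> x) (a \<odot>\<^bsub>N\<^esub> y)" using \<rho>smult a x sub by blast
    then show "a \<odot>\<^bsub>N\<^esub> y \<in> {y \<in> carrier N. \<exists>x \<in> lin_span R M G. \<rho> x y}"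
      using s(5)[OF a x(2)] x(1) a by auto
  qed auto
  moreover have "G' \<subseteq> {y \<in> carrier N. \<exists>x \<in> lin_span R M G. \<rho> x y}"
    using c G'(2) lin_span_incl[of G R M] unfolding G_def by blast
  ultimately have "Y \<subseteq> {y \<in> carrier N. \<exists>x \<in> lin_span R M G. \<rho> x y}"
    unfolding G'(3) by (rule lin_span_least)
  then show ?thesis using GH G'(1) by (intro exI[of _ G]) (auto simp: G_def)
qed

end

lemma regular_simps [simp]:
  "carrier (regular B) = carrier B" "\<zero>\<^bsub>regular B\<^esub> = \<zero>\<^bsub>B\<^esub>"
  "x \<oplus>\<^bsub>regular B\<^esub> y = x \<oplus>\<^bsub>B\<^esub> y" "a \<odot>\<^bsub>regular B\<^esub> x = a \<otimes>\<^bsub>B\<^esub> x"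
  by (simp_all add: regular_def)

lemma (in cring) ideal_iff_submodule: "ideal I R \<longleftrightarrow> submodule I R (regular R)"
proof -
  interpret V: left_module R "regular R" by (rule left_module_regular) (rule ring_axioms)
  show ?thesis
  proof
    assume "ideal I R"
    then interpret ideal I R .
    show "submodule I R (regular R)"
      by (rule V.submoduleI) (auto intro: I_l_closed)
  next
    assume I: "submodule I R (regular R)"
    note s = V.submoduleD[OF I, simplified]
    have inv: "\<ominus>\<^bsub>R\<^esub> x \<in> I" if "x \<in> I" for x
      using s(5)[OF add.inv_closed[OF one_closed] that] s(3)[OF that] by (simp add: l_minus)
    have right: "x \<otimes> a \<in> I" if "x \<in> I" "a \<in> carrier R" for a x
      using s(5)[OF that(2,1)] s(3)[OF that(1)] that(2) by (simp add: m_comm)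
    show "ideal I R"
      by (intro idealI ring_axioms subgroup.intro)
        (use s(1,2,4,5) inv right in \<open>auto simp: a_inv_def[symmetric]\<close>)
  qed
qed

text \<open>
  Otherwise a strictly descending sequence could be chosen inside \<open>F\<close>.
\<close>

lemma (in cring) artinian_minimal_submodule:
  assumes art: "artinian R" and F: "F \<noteq> {}" "\<And>I. I \<in> F \<Longrightarrow> submodule I R (regular R)"
  shows "\<exists>K \<in> F. \<forall>I \<in> F. I \<subseteq> K \<longrightarrow> I = K"
proof (rule ccontr)
  assume "\<not> ?thesis"
  then have "\<forall>K \<in> F. \<exists>I. I \<in> F \<and> I \<subset> K" by auto
  then obtain f where f: "\<And>K. K \<in> F \<Longrightarrow> f K \<in> F \<and> f K \<subset> K" by metis
  obtain K where K: "K \<in> F" using F(1) by auto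
  define I where "I k = (f ^^ k) K" for k
  have IF: "I k \<in> F" for k by (induct k) (auto simp: I_def K f)
  have less: "I (Suc k) \<subset> I k" for k using f[OF IF[of k]] by (simp add: I_def)
  have "\<exists>N. \<forall>k \<ge> N. I k = I N"
    using art less F(2)[OF IF] unfolding artinian_def ideal_iff_submodule
    by (metis (no_types, lifting) psubset_imp_subset)
  then show False using less by (metis le_SucI order_refl psubset_eq)
qed

text \<open>
  Artinian commutative rings are noetherian.  Let \<open>L\<close> be minimal among the ideals that are not
  finitely generated.  An element \<open>r\<close> acts on \<open>L\<close> either as zero or surjectively, as otherwise \<open>r L\<close>
  and the kernel of \<open>r\<close> on \<open>L\<close> would both be smaller, hence finitely generated, and so would \<open>L\<close>.  If \<open>r\<close>
  acts surjectively, then some \<open>a\<close> acts as its inverse, because the ideals generated by the powers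
  of \<open>r\<close> become stationary.  So \<open>L\<close> is in effect a vector space over a field.  A submodule that is
  maximal among those avoiding some \<open>x \<noteq> 0\<close> in \<open>L\<close> is a complement of the line through \<open>x\<close>.  It is
  smaller than \<open>L\<close>, hence finitely generated, and so \<open>L\<close> is finitely generated as well.
\<close>

lemma (in cring) artinian_imp_fg_ideals:
  assumes art: "artinian R" and I: "submodule I R (regular R)"
  shows "fg_submodule R (regular R) I"
proof (rule ccontr)
  interpret V: left_module R "regular R" by (rule left_module_regular) (rule ring_axioms)
  assume nfg: "\<not> fg_submodule R (regular R) I"
  obtain L where L: "submodule L R (regular R)" "\<not> fg_submodule R (regular R) L"
    and min: "\<And>K. submodule K R (regular R) \<Longrightarrow> K \<subseteq> L \<Longrightarrow> K \<noteq> L \<Longrightarrow> fg_submodule R (regular R) K"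
    using artinian_minimal_submodule[OF art,
      of "{K. submodule K R (regular R) \<and> \<not> fg_submodule R (regular R) K}"] I nfg by blast
  note s = V.submoduleD[OF L(1), simplified]
  have mult_lin: "(\<lambda>x. r \<otimes> x) \<in> lin_maps R (regular R) (regular R)" if "r \<in> carrier R" for r
    using that by (intro lin_mapsI) (auto simp: r_distr m_lcomm)
  have dich: "(\<lambda>x. r \<otimes> x) ` L = L \<or> (\<forall>x \<in> L. r \<otimes> x = \<zero>)" if r: "r \<in> carrier R" for r
  proof (rule ccontr)
    assume n: "\<not> ?thesis"
    have im: "submodule ((\<lambda>x. r \<otimes> x) ` L) R (regular R)"
      by (rule submodule_image[OF V.left_module V.left_module mult_lin[OF r] L(1)])
    have "(\<lambda>x. r \<otimes> x) ` L \<subseteq> L" using s(5)[OF r] by auto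
    then have fg_im: "fg_submodule R (regular R) ((\<lambda>x. r \<otimes> x) ` L)" using min[OF im] n by blast
    define K where "K = L \<inter> {x \<in> carrier R. r \<otimes> x \<in> {\<zero>}}"
    have "submodule K R (regular R)"
      using submodule_vimage[OF V.left_module V.left_module mult_lin[OF r] V.submodule_zero]
      unfolding K_def by (intro V.submodule_inter L(1)) simp
    moreover have "K \<noteq> L" using n s(3) by (auto simp: K_def)
    ultimately have fg_K: "fg_submodule R (regular R) K" using min[of K] by (auto simp: K_def)
    have "\<exists>G. finite G \<and> G \<subseteq> L \<and>
        (\<forall>y \<in> (\<lambda>x. r \<otimes> x) ` L. \<exists>x \<in> lin_span R (regular R) G. y = r \<otimes> x)"
      using r s by (intro V.fg_lift[OF V.left_module L(1) fg_im]) (auto simp: r_distr m_lcomm)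
    then obtain G where G: "finite G" "G \<subseteq> L"
      "\<And>x. x \<in> L \<Longrightarrow> \<exists>y \<in> lin_span R (regular R) G. r \<otimes> x = r \<otimes> y" by auto
    have "fg_submodule R (regular R) L"
    proof (rule V.fg_extension[OF L(1) fg_K _ G(1,2)])
      show "K \<subseteq> L" by (auto simp: K_def)
      fix x assume x: "x \<in> L"
      then obtain y where y: "y \<in> lin_span R (regular R) G" "r \<otimes> x = r \<otimes> y" using G(3) by blast
      have yL: "y \<in> L" using y(1) lin_span_least[OF L(1) G(2)] by blast
      note c = s(3)[OF x] s(3)[OF yL]
      have "\<ominus> y \<in> L" using s(5)[OF add.inv_closed[OF one_closed] yL] c by (simp add: l_minus)
      then have "x \<ominus> y \<in> K"
        using s(4)[OF x] r c y(2) by (auto simp: K_def minus_eq r_distr r_minus r_neg)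
      moreover have "x = y \<oplus> (x \<ominus> y)" using c by (simp add: minus_eq a_lcomm r_neg)
      ultimately show "\<exists>y \<in> lin_span R (regular R) G. \<exists>k \<in> K. x = y \<oplus>\<^bsub>regular R\<^esub> k"
        using y(1) by auto
    qed
    then show False using L(2) by blast
  qed
  have inverse: "\<exists>a \<in> carrier R. \<forall>x \<in> L. (a \<otimes> r) \<otimes> x = x"
    if r: "r \<in> carrier R" and rL: "(\<lambda>x. r \<otimes> x) ` L = L" for r
  proof -
    define I where "I k = PIdl (r [^] (k :: nat))" for k
    have "ideal (I k) R" for k using r by (auto simp: I_def intro: cgenideal_ideal)
    moreover have "I (Suc k) \<subseteq> I k" for k
    proof
      fix y assume "y \<in> I (Suc k)"
      then obtain b where b: "b \<in> carrier R" "y = b \<otimes> r [^] Suc k" unfolding I_def cgenideal_def by blast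
      then have "y = (b \<otimes> r) \<otimes> r [^] k" using r by (simp add: m_ac)
      then show "y \<in> I k" using b r unfolding I_def cgenideal_def by blast
    qed
    ultimately obtain N where "\<forall>k \<ge> N. I k = I N" using art unfolding artinian_def by blast
    then have "r [^] N \<in> I (Suc N)" using cgenideal_self[of "r [^] N"] r by (metis I_def le_SucI nat_pow_closed order_refl)
    then obtain a where a: "a \<in> carrier R" "r [^] N = a \<otimes> r [^] Suc N"
      unfolding I_def cgenideal_def by blast
    have pow: "(\<lambda>x. r [^] k \<otimes> x) ` L = L" for k :: nat
    proof (induct k)
      case 0 then show ?case using s(3) by force
    next
      case (Suc k)
      have "(\<lambda>x. r [^] Suc k \<otimes> x) ` L = (\<lambda>x. r [^] k \<otimes> x) ` (\<lambda>x. r \<otimes> x) ` L"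
        unfolding image_image using r s(3) by (intro image_cong) (auto simp: m_assoc)
      then show ?case using Suc rL by simp
    qed
    have "(a \<otimes> r) \<otimes> x = x" if x: "x \<in> L" for x
    proof -
      obtain y where y: "y \<in> L" "x = r [^] N \<otimes> y" using pow[of N] x by blast
      have "(a \<otimes> r) \<otimes> (r [^] N \<otimes> y) = (a \<otimes> (r [^] N \<otimes> r)) \<otimes> y"
        using s(3)[OF y(1)] a(1) r by (simp add: m_ac)
      then show ?thesis using a(2) y(2) by (metis nat_pow_Suc)
    qed
    then show ?thesis using a(1) by blast
  qed
  have "L \<noteq> {\<zero>}"
  proof
    assume "L = {\<zero>}"
    then have "L = lin_span R (regular R) {}"
      using lin_span_least[OF V.submodule_zero, of "{}"]
        V.submoduleD(2)[OF V.submodule_lin_span[of "{}"]] by auto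
    then show False using L(2) unfolding fg_submodule_def by blast
  qed
  then obtain x where x: "x \<in> L" "x \<noteq> \<zero>" using s(2) by blast
  obtain K where K: "submodule K R (regular R)" "K \<subseteq> L \<and> x \<notin> K"
    and Kmax: "\<And>X. submodule X R (regular R) \<Longrightarrow> X \<subseteq> L \<and> x \<notin> X \<Longrightarrow> K \<subseteq> X \<Longrightarrow> X = K"
  proof (rule V.exists_maximal_submodule[of "{\<zero>}" "\<lambda>K. K \<subseteq> L \<and> x \<notin> K"])
    show "submodule {\<zero>} R (regular R)" using V.submodule_zero by simp
  qed (use x s(2) in auto)
  note k = V.submoduleD[OF K(1), simplified]
  have "fg_submodule R (regular R) L"
  proof (rule V.fg_extension[OF L(1) _ conjunct1[OF K(2)], of "{x}"])
    show "fg_submodule R (regular R) K" using min K x by blast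
    show "{x} \<subseteq> L" using x by simp
    note sx = V.submoduleD[OF V.submodule_lin_span[of "{x}"], simplified, OF s(3)[OF x(1)]]
    have x_span: "x \<in> lin_span R (regular R) {x}" using lin_span_incl[of "{x}" R "regular R"] by simp
    fix y assume y: "y \<in> L"
    show "\<exists>u \<in> lin_span R (regular R) {x}. \<exists>v \<in> K. y = u \<oplus>\<^bsub>regular R\<^esub> v"
    proof (cases "y \<in> K")
      case True
      then show ?thesis using k(3) sx(2) by force
    next
      case False
      let ?X = "{s \<oplus>\<^bsub>regular R\<^esub> a \<odot>\<^bsub>regular R\<^esub> y | s a. s \<in> K \<and> a \<in> carrier R}"
      have yR: "y \<in> carrier R" using s(3) y by blast
      have "submodule ?X R (regular R)" using V.submodule_add_cyclic[OF K(1), of y] yR by simp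
      moreover have "?X \<subseteq> L" using K(2) s(4,5) y by auto
      moreover have "K \<subseteq> ?X"
      proof
        fix u assume "u \<in> K"
        moreover from this have "u = u \<oplus>\<^bsub>regular R\<^esub> \<zero> \<odot>\<^bsub>regular R\<^esub> y" using k(3) yR by simp
        ultimately show "u \<in> ?X" using zero_closed by blast
      qed
      moreover have "y = \<zero> \<oplus>\<^bsub>regular R\<^esub> \<one> \<odot>\<^bsub>regular R\<^esub> y" using yR by simp
      then have "y \<in> ?X" using k(2) one_closed by blast
      ultimately have "x \<in> ?X" using Kmax[of ?X] False by blast
      then obtain u r where ur: "u \<in> K" "r \<in> carrier R" "x = u \<oplus> r \<otimes> y" by auto
      have "r \<otimes> y \<noteq> \<zero>" using ur K(2) k(3) by auto
      then have "(\<lambda>x. r \<otimes> x) ` L = L" using dich[OF ur(2)] y by blast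
      then obtain a where a: "a \<in> carrier R" "\<forall>x \<in> L. (a \<otimes> r) \<otimes> x = x" using inverse[OF ur(2)] by blast
      have uR: "u \<in> carrier R" using k(3) ur(1) .
      have "a \<otimes> x = a \<otimes> u \<oplus> y"
        using ur a uR yR bspec[OF a(2) y] by (simp add: r_distr m_assoc)
      then have "y = a \<otimes> x \<oplus> (\<ominus> a) \<otimes> u"
        using a(1) uR yR by (simp add: l_minus a_ac r_neg)
      then show ?thesis using sx(5)[OF a(1) x_span] k(5)[OF add.inv_closed[OF a(1)] ur(1)] by auto
    qed
  qed simp
  then show False using L(2) by blast
qed

text \<open>
  Induction on the number of generators.  For the last generator \<open>g\<close>, the possible coefficients of \<open>g\<close>
  in elements of \<open>H\<close> form an ideal, which is finitely generated; the elements of \<open>H\<close> that can be written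
  without \<open>g\<close> are covered by the induction hypothesis.
\<close>

lemma artinian_imp_fg_submodules:
  assumes "cring R" "artinian R" "left_module R M"
    and "finite G" "G \<subseteq> carrier M" "submodule H R M" "H \<subseteq> lin_span R M G"
  shows "fg_submodule R M H"
  using assms(4-7)
proof (induct arbitrary: H set: finite)
  interpret M: left_module R M by fact
  case empty
  have "lin_span R M {} \<subseteq> {\<zero>\<^bsub>M\<^esub>}" by (rule lin_span_least[OF M.submodule_zero]) simp
  then have "H = lin_span R M {}"
    using lin_span_least[OF empty(2), of "{}"] M.submoduleD(2)[OF empty(2)] empty(3) by blast
  then show ?case unfolding fg_submodule_def by blast
next
  case (insert g G)
  interpret R: cring R by fact
  interpret M: left_module R M by fact
  interpret V: left_module R "regular R" by (rule left_module_regular) (rule R.ring_axioms)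
  have g: "g \<in> carrier M" and G: "G \<subseteq> carrier M" using insert(4) by auto
  define S where "S = lin_span R M G"
  have S: "submodule S R M" unfolding S_def by (rule M.submodule_lin_span[OF G])
  note s = M.submoduleD[OF S] and h = M.submoduleD[OF insert(5)]
  define \<rho> where "\<rho> x r \<longleftrightarrow> (\<exists>s \<in> S. x = s \<oplus>\<^bsub>M\<^esub> r \<odot>\<^bsub>M\<^esub> g)" for x r
  have \<rho>0: "\<rho> \<zero>\<^bsub>M\<^esub> \<zero>\<^bsub>R\<^esub>" using s(2) g unfolding \<rho>_def by force
  have \<rho>add: "\<rho> (x \<oplus>\<^bsub>M\<^esub> x') (r \<oplus>\<^bsub>R\<^esub> r')"
    if r: "r \<in> carrier R" "r' \<in> carrier R" "\<rho> x r" "\<rho> x' r'" for x x' r r'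
  proof -
    obtain u u' where u: "u \<in> S" "x = u \<oplus>\<^bsub>M\<^esub> r \<odot>\<^bsub>M\<^esub> g" "u' \<in> S" "x' = u' \<oplus>\<^bsub>M\<^esub> r' \<odot>\<^bsub>M\<^esub> g"
      using r(3,4) unfolding \<rho>_def by blast
    have "x \<oplus>\<^bsub>M\<^esub> x' = (u \<oplus>\<^bsub>M\<^esub> u') \<oplus>\<^bsub>M\<^esub> (r \<oplus>\<^bsub>R\<^esub> r') \<odot>\<^bsub>M\<^esub> g"
      using u r g s(3) by (simp add: M.smult_l_distr M.M.a_ac)
    then show ?thesis using s(4)[OF u(1,3)] unfolding \<rho>_def by blast
  qed
  have \<rho>smult: "\<rho> (a \<odot>\<^bsub>M\<^esub> x) (a \<otimes>\<^bsub>R\<^esub> r)"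
    if r: "a \<in> carrier R" "r \<in> carrier R" "\<rho> x r" for a x r
  proof -
    obtain u where u: "u \<in> S" "x = u \<oplus>\<^bsub>M\<^esub> r \<odot>\<^bsub>M\<^esub> g" using r(3) unfolding \<rho>_def by blast
    have "a \<odot>\<^bsub>M\<^esub> x = a \<odot>\<^bsub>M\<^esub> u \<oplus>\<^bsub>M\<^esub> (a \<otimes>\<^bsub>R\<^esub> r) \<odot>\<^bsub>M\<^esub> g"
      using u r g s(3) by (simp add: M.smult_r_distr M.smult_assoc1)
    then show ?thesis using s(5)[OF r(1) u(1)] unfolding \<rho>_def by blast
  qed
  define Y where "Y = {r \<in> carrier R. \<exists>x \<in> H. \<rho> x r}"
  have "submodule Y R (regular R)"
  proof (rule V.submoduleI)
    show "Y \<subseteq> carrier (regular R)" "\<zero>\<^bsub>regular R\<^esub> \<in> Y" using h(2) \<rho>0 by (auto simp: Y_def)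
    show "r \<oplus>\<^bsub>regular R\<^esub> r' \<in> Y" if rr: "r \<in> Y" "r' \<in> Y" for r r'
    proof -
      obtain x x' where x: "x \<in> H" "\<rho> x r" "x' \<in> H" "\<rho> x' r'" "r \<in> carrier R" "r' \<in> carrier R"
        using rr unfolding Y_def by blast
      then show ?thesis using \<rho>add[OF x(5,6,2,4)] h(4)[OF x(1,3)] by (auto simp: Y_def)
    qed
    show "a \<odot>\<^bsub>regular R\<^esub> r \<in> Y" if ar: "a \<in> carrier R" "r \<in> Y" for a r
    proof -
      obtain x where x: "x \<in> H" "\<rho> x r" "r \<in> carrier R" using ar(2) unfolding Y_def by blast
      then show ?thesis using \<rho>smult[OF ar(1) x(3,2)] h(5)[OF ar(1) x(1)] ar(1) by (auto simp: Y_def)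
    qed
  qed
  then have "fg_submodule R (regular R) Y" by (rule R.artinian_imp_fg_ideals[OF assms(2)])
  then have "\<exists>G'. finite G' \<and> G' \<subseteq> H \<and> (\<forall>r \<in> Y. \<exists>x \<in> lin_span R M G'. \<rho> x r)"
  proof (rule M.fg_lift[OF V.left_module insert(5)])
    show "\<rho> \<zero>\<^bsub>M\<^esub> \<zero>\<^bsub>regular R\<^esub>" using \<rho>0 by simp
  qed (use \<rho>add \<rho>smult in \<open>simp_all add: Y_def\<close>)
  then obtain G' where G': "finite G'" "G' \<subseteq> H" "\<And>r. r \<in> Y \<Longrightarrow> \<exists>x \<in> lin_span R M G'. \<rho> x r" by blast
  show ?case
  proof (rule M.fg_extension[OF insert(5) _ _ G'(1,2)])
    show "fg_submodule R M (H \<inter> S)"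
      using insert(3)[OF G M.submodule_inter[OF insert(5) S]] by (auto simp: S_def)
    fix x assume x: "x \<in> H"
    have "lin_span R M (insert g G) \<subseteq> {s \<oplus>\<^bsub>M\<^esub> a \<odot>\<^bsub>M\<^esub> g | s a. s \<in> S \<and> a \<in> carrier R}" (is "_ \<subseteq> ?X")
    proof (rule lin_span_least[OF M.submodule_add_cyclic[OF S g]])
      have "u \<in> ?X" if "u \<in> G" for u
      proof -
        have u: "u \<in> S" using that lin_span_incl[of G R M] by (auto simp: S_def)
        then have "u = u \<oplus>\<^bsub>M\<^esub> \<zero>\<^bsub>R\<^esub> \<odot>\<^bsub>M\<^esub> g" using s(3) g by simp
        then show ?thesis using u R.zero_closed by blast
      qed
      moreover have "g = \<zero>\<^bsub>M\<^esub> \<oplus>\<^bsub>M\<^esub> \<one>\<^bsub>R\<^esub> \<odot>\<^bsub>M\<^esub> g" using g by simp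
      then have "g \<in> ?X" using s(2) R.one_closed by blast
      ultimately show "insert g G \<subseteq> ?X" by blast
    qed
    then obtain u r where ur: "u \<in> S" "r \<in> carrier R" "x = u \<oplus>\<^bsub>M\<^esub> r \<odot>\<^bsub>M\<^esub> g" using x insert(6) by blast
    then have "r \<in> Y" using x unfolding Y_def \<rho>_def by blast
    then obtain y v where y: "y \<in> lin_span R M G'" "v \<in> S" "y = v \<oplus>\<^bsub>M\<^esub> r \<odot>\<^bsub>M\<^esub> g" using G'(3) unfolding \<rho>_def by blast
    have yH: "y \<in> H" using y(1) lin_span_least[OF insert(5) G'(2)] by blast
    have e: "x \<ominus>\<^bsub>M\<^esub> y = u \<ominus>\<^bsub>M\<^esub> v"
      unfolding ur(3) y(3) using ur y(2) g s(3)
      by (simp add: M.M.minus_eq M.M.minus_add M.M.a_ac M.M.r_neg M.M.r_neg1 M.M.r_neg2)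
    have "x \<ominus>\<^bsub>M\<^esub> y \<in> H" using h(4)[OF x h(6)[OF yH]] by (simp add: M.M.minus_eq)
    moreover have "x \<ominus>\<^bsub>M\<^esub> y \<in> S" unfolding e using s(4)[OF ur(1) s(6)[OF y(2)]] by (simp add: M.M.minus_eq)
    moreover have "x = y \<oplus>\<^bsub>M\<^esub> (x \<ominus>\<^bsub>M\<^esub> y)"
      using h(3)[OF x] h(3)[OF yH] by (simp add: M.M.minus_eq M.M.a_lcomm M.M.r_neg)
    ultimately show "\<exists>y \<in> lin_span R M G'. \<exists>k \<in> H \<inter> S. x = y \<oplus>\<^bsub>M\<^esub> k" using y(1) by blast
  qed simp
qed


section \<open>Injective modules and Baer's criterion\<close>

definition prod_module ::
    "('a, 'x, 'q) module_scheme \<Rightarrow> ('a, 'y, 's) module_scheme \<Rightarrow> ('a, 'x \<times> 'y) module" where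
  "prod_module M N = \<lparr>carrier = carrier M \<times> carrier N, monoid.mult = undefined, monoid.one = undefined,
     ring.zero = (\<zero>\<^bsub>M\<^esub>, \<zero>\<^bsub>N\<^esub>),
     ring.add = (\<lambda>u v. (fst u \<oplus>\<^bsub>M\<^esub> fst v, snd u \<oplus>\<^bsub>N\<^esub> snd v)),
     smult = (\<lambda>a u. (a \<odot>\<^bsub>M\<^esub> fst u, a \<odot>\<^bsub>N\<^esub> snd u))\<rparr>"

lemma prod_module_simps [simp]:
  "carrier (prod_module M N) = carrier M \<times> carrier N"
  "\<zero>\<^bsub>prod_module M N\<^esub> = (\<zero>\<^bsub>M\<^esub>, \<zero>\<^bsub>N\<^esub>)"
  "u \<oplus>\<^bsub>prod_module M N\<^esub> v = (fst u \<oplus>\<^bsub>M\<^esub> fst v, snd u \<oplus>\<^bsub>N\<^esub> snd v)"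
  "a \<odot>\<^bsub>prod_module M N\<^esub> u = (a \<odot>\<^bsub>M\<^esub> fst u, a \<odot>\<^bsub>N\<^esub> snd u)"
  by (simp_all add: prod_module_def)

lemma left_module_prod:
  assumes "left_module B M" "left_module B N" shows "left_module B (prod_module M N)"
proof -
  interpret M: left_module B M by fact
  interpret N: left_module B N by fact
  show ?thesis
  proof (intro left_module.intro abelian_groupI left_module_axioms.intro)
    show "ring B" by (rule M.R.ring_axioms)
    show "\<exists>v \<in> carrier (prod_module M N). v \<oplus>\<^bsub>prod_module M N\<^esub> u = \<zero>\<^bsub>prod_module M N\<^esub>"
      if "u \<in> carrier (prod_module M N)" for u
      using that by (intro bexI[of _ "(\<ominus>\<^bsub>M\<^esub> fst u, \<ominus>\<^bsub>N\<^esub> snd u)"]) (auto simp: M.M.l_neg N.M.l_neg)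
  qed (auto simp: M.M.a_ac N.M.a_ac M.smult_l_distr N.smult_l_distr
    M.smult_r_distr N.smult_r_distr M.smult_assoc1 N.smult_assoc1)
qed

text \<open>
  The test modules of \<open>injective_module\<close> live on the type \<open>(nat \<Rightarrow> 'r) set\<close>.  Singletons of
  constant functions give a copy of a module on \<open>'r\<close>, such as \<open>R\<close> or an ideal, on this type.
\<close>

definition copy_module :: "('r, 'r, 'q) module_scheme \<Rightarrow> ('r, (nat \<Rightarrow> 'r) set) module" where
  "copy_module V =
    (let \<iota> = (\<lambda>r. {\<lambda>_. r}); un = (\<lambda>S. (SOME w. w \<in> S) 0)
     in \<lparr>carrier = \<iota> ` carrier V, monoid.mult = undefined, monoid.one = undefined,
         ring.zero = \<iota> \<zero>\<^bsub>V\<^esub>, ring.add = (\<lambda>S T. \<iota> (un S \<oplus>\<^bsub>V\<^esub> un T)), smult = (\<lambda>r S. \<iota> (r \<odot>\<^bsub>V\<^esub> un S))\<rparr>)"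

lemma copy_module_simps [simp]:
  "carrier (copy_module V) = (\<lambda>r. {\<lambda>_. r}) ` carrier V"
  "\<zero>\<^bsub>copy_module V\<^esub> = {\<lambda>_. \<zero>\<^bsub>V\<^esub>}"
  "{\<lambda>_. r} \<oplus>\<^bsub>copy_module V\<^esub> {\<lambda>_. s} = {\<lambda>_. r \<oplus>\<^bsub>V\<^esub> s}"
  "a \<odot>\<^bsub>copy_module V\<^esub> {\<lambda>_. r} = {\<lambda>_. a \<odot>\<^bsub>V\<^esub> r}"
  by (simp_all add: copy_module_def)

lemma module_copy:
  assumes "module R V" shows "module R (copy_module V)"
proof -
  interpret module R V by fact
  show ?thesis
  proof (intro moduleI abelian_groupI)
    show "cring R" by (rule R.is_cring)
    show "\<exists>T \<in> carrier (copy_module V). T \<oplus>\<^bsub>copy_module V\<^esub> S = \<zero>\<^bsub>copy_module V\<^esub>"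
      if S: "S \<in> carrier (copy_module V)" for S
    proof -
      obtain r where "r \<in> carrier V" "S = {\<lambda>_. r}" using S by auto
      then show ?thesis by (intro bexI[of _ "{\<lambda>_. \<ominus>\<^bsub>V\<^esub> r}"]) (auto simp: M.l_neg)
    qed
  qed (auto simp: M.a_assoc M.a_comm M.a_lcomm smult_l_distr smult_r_distr smult_assoc1)
qed

lemma injective_moduleD:
  fixes M N :: "('r, (nat \<Rightarrow> 'r) set) module"
  assumes "injective_module R J" "module R M" "module R N"
    "f \<in> lin_maps R M N" "inj_on f (carrier M)" "g \<in> lin_maps R M J"
  shows "\<exists>h \<in> lin_maps R N J. \<forall>x \<in> carrier M. h (f x) = g x"
  using assms unfolding injective_module_def by blast

text \<open>
  The functional is extended from (a copy of) the ideal to (a copy of) \<open>R\<close>, and \<open>j\<close> is the value of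
  the extension at \<open>1\<close>.
\<close>

lemma (in cring) injective_extend_from_ideal:
  assumes J: "injective_module R J" and I: "submodule I R (regular R)"
    and f: "\<And>r. r \<in> I \<Longrightarrow> f r \<in> carrier J"
    and add: "\<And>r s. r \<in> I \<Longrightarrow> s \<in> I \<Longrightarrow> f (r \<oplus> s) = f r \<oplus>\<^bsub>J\<^esub> f s"
    and smult: "\<And>a r. a \<in> carrier R \<Longrightarrow> r \<in> I \<Longrightarrow> f (a \<otimes> r) = a \<odot>\<^bsub>J\<^esub> f r"
  shows "\<exists>j \<in> carrier J. \<forall>r \<in> I. f r = r \<odot>\<^bsub>J\<^esub> j"
proof -
  have V: "module R (regular R)"
    using left_module_regular[OF ring_axioms] is_cring by (simp add: module_iff_left_module)
  have I': "module R ((regular R)\<lparr>carrier := I\<rparr>)" by (rule submodule.submodule_is_module[OF I V])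
  have IR: "I \<subseteq> carrier R" using left_module.submoduleD(1)[OF left_module_regular[OF ring_axioms] I] by simp
  let ?M = "copy_module ((regular R)\<lparr>carrier := I\<rparr>)" and ?N = "copy_module (regular R)"
  have "(\<lambda>S. S) \<in> lin_maps R ?M ?N" using IR by (intro lin_mapsI) auto
  moreover have "(\<lambda>S. f ((SOME w. w \<in> S) 0)) \<in> lin_maps R ?M J"
    by (intro lin_mapsI) (auto simp: f add smult)
  ultimately obtain h where h: "h \<in> lin_maps R ?N J"
    "\<And>S. S \<in> carrier ?M \<Longrightarrow> h S = f ((SOME w. w \<in> S) 0)"
    using injective_moduleD[OF J module_copy[OF I'] module_copy[OF V] _ inj_on_id2] by blast
  have "f r = r \<odot>\<^bsub>J\<^esub> h {\<lambda>_. \<one>}" if r: "r \<in> I" for r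
  proof -
    have rR: "r \<in> carrier R" using r IR by blast
    have "f r = h {\<lambda>_. r}" using h(2)[of "{\<lambda>_. r}"] r by simp
    also have "\<dots> = h (r \<odot>\<^bsub>?N\<^esub> {\<lambda>_. \<one>})" using rR by simp
    also have "\<dots> = r \<odot>\<^bsub>J\<^esub> h {\<lambda>_. \<one>}" using rR by (intro lin_mapsD(3)[OF h(1)]) auto
    finally show ?thesis .
  qed
  moreover have "h {\<lambda>_. \<one>} \<in> carrier J" by (rule lin_mapsD(1)[OF h(1)]) simp
  ultimately show ?thesis by blast
qed

text \<open>
  Baer's criterion.  Partial linear maps are represented by their graphs, so that extending a map
  means enlarging a submodule of \<open>M \<times> J\<close>.  A maximal graph is total: if \<open>x\<close> is outside its domain,
  then \<open>r \<mapsto>\<close> (value at \<open>r x\<close>), defined on an ideal, is multiplication by some \<open>j\<close>, and the pair \<open>(x, j)\<close>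
  can be adjoined without losing single-valuedness.
\<close>

theorem (in cring) injective_extend_graph:
  assumes J: "injective_module R J" and M: "left_module R M"
    and \<Gamma>: "submodule \<Gamma> R (prod_module M J)" and sv: "\<And>y. (\<zero>\<^bsub>M\<^esub>, y) \<in> \<Gamma> \<Longrightarrow> y = \<zero>\<^bsub>J\<^esub>"
  shows "\<exists>h \<in> lin_maps R M J. \<forall>x y. (x, y) \<in> \<Gamma> \<longrightarrow> h x = y"
proof -
  have J': "left_module R J" using J by (simp add: injective_module_def module_iff_left_module)
  interpret J: left_module R J by fact
  interpret M: left_module R M by fact
  interpret P: left_module R "prod_module M J" by (rule left_module_prod[OF M J'])
  interpret V: left_module R "regular R" by (rule left_module_regular) (rule ring_axioms)
  obtain \<Delta> where \<Delta>': "submodule \<Delta> R (prod_module M J)"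
      "\<Gamma> \<subseteq> \<Delta> \<and> (\<forall>y. (\<zero>\<^bsub>M\<^esub>, y) \<in> \<Delta> \<longrightarrow> y = \<zero>\<^bsub>J\<^esub>)"
    and max: "\<And>X. submodule X R (prod_module M J) \<Longrightarrow>
      \<Gamma> \<subseteq> X \<and> (\<forall>y. (\<zero>\<^bsub>M\<^esub>, y) \<in> X \<longrightarrow> y = \<zero>\<^bsub>J\<^esub>) \<Longrightarrow> \<Delta> \<subseteq> X \<Longrightarrow> X = \<Delta>"
    by (rule P.exists_maximal_submodule[of \<Gamma> "\<lambda>X. \<Gamma> \<subseteq> X \<and> (\<forall>y. (\<zero>\<^bsub>M\<^esub>, y) \<in> X \<longrightarrow> y = \<zero>\<^bsub>J\<^esub>)"])
      (rule \<Gamma>, use sv in blast, blast, rule that)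
  note \<Delta> = \<Delta>'(1) conjunct1[OF \<Delta>'(2)] conjunct2[OF \<Delta>'(2), rule_format]
  note d = P.submoduleD[OF \<Delta>(1)]
  have dc: "x \<in> carrier M" "y \<in> carrier J" if "(x, y) \<in> \<Delta>" for x y using d(3)[OF that] by auto
  have dadd: "(x \<oplus>\<^bsub>M\<^esub> x', y \<oplus>\<^bsub>J\<^esub> y') \<in> \<Delta>" if "(x, y) \<in> \<Delta>" "(x', y') \<in> \<Delta>" for x y x' y'
    using d(4)[OF that] by simp
  have dsm: "(a \<odot>\<^bsub>M\<^esub> x, a \<odot>\<^bsub>J\<^esub> y) \<in> \<Delta>" if "a \<in> carrier R" "(x, y) \<in> \<Delta>" for x y a
    using d(5)[OF that] by simp
  have dmin: "(\<ominus>\<^bsub>M\<^esub> x, \<ominus>\<^bsub>J\<^esub> y) \<in> \<Delta>" if "(x, y) \<in> \<Delta>" for x y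
    using dsm[OF add.inv_closed[OF one_closed] that] dc[OF that] M.smult_minus_one J.smult_minus_one by simp
  have uniq: "y = y'" if "(x, y) \<in> \<Delta>" "(x, y') \<in> \<Delta>" for x y y'
  proof -
    have "y \<oplus>\<^bsub>J\<^esub> \<ominus>\<^bsub>J\<^esub> y' = \<zero>\<^bsub>J\<^esub>"
      using \<Delta>(3) dadd[OF that(1) dmin[OF that(2)]] dc[OF that(1)] by (simp add: M.M.r_neg)
    then have "\<ominus>\<^bsub>J\<^esub> (\<ominus>\<^bsub>J\<^esub> y') = y"
      using dc[OF that(1)] dc[OF that(2)] by (intro J.M.minus_equality) auto
    then show ?thesis using dc(2)[OF that(2)] by simp
  qed
  have total: "\<exists>y. (x, y) \<in> \<Delta>" if x: "x \<in> carrier M" for x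
  proof (rule ccontr)
    assume no: "\<nexists>y. (x, y) \<in> \<Delta>"
    define I where "I = {r \<in> carrier R. \<exists>y. (r \<odot>\<^bsub>M\<^esub> x, y) \<in> \<Delta>}"
    define f where "f r = (THE y. (r \<odot>\<^bsub>M\<^esub> x, y) \<in> \<Delta>)" for r
    have fI: "f r = y" if "(r \<odot>\<^bsub>M\<^esub> x, y) \<in> \<Delta>" for r y
      unfolding f_def by (rule the_equality) (rule that, rule uniq[OF _ that])
    have fI': "(r \<odot>\<^bsub>M\<^esub> x, f r) \<in> \<Delta>" if rI: "r \<in> I" for r
    proof -
      obtain y where "(r \<odot>\<^bsub>M\<^esub> x, y) \<in> \<Delta>" using rI unfolding I_def by blast
      then show ?thesis using fI by simp
    qed
    have f_add: "((r \<oplus> s) \<odot>\<^bsub>M\<^esub> x, f r \<oplus>\<^bsub>J\<^esub> f s) \<in> \<Delta>" if "r \<in> I" "s \<in> I" for r s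
      using dadd[OF fI'[OF that(1)] fI'[OF that(2)]] that x by (simp add: M.smult_l_distr I_def)
    have f_sm: "((a \<otimes> r) \<odot>\<^bsub>M\<^esub> x, a \<odot>\<^bsub>J\<^esub> f r) \<in> \<Delta>" if "a \<in> carrier R" "r \<in> I" for a r
      using dsm[OF that(1) fI'[OF that(2)]] that x by (simp add: M.smult_assoc1 I_def)
    have "submodule I R (regular R)"
    proof (rule V.submoduleI)
      show "I \<subseteq> carrier (regular R)" "\<zero>\<^bsub>regular R\<^esub> \<in> I" using d(2) x by (auto simp: I_def)
      show "r \<oplus>\<^bsub>regular R\<^esub> s \<in> I" if "r \<in> I" "s \<in> I" for r s
        using f_add[OF that] that by (auto simp: I_def)
      show "a \<odot>\<^bsub>regular R\<^esub> r \<in> I" if "a \<in> carrier R" "r \<in> I" for a r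
        using f_sm[OF that] that by (auto simp: I_def)
    qed
    then have "\<exists>j \<in> carrier J. \<forall>r \<in> I. f r = r \<odot>\<^bsub>J\<^esub> j"
      using dc(2)[OF fI'] fI[OF f_add] fI[OF f_sm] by (rule injective_extend_from_ideal[OF J])
    then obtain j where j: "j \<in> carrier J" "\<And>r. r \<in> I \<Longrightarrow> f r = r \<odot>\<^bsub>J\<^esub> j" by blast
    let ?X = "{s \<oplus>\<^bsub>prod_module M J\<^esub> a \<odot>\<^bsub>prod_module M J\<^esub> (x, j) | s a. s \<in> \<Delta> \<and> a \<in> carrier R}"
    have sX: "submodule ?X R (prod_module M J)"
      using P.submodule_add_cyclic[OF \<Delta>(1), of "(x, j)"] x j by simp
    have DX: "\<Delta> \<subseteq> ?X"
    proof
      fix u assume u: "u \<in> \<Delta>"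
      have "u = u \<oplus>\<^bsub>prod_module M J\<^esub> \<zero> \<odot>\<^bsub>prod_module M J\<^esub> (x, j)"
        using x j dc[of "fst u" "snd u"] u by (auto simp: prod_eq_iff)
      then show "u \<in> ?X" using u zero_closed by blast
    qed
    have "y = \<zero>\<^bsub>J\<^esub>" if y: "(\<zero>\<^bsub>M\<^esub>, y) \<in> ?X" for y
    proof -
      obtain u v r where r: "(u, v) \<in> \<Delta>" "r \<in> carrier R"
        "\<zero>\<^bsub>M\<^esub> = u \<oplus>\<^bsub>M\<^esub> r \<odot>\<^bsub>M\<^esub> x" "y = v \<oplus>\<^bsub>J\<^esub> r \<odot>\<^bsub>J\<^esub> j" using y by auto
      have "\<ominus>\<^bsub>M\<^esub> u = r \<odot>\<^bsub>M\<^esub> x"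
        using r(2,3) dc[OF r(1)] x by (metis M.M.minus_equality M.M.a_comm M.smult_closed)
      then have n: "(r \<odot>\<^bsub>M\<^esub> x, \<ominus>\<^bsub>J\<^esub> v) \<in> \<Delta>" using dmin[OF r(1)] by simp
      then have "r \<in> I" using r(2) by (auto simp: I_def)
      then have "r \<odot>\<^bsub>J\<^esub> j = \<ominus>\<^bsub>J\<^esub> v" using fI[OF n] j(2) by simp
      then show ?thesis using r(4) dc[OF r(1)] by (simp add: J.M.r_neg)
    qed
    then have "?X = \<Delta>" using max[OF sX _ DX] DX \<Delta>(2) by blast
    moreover have "(x, j) = \<zero>\<^bsub>prod_module M J\<^esub> \<oplus>\<^bsub>prod_module M J\<^esub> \<one> \<odot>\<^bsub>prod_module M J\<^esub> (x, j)"
      using x j by simp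
    then have "(x, j) \<in> ?X" using d(2) one_closed by blast
    ultimately show False using no by blast
  qed
  define h where "h x = (THE y. (x, y) \<in> \<Delta>)" for x
  have hI: "h x = y" if "(x, y) \<in> \<Delta>" for x y
    unfolding h_def by (rule the_equality) (rule that, rule uniq[OF _ that])
  have hI': "(x, h x) \<in> \<Delta>" if x: "x \<in> carrier M" for x
  proof -
    obtain y where "(x, y) \<in> \<Delta>" using total[OF x] by blast
    then show ?thesis using hI by simp
  qed
  have "h \<in> lin_maps R M J"
    using dc(2)[OF hI'] hI[OF dadd[OF hI' hI']] hI[OF dsm[OF _ hI']] by (rule lin_mapsI)
  then show ?thesis using hI \<Delta>(2) by blast
qed

text \<open>
  This is the extension property for the injection from \<open>P\<close> modulo the preimage of \<open>K\<close> into \<open>M\<close>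
  modulo \<open>K\<close>, with the quotient modules avoided: the graph to be extended consists of the pairs
  \<open>(d p + x, f p)\<close> with \<open>x\<close> in \<open>K\<close>.
\<close>

corollary (in cring) injective_factor:
  assumes J: "injective_module R J" and P: "left_module R P" and M: "left_module R M"
    and d: "d \<in> lin_maps R P M" and f: "f \<in> lin_maps R P J" and K: "submodule K R M"
    and compat: "\<And>p. p \<in> carrier P \<Longrightarrow> d p \<in> K \<Longrightarrow> f p = \<zero>\<^bsub>J\<^esub>"
  shows "\<exists>g \<in> lin_maps R M J. (\<forall>p \<in> carrier P. g (d p) = f p) \<and> (\<forall>x \<in> K. g x = \<zero>\<^bsub>J\<^esub>)"
proof -
  have J': "left_module R J" using J by (simp add: injective_module_def module_iff_left_module)
  interpret J: left_module R J by fact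
  interpret M: left_module R M by fact
  interpret P: left_module R P by fact
  interpret MJ: left_module R "prod_module M J" by (rule left_module_prod[OF M J'])
  interpret PM: left_module R "prod_module P M" by (rule left_module_prod[OF P M])
  note k = M.submoduleD[OF K] and d = d lin_mapsD[OF d] and f = f lin_mapsD[OF f]
  define \<Gamma> where "\<Gamma> = (\<lambda>(p, x). (d p \<oplus>\<^bsub>M\<^esub> x, f p)) ` (carrier P \<times> K)"
  have "submodule (carrier P \<times> K) R (prod_module P M)"
    using k by (intro PM.submoduleI) auto
  moreover have "(\<lambda>(p, x). (d p \<oplus>\<^bsub>M\<^esub> x, f p)) \<in> lin_maps R (prod_module P M) (prod_module M J)"
    using d f by (intro lin_mapsI) (auto simp: M.M.a_ac M.smult_r_distr)
  ultimately have "submodule \<Gamma> R (prod_module M J)"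
    unfolding \<Gamma>_def by (intro submodule_image[OF PM.left_module MJ.left_module])
  moreover have "y = \<zero>\<^bsub>J\<^esub>" if y: "(\<zero>\<^bsub>M\<^esub>, y) \<in> \<Gamma>" for y
  proof -
    obtain p x where p: "p \<in> carrier P" "x \<in> K" "\<zero>\<^bsub>M\<^esub> = d p \<oplus>\<^bsub>M\<^esub> x" "y = f p" using y unfolding \<Gamma>_def by auto
    have "d p = \<ominus>\<^bsub>M\<^esub> x" using p(3) d(2)[OF p(1)] k(3)[OF p(2)] by (metis M.M.minus_equality)
    then show ?thesis using compat[OF p(1)] k(6)[OF p(2)] p(4) by simp
  qed
  ultimately have "\<exists>h \<in> lin_maps R M J. \<forall>x y. (x, y) \<in> \<Gamma> \<longrightarrow> h x = y" by (rule injective_extend_graph[OF J M])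
  then obtain g where g: "g \<in> lin_maps R M J" "\<And>x y. (x, y) \<in> \<Gamma> \<Longrightarrow> g x = y" by blast
  have "g (d p) = f p" if p: "p \<in> carrier P" for p
  proof -
    have "(d p \<oplus>\<^bsub>M\<^esub> \<zero>\<^bsub>M\<^esub>, f p) \<in> \<Gamma>" using p k(2) unfolding \<Gamma>_def by force
    then show ?thesis using g(2) d(2)[OF p] by simp
  qed
  moreover have "g x = \<zero>\<^bsub>J\<^esub>" if x: "x \<in> K" for x
  proof -
    have "(d \<zero>\<^bsub>P\<^esub> \<oplus>\<^bsub>M\<^esub> x, f \<zero>\<^bsub>P\<^esub>) \<in> \<Gamma>" using x unfolding \<Gamma>_def by force
    then show ?thesis
      using g(2) k(3)[OF x] lin_maps_zero[OF P M d(1)] lin_maps_zero[OF P J' f(1)] by simp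
  qed
  ultimately show ?thesis using g(1) by blast
qed


section \<open>The injective envelope of the semisimple quotient as a cogenerator\<close>

lemma (in cring) exists_maximalideal:
  assumes I: "submodule I R (regular R)" and one: "\<one> \<notin> I"
  shows "\<exists>m. maximalideal m R \<and> I \<subseteq> m"
proof -
  interpret V: left_module R "regular R" by (rule left_module_regular) (rule ring_axioms)
  obtain m where m: "submodule m R (regular R)" "I \<subseteq> m \<and> \<one> \<notin> m"
    and max: "\<And>X. submodule X R (regular R) \<Longrightarrow> I \<subseteq> X \<and> \<one> \<notin> X \<Longrightarrow> m \<subseteq> X \<Longrightarrow> X = m"
    by (rule V.exists_maximal_submodule[of I "\<lambda>X. I \<subseteq> X \<and> \<one> \<notin> X"]) (use assms in auto)
  have "maximalideal m R"
  proof (rule maximalidealI)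
    show "ideal m R" using m(1) by (simp add: ideal_iff_submodule)
    show "carrier R \<noteq> m" using m(2) by auto
    fix X assume X: "ideal X R" "m \<subseteq> X" "X \<subseteq> carrier R"
    show "X = m \<or> X = carrier R"
    proof (cases "\<one> \<in> X")
      case True then show ?thesis using ideal.one_imp_carrier[OF X(1)] by simp
    next
      case False
      then show ?thesis using max[of X] X m(2) by (auto simp: ideal_iff_submodule)
    qed
  qed
  then show ?thesis using m(2) by blast
qed

text \<open>
  The residue class of \<open>s\<close> spans a copy of \<open>R / m\<close> inside \<open>R / rad R\<close>.  To find \<open>s\<close>, let \<open>K\<close> be minimal
  among the ideals that are not contained in \<open>m\<close>.  For every other maximal ideal \<open>m'\<close>, the ideal
  \<open>K \<inter> m'\<close> is not contained in \<open>m\<close> either, since \<open>m\<close> is prime; so \<open>K \<subseteq> m'\<close>.  Any element of \<open>K\<close> outside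
  \<open>m\<close> will do.
\<close>

lemma (in cring) jacobson_radical_complement:
  assumes art: "artinian R" and m: "maximalideal m R"
  shows "\<exists>s \<in> carrier R. s \<notin> jacobson_radical R \<and> (\<forall>r \<in> m. r \<otimes> s \<in> jacobson_radical R)"
proof -
  interpret V: left_module R "regular R" by (rule left_module_regular) (rule ring_axioms)
  interpret m: maximalideal m R by fact
  interpret m: primeideal m R by (rule maximalideal_prime[OF m])
  let ?F = "{K. submodule K R (regular R) \<and> \<not> K \<subseteq> m}"
  have "carrier R \<in> ?F" using V.submodule_carrier m.I_notcarr m.a_subset by auto
  then obtain K where K: "submodule K R (regular R)" "\<not> K \<subseteq> m"
    and min: "\<And>X. submodule X R (regular R) \<Longrightarrow> \<not> X \<subseteq> m \<Longrightarrow> X \<subseteq> K \<Longrightarrow> X = K"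
    using artinian_minimal_submodule[OF art, of ?F] by blast
  note k = V.submoduleD[OF K(1), simplified]
  have "K \<subseteq> m'" if m': "maximalideal m' R" "m' \<noteq> m" for m'
  proof -
    interpret m': maximalideal m' R by fact
    have "\<not> m' \<subseteq> m" using m'.I_maximal[OF m.is_ideal] m'(2) m.a_subset m.I_notcarr by blast
    then obtain a b where ab: "a \<in> K" "a \<notin> m" "b \<in> m'" "b \<notin> m" using K(2) by blast
    have c: "a \<in> carrier R" "b \<in> carrier R" using ab k(3) m'.a_Hcarr by auto
    have "a \<otimes> b \<in> K" using k(5)[OF c(2) ab(1)] c by (simp add: m_comm)
    moreover have "a \<otimes> b \<in> m'" using m'.I_l_closed[OF ab(3) c(1)] .
    moreover have "a \<otimes> b \<notin> m" using m.I_prime[OF c] ab by blast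
    moreover have "submodule (K \<inter> m') R (regular R)"
      using K(1) m'.is_ideal ideal_iff_submodule V.submodule_inter by blast
    ultimately show ?thesis using min[of "K \<inter> m'"] by blast
  qed
  moreover obtain s where s: "s \<in> K" "s \<notin> m" using K(2) by blast
  ultimately have sm': "s \<in> m'" if "maximalideal m' R" "m' \<noteq> m" for m' using that by blast
  have sR: "s \<in> carrier R" using k(3)[OF s(1)] .
  have "r \<otimes> s \<in> jacobson_radical R" if r: "r \<in> m" for r
  proof -
    have rR: "r \<in> carrier R" using m.a_Hcarr[OF r] .
    have "r \<otimes> s \<in> m'" if m': "maximalideal m' R" for m'
    proof (cases "m' = m")
      case True then show ?thesis using m.I_r_closed[OF r sR] by simp
    next
      case False
      interpret m': maximalideal m' R by fact
      show ?thesis using m'.I_l_closed[OF sm'[OF m' False] rR] .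
    qed
    then show ?thesis using rR sR by (simp add: jacobson_radical_def)
  qed
  then show ?thesis using sR s(2) m by (intro bexI[of _ s]) (auto simp: jacobson_radical_def)
qed

lemma (in cring) ideal_jacobson_radical: "ideal (jacobson_radical R) R"
proof -
  interpret V: left_module R "regular R" by (rule left_module_regular) (rule ring_axioms)
  have s: "submodule m R (regular R)" if "maximalideal m R" for m
    using maximalideal.axioms(1)[OF that] ideal_iff_submodule by blast
  show ?thesis
    unfolding ideal_iff_submodule
    by (rule V.submoduleI) (auto simp: jacobson_radical_def V.submoduleD[OF s, simplified])
qed

lemma quotient_module_simps:
  "carrier (quotient_module R I) = a_rcosets\<^bsub>R\<^esub> I"
  "r \<odot>\<^bsub>quotient_module R I\<^esub> Y = rcoset_mult R I (I +>\<^bsub>R\<^esub> r) Y"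
  by (simp_all add: quotient_module_def FactRing_def ring.defs module.defs)

text \<open>
  The annihilator of \<open>x\<close> is contained in a maximal ideal \<open>m\<close>, and \<open>J\<close> contains a nonzero element \<open>j\<close>
  annihilated by \<open>m\<close>, coming from a copy of \<open>R / m\<close> in \<open>R / rad R\<close>.  So \<open>r x \<mapsto> r j\<close> is a well-defined
  map, which extends to \<open>M\<close>.
\<close>

theorem (in cring) injective_envelope_cogenerator:
  assumes art: "artinian R" and J: "injective_envelope R (quotient_module R (jacobson_radical R)) J"
    and M: "left_module R M" and x: "x \<in> carrier M" "x \<noteq> \<zero>\<^bsub>M\<^esub>"
  shows "\<exists>h \<in> lin_maps R M J. h x \<noteq> \<zero>\<^bsub>J\<^esub>"
proof -
  let ?I = "jacobson_radical R" and ?Q = "quotient_module R (jacobson_radical R)"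
  have inj: "injective_module R J" using J by (simp add: injective_envelope_def)
  obtain e where e: "e \<in> lin_maps R ?Q J" "inj_on e (carrier ?Q)"
    using J by (auto simp: injective_envelope_def)
  have J': "left_module R J" using inj by (simp add: injective_module_def module_iff_left_module)
  interpret J: left_module R J by fact
  interpret M: left_module R M by fact
  interpret V: left_module R "regular R" by (rule left_module_regular) (rule ring_axioms)
  interpret I: ideal ?I R by (rule ideal_jacobson_radical)
  have lin: "(\<lambda>r. r \<odot>\<^bsub>M\<^esub> x) \<in> lin_maps R (regular R) M"
    using x by (intro lin_mapsI) (auto simp: M.smult_l_distr M.smult_assoc1)
  have ann: "submodule {r \<in> carrier R. r \<odot>\<^bsub>M\<^esub> x \<in> {\<zero>\<^bsub>M\<^esub>}} R (regular R)"
    using submodule_vimage[OF V.left_module M lin M.submodule_zero] by simp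
  obtain m where m: "maximalideal m R" "{r \<in> carrier R. r \<odot>\<^bsub>M\<^esub> x \<in> {\<zero>\<^bsub>M\<^esub>}} \<subseteq> m"
    using exists_maximalideal[OF ann] x by auto
  obtain s where s: "s \<in> carrier R" "s \<notin> ?I" "\<And>r. r \<in> m \<Longrightarrow> r \<otimes> s \<in> ?I"
    using jacobson_radical_complement[OF art m(1)] by blast
  have coset: "?I +> r \<in> carrier ?Q" if "r \<in> carrier R" for r
    using that by (auto simp: quotient_module_simps A_RCOSETS_def')
  have smult: "r \<odot>\<^bsub>?Q\<^esub> (?I +> t) = ?I +> (r \<otimes> t)" if "r \<in> carrier R" "t \<in> carrier R" for r t
    using that by (simp add: quotient_module_simps I.rcoset_mult_add)
  have zero: "?I +> \<zero> = ?I" by (rule a_rcos_zero[OF I.is_ideal I.zero_closed])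
  have e0: "e ?I = \<zero>\<^bsub>J\<^esub>"
    using lin_mapsD(3)[OF e(1) zero_closed coset[OF zero_closed]] smult[of \<zero> \<zero>]
      lin_mapsD(1)[OF e(1) coset[OF zero_closed]] zero by simp
  define j where "j = e (?I +> s)"
  have j: "j \<in> carrier J" unfolding j_def by (rule lin_mapsD(1)[OF e(1) coset[OF s(1)]])
  have "?I +> s \<noteq> ?I" using I.rcos_const_imp_mem[OF s(1)] s(2) by blast
  then have j0: "j \<noteq> \<zero>\<^bsub>J\<^esub>"
    using e(2) coset[OF s(1)] coset[OF zero_closed] zero e0 unfolding j_def by (metis inj_onD)
  have mj: "r \<odot>\<^bsub>J\<^esub> j = \<zero>\<^bsub>J\<^esub>" if r: "r \<in> carrier R" "r \<in> m" for r
    using lin_mapsD(3)[OF e(1) r(1) coset[OF s(1)]] smult[OF r(1) s(1)] s(3)[OF r(2)] e0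
      a_rcos_zero[OF I.is_ideal] by (simp add: j_def)
  have "(\<lambda>r. r \<odot>\<^bsub>J\<^esub> j) \<in> lin_maps R (regular R) J"
    using j by (intro lin_mapsI) (auto simp: J.smult_l_distr J.smult_assoc1)
  then obtain g where g: "g \<in> lin_maps R M J" "\<forall>r \<in> carrier R. g (r \<odot>\<^bsub>M\<^esub> x) = r \<odot>\<^bsub>J\<^esub> j"
    using injective_factor[OF inj V.left_module M lin _ M.submodule_zero, of "\<lambda>r. r \<odot>\<^bsub>J\<^esub> j"] mj m(2)
    by auto
  have "g x = j" using g(2) x(1) j by (metis M.smult_one J.smult_one one_closed)
  then show ?thesis using g(1) j0 by blast
qed


section \<open>Triangular matrices\<close>

lemma (in abelian_monoid) finsum_swap:
  assumes "finite I" "finite K" "\<And>i k. i \<in> I \<Longrightarrow> k \<in> K \<Longrightarrow> f i k \<in> carrier G"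
  shows "(\<Oplus>i \<in> I. \<Oplus>k \<in> K. f i k) = (\<Oplus>k \<in> K. \<Oplus>i \<in> I. f i k)"
  using assms(1,3)
proof (induct set: finite)
  case empty then show ?case by (simp add: finsum_zero)
next
  case (insert i I)
  have f: "\<And>i' k. i' \<in> I \<Longrightarrow> k \<in> K \<Longrightarrow> f i' k \<in> carrier G" and fi: "\<And>k. k \<in> K \<Longrightarrow> f i k \<in> carrier G"
    using insert(4) by auto
  have "(\<Oplus>k \<in> K. \<Oplus>i' \<in> insert i I. f i' k) = (\<Oplus>k \<in> K. f i k \<oplus> (\<Oplus>i' \<in> I. f i' k))"
    using insert(1,2) f fi by (intro finsum_cong') (auto simp: Pi_iff)
  also have "\<dots> = (\<Oplus>k \<in> K. f i k) \<oplus> (\<Oplus>k \<in> K. \<Oplus>i' \<in> I. f i' k)"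
    using f fi by (intro finsum_addf) (auto simp: Pi_iff)
  also have "\<dots> = (\<Oplus>i' \<in> insert i I. \<Oplus>k \<in> K. f i' k)"
    using insert(1,2) insert(3)[OF f] f fi by (simp add: Pi_iff)
  finally show ?case by simp
qed

lemma (in left_module) finsum_smult_left:
  assumes "finite I" "f \<in> I \<rightarrow> carrier R" "x \<in> carrier M"
  shows "(\<Oplus>i \<in> I. f i) \<odot>\<^bsub>M\<^esub> x = (\<Oplus>\<^bsub>M\<^esub> i \<in> I. f i \<odot>\<^bsub>M\<^esub> x)"
  using assms by (induct set: finite) (simp_all add: Pi_iff smult_l_distr)

lemma lin_maps_finsum:
  assumes "left_module B M" "left_module B N" "f \<in> lin_maps B M N" "finite I" "x \<in> I \<rightarrow> carrier M"
  shows "f (\<Oplus>\<^bsub>M\<^esub> i \<in> I. x i) = (\<Oplus>\<^bsub>N\<^esub> i \<in> I. f (x i))"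
proof -
  interpret M: left_module B M by fact
  interpret N: left_module B N by fact
  show ?thesis
    using assms(4,5)
    by (induct set: finite) (simp_all add: Pi_iff lin_maps_zero[OF assms(1-3)] lin_mapsD[OF assms(3)])
qed

locale triangular = ring A for A :: "('a, 'p) ring_scheme" (structure) + fixes n :: nat
begin

abbreviation "T \<equiv> T_ring n A"

text \<open>
  The matrix unit at position \<open>(i, j)\<close>, multiplied by \<open>a\<close>.
\<close>

definition unit :: "nat \<Rightarrow> nat \<Rightarrow> 'a \<Rightarrow> nat \<Rightarrow> nat \<Rightarrow> 'a" where
  "unit i j a = (\<lambda>k l. if k = i \<and> l = j then a else \<zero>)"

definition diag :: "'a \<Rightarrow> nat \<Rightarrow> nat \<Rightarrow> 'a" where
  "diag a = (\<lambda>i j. if i = j \<and> i \<in> {1..n} then a else \<zero>)"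

lemma T_simps [simp]:
  "\<one>\<^bsub>T\<^esub> = diag \<one>"
  "\<zero>\<^bsub>T\<^esub> = (\<lambda>i j. \<zero>)"
  "a \<oplus>\<^bsub>T\<^esub> b = (\<lambda>i j. a i j \<oplus> b i j)"
  by (simp_all add: T_ring_def diag_def)

lemma T_mult: "a \<otimes>\<^bsub>T\<^esub> b = (\<lambda>i j. \<Oplus>k \<in> {1..n}. a i k \<otimes> b k j)"
  by (simp add: T_ring_def)

lemma T_carrier: "a \<in> carrier T \<longleftrightarrow>
    (\<forall>i j. a i j \<in> carrier A \<and> (\<not> (1 \<le> i \<and> i \<le> j \<and> j \<le> n) \<longrightarrow> a i j = \<zero>))"
proof -
  have "(if c then p \<in> carrier A else p = \<zero>) \<longleftrightarrow> p \<in> carrier A \<and> (\<not> c \<longrightarrow> p = \<zero>)" for c p by auto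
  then show ?thesis unfolding T_ring_def by simp
qed

lemma T_entry: "a \<in> carrier T \<Longrightarrow> a i j \<in> carrier A"
  by (simp add: T_carrier)

lemma T_entry_zero: "a \<in> carrier T \<Longrightarrow> \<not> (1 \<le> i \<and> i \<le> j \<and> j \<le> n) \<Longrightarrow> a i j = \<zero>"
  unfolding T_carrier by blast

lemma T_mult_closed: assumes a: "a \<in> carrier T" and b: "b \<in> carrier T" shows "a \<otimes>\<^bsub>T\<^esub> b \<in> carrier T"
proof -
  have "(\<Oplus>k \<in> {1..n}. a i k \<otimes> b k j) = \<zero>" if ij: "\<not> (1 \<le> i \<and> i \<le> j \<and> j \<le> n)" for i j
  proof (rule add.finprod_one_eqI)
    fix k assume "k \<in> {1..n}"
    show "a i k \<otimes> b k j = \<zero>"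
    proof (cases "1 \<le> i \<and> i \<le> k")
      case True
      then have "b k j = \<zero>" using ij by (intro T_entry_zero[OF b]) auto
      then show ?thesis using T_entry[OF a] by simp
    next
      case False
      then have "a i k = \<zero>" by (intro T_entry_zero[OF a]) auto
      then show ?thesis using T_entry[OF b] by simp
    qed
  qed
  then show ?thesis
    using T_entry[OF a] T_entry[OF b] by (auto simp: T_carrier T_mult Pi_iff intro!: finsum_closed)
qed

lemma diag_closed: "a \<in> carrier A \<Longrightarrow> diag a \<in> carrier T"
  by (auto simp: diag_def T_carrier)

lemma diag_mult:
  assumes a: "a \<in> carrier A" and t: "t \<in> carrier T"
  shows "diag a \<otimes>\<^bsub>T\<^esub> t = (\<lambda>i j. a \<otimes> t i j)" "t \<otimes>\<^bsub>T\<^esub> diag a = (\<lambda>i j. t i j \<otimes> a)"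
proof -
  note e = T_entry[OF t]
  have sum: "(\<Oplus>k \<in> {1..n}. if i = k then f k else \<zero>) = (if i \<in> {1..n} then f i else \<zero>)"
    if "\<And>k. f k \<in> carrier A" for f :: "nat \<Rightarrow> 'a" and i
  proof (cases "i \<in> {1..n}")
    case True
    then show ?thesis using finsum_singleton[of i "{1..n}" f] that by auto
  next
    case False
    then have "(\<Oplus>k \<in> {1..n}. if i = k then f k else \<zero>) = \<zero>" by (intro add.finprod_one_eqI) auto
    then show ?thesis using False by auto
  qed
  have out: "t i j = \<zero>" if "\<not> (i \<in> {1..n} \<and> j \<in> {1..n})" for i j
    using that by (intro T_entry_zero[OF t]) auto
  show "diag a \<otimes>\<^bsub>T\<^esub> t = (\<lambda>i j. a \<otimes> t i j)"
  proof (intro ext)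
    fix i j
    have "(diag a \<otimes>\<^bsub>T\<^esub> t) i j = (\<Oplus>k \<in> {1..n}. if i = k then a \<otimes> t k j else \<zero>)"
      unfolding T_mult using e a by (intro finsum_cong') (auto simp: diag_def)
    also have "\<dots> = a \<otimes> t i j" using sum[of "\<lambda>k. a \<otimes> t k j" i] out[of i j] e a by auto
    finally show "(diag a \<otimes>\<^bsub>T\<^esub> t) i j = a \<otimes> t i j" .
  qed
  show "t \<otimes>\<^bsub>T\<^esub> diag a = (\<lambda>i j. t i j \<otimes> a)"
  proof (intro ext)
    fix i j
    have "(t \<otimes>\<^bsub>T\<^esub> diag a) i j = (\<Oplus>k \<in> {1..n}. if j = k then t i k \<otimes> a else \<zero>)"
      unfolding T_mult using e a by (intro finsum_cong') (auto simp: diag_def)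
    also have "\<dots> = t i j \<otimes> a" using sum[of "\<lambda>k. t i k \<otimes> a" j] out[of i j] e a by auto
    finally show "(t \<otimes>\<^bsub>T\<^esub> diag a) i j = t i j \<otimes> a" .
  qed
qed

lemma ring_T: "ring T"
proof (rule ringI)
  note e = T_entry
  show "abelian_group T"
  proof (rule abelian_groupI)
    fix a assume a: "a \<in> carrier T"
    have "(\<lambda>i j. \<ominus> a i j) \<in> carrier T" using a by (auto simp: T_carrier)
    moreover have "(\<lambda>i j. \<ominus> a i j) \<oplus>\<^bsub>T\<^esub> a = \<zero>\<^bsub>T\<^esub>" using e[OF a] by (simp add: l_neg)
    ultimately show "\<exists>b \<in> carrier T. b \<oplus>\<^bsub>T\<^esub> a = \<zero>\<^bsub>T\<^esub>" by blast
  qed (auto simp: T_carrier a_ac fun_eq_iff)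
  show "monoid T"
  proof (rule monoidI)
    fix a b c assume a: "a \<in> carrier T" and b: "b \<in> carrier T" and c: "c \<in> carrier T"
    show "(a \<otimes>\<^bsub>T\<^esub> b) \<otimes>\<^bsub>T\<^esub> c = a \<otimes>\<^bsub>T\<^esub> (b \<otimes>\<^bsub>T\<^esub> c)"
    proof (intro ext)
      fix i j
      have "((a \<otimes>\<^bsub>T\<^esub> b) \<otimes>\<^bsub>T\<^esub> c) i j = (\<Oplus>k \<in> {1..n}. \<Oplus>l \<in> {1..n}. a i l \<otimes> b l k \<otimes> c k j)"
        unfolding T_mult using e[OF a] e[OF b] e[OF c]
        by (intro finsum_cong') (auto simp: finsum_ldistr Pi_iff)
      also have "\<dots> = (\<Oplus>l \<in> {1..n}. \<Oplus>k \<in> {1..n}. a i l \<otimes> b l k \<otimes> c k j)"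
        using e[OF a] e[OF b] e[OF c] by (intro finsum_swap) auto
      also have "\<dots> = (a \<otimes>\<^bsub>T\<^esub> (b \<otimes>\<^bsub>T\<^esub> c)) i j"
        unfolding T_mult using e[OF a] e[OF b] e[OF c]
        by (intro finsum_cong') (auto simp: finsum_rdistr Pi_iff m_assoc)
      finally show "((a \<otimes>\<^bsub>T\<^esub> b) \<otimes>\<^bsub>T\<^esub> c) i j = (a \<otimes>\<^bsub>T\<^esub> (b \<otimes>\<^bsub>T\<^esub> c)) i j" .
    qed
  next
    fix a assume a: "a \<in> carrier T"
    show "\<one>\<^bsub>T\<^esub> \<otimes>\<^bsub>T\<^esub> a = a" "a \<otimes>\<^bsub>T\<^esub> \<one>\<^bsub>T\<^esub> = a"
      using diag_mult[OF one_closed a] e[OF a] by simp_all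
  qed (use diag_closed T_mult_closed in auto)
next
  fix a b c assume a: "a \<in> carrier T" and b: "b \<in> carrier T" and c: "c \<in> carrier T"
  note e = T_entry[OF a] T_entry[OF b] T_entry[OF c]
  show "(a \<oplus>\<^bsub>T\<^esub> b) \<otimes>\<^bsub>T\<^esub> c = a \<otimes>\<^bsub>T\<^esub> c \<oplus>\<^bsub>T\<^esub> b \<otimes>\<^bsub>T\<^esub> c"
  proof (intro ext)
    fix i j
    have "((a \<oplus>\<^bsub>T\<^esub> b) \<otimes>\<^bsub>T\<^esub> c) i j = (\<Oplus>k \<in> {1..n}. a i k \<otimes> c k j \<oplus> b i k \<otimes> c k j)"
      unfolding T_mult using e by (intro finsum_cong') (auto simp: l_distr)
    also have "\<dots> = (a \<otimes>\<^bsub>T\<^esub> c \<oplus>\<^bsub>T\<^esub> b \<otimes>\<^bsub>T\<^esub> c) i j"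
      unfolding T_mult T_simps using e by (intro finsum_addf) auto
    finally show "((a \<oplus>\<^bsub>T\<^esub> b) \<otimes>\<^bsub>T\<^esub> c) i j = (a \<otimes>\<^bsub>T\<^esub> c \<oplus>\<^bsub>T\<^esub> b \<otimes>\<^bsub>T\<^esub> c) i j" .
  qed
  show "c \<otimes>\<^bsub>T\<^esub> (a \<oplus>\<^bsub>T\<^esub> b) = c \<otimes>\<^bsub>T\<^esub> a \<oplus>\<^bsub>T\<^esub> c \<otimes>\<^bsub>T\<^esub> b"
  proof (intro ext)
    fix i j
    have "(c \<otimes>\<^bsub>T\<^esub> (a \<oplus>\<^bsub>T\<^esub> b)) i j = (\<Oplus>k \<in> {1..n}. c i k \<otimes> a k j \<oplus> c i k \<otimes> b k j)"
      unfolding T_mult using e by (intro finsum_cong') (auto simp: r_distr)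
    also have "\<dots> = (c \<otimes>\<^bsub>T\<^esub> a \<oplus>\<^bsub>T\<^esub> c \<otimes>\<^bsub>T\<^esub> b) i j"
      unfolding T_mult T_simps using e by (intro finsum_addf) auto
    finally show "(c \<otimes>\<^bsub>T\<^esub> (a \<oplus>\<^bsub>T\<^esub> b)) i j = (c \<otimes>\<^bsub>T\<^esub> a \<oplus>\<^bsub>T\<^esub> c \<otimes>\<^bsub>T\<^esub> b) i j" .
  qed
qed

lemma unit_closed [simp]: "1 \<le> i \<Longrightarrow> i \<le> j \<Longrightarrow> j \<le> n \<Longrightarrow> a \<in> carrier A \<Longrightarrow> unit i j a \<in> carrier T"
  by (auto simp: unit_def T_carrier)

lemma unit_zero [simp]: "unit i j \<zero> = \<zero>\<^bsub>T\<^esub>"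
  by (simp add: unit_def fun_eq_iff)

lemma unit_add: "a \<in> carrier A \<Longrightarrow> b \<in> carrier A \<Longrightarrow> unit i j (a \<oplus> b) = unit i j a \<oplus>\<^bsub>T\<^esub> unit i j b"
  by (simp add: unit_def fun_eq_iff)

lemma unit_mult_left:
  assumes "j \<in> {1..n}" "a \<in> carrier A" "t \<in> carrier T"
  shows "unit i j a \<otimes>\<^bsub>T\<^esub> t = (\<lambda>k l. if k = i then a \<otimes> t j l else \<zero>)"
proof (intro ext)
  fix k l
  note e = T_entry[OF assms(3)]
  have "(unit i j a \<otimes>\<^bsub>T\<^esub> t) k l = (\<Oplus>m \<in> {1..n}. if j = m then (if k = i then a \<otimes> t m l else \<zero>) else \<zero>)"
    unfolding T_mult using e assms(2) by (intro finsum_cong') (auto simp: unit_def)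
  also have "\<dots> = (if k = i then a \<otimes> t j l else \<zero>)"
    using e assms(1,2) by (intro finsum_singleton) auto
  finally show "(unit i j a \<otimes>\<^bsub>T\<^esub> t) k l = (if k = i then a \<otimes> t j l else \<zero>)" .
qed

lemma unit_mult:
  assumes "1 \<le> i" "i \<le> j" "j \<le> n" "1 \<le> k" "k \<le> l" "l \<le> n" "a \<in> carrier A" "b \<in> carrier A"
  shows "unit i j a \<otimes>\<^bsub>T\<^esub> unit k l b = (if j = k then unit i l (a \<otimes> b) else \<zero>\<^bsub>T\<^esub>)"
proof -
  have "unit i j a \<otimes>\<^bsub>T\<^esub> unit k l b = (\<lambda>k' l'. if k' = i then a \<otimes> unit k l b j l' else \<zero>)"
    using assms by (intro unit_mult_left unit_closed) auto
  then show ?thesis using assms by (auto simp: unit_def fun_eq_iff)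
qed

text \<open>
  A triangular matrix is rebuilt from its entries, one at a time.  In this way linearity of an
  additive map has to be checked for matrix units only.
\<close>

lemma T_induct [consumes 1, case_names zero add unit]:
  assumes t: "t \<in> carrier T" and zero: "P \<zero>\<^bsub>T\<^esub>"
    and add: "\<And>s t. \<lbrakk>s \<in> carrier T; t \<in> carrier T; P s; P t\<rbrakk> \<Longrightarrow> P (s \<oplus>\<^bsub>T\<^esub> t)"
    and unit: "\<And>i j a. \<lbrakk>1 \<le> i; i \<le> j; j \<le> n; a \<in> carrier A\<rbrakk> \<Longrightarrow> P (unit i j a)"
  shows "P t"
proof -
  define r where "r S = (\<lambda>k l. if (k, l) \<in> S then t k l else \<zero>)" for S
  have "r S \<in> carrier T \<and> P (r S)" if "finite S" for S
    using that
  proof (induct S)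
    case empty
    have "r {} = \<zero>\<^bsub>T\<^esub>" by (simp add: r_def)
    then show ?case using zero ring.ring_simprules(2)[OF ring_T] by simp
  next
    case (insert p S)
    obtain i j where p: "p = (i, j)" by (cases p)
    show ?case
    proof (cases "1 \<le> i \<and> i \<le> j \<and> j \<le> n")
      case True
      have u: "unit i j (t i j) \<in> carrier T" "P (unit i j (t i j))"
        using True T_entry[OF t] unit by auto
      have "r (insert p S) = r S \<oplus>\<^bsub>T\<^esub> unit i j (t i j)"
        using insert(2) p T_entry[OF t] by (auto simp: r_def unit_def fun_eq_iff)
      then show ?thesis using add insert(3) u ring.ring_simprules(1)[OF ring_T] by auto
    next
      case False
      then have "r (insert p S) = r S" using p T_entry_zero[OF t, of i j] by (auto simp: r_def fun_eq_iff)
      then show ?thesis using insert(3) by simp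
    qed
  qed
  then have "P (r ({1..n} \<times> {1..n}))" by simp
  moreover have "r ({1..n} \<times> {1..n}) = t"
    using T_entry_zero[OF t] by (auto simp: r_def fun_eq_iff)
  ultimately show ?thesis by simp
qed

text \<open>
  Multiplication by the matrix unit at \<open>(1, j)\<close> is the composite structure map from the \<open>j\<close>-th
  branch \<open>e\<^sub>j\<^sub>j P\<close> to the first one.  So these are the \<open>T\<close>-modules whose composite structure maps into
  the first branch are injective, expressed by the action of \<open>T\<close> alone.
\<close>

definition mono_type :: "(nat \<Rightarrow> nat \<Rightarrow> 'a, 'x, 'q) module_scheme \<Rightarrow> bool" where
  "mono_type P \<longleftrightarrow> (\<forall>j \<in> {1..n}. \<forall>x \<in> carrier P.
     unit 1 j \<one> \<odot>\<^bsub>P\<^esub> x = \<zero>\<^bsub>P\<^esub> \<longrightarrow> unit j j \<one> \<odot>\<^bsub>P\<^esub> x = \<zero>\<^bsub>P\<^esub>)"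

text \<open>
  Multiplying a matrix by the unit at \<open>(1, j)\<close> moves its \<open>j\<close>-th row to the first row.
\<close>

lemma mono_type_free: "mono_type (free T k)"
  unfolding mono_type_def
proof (intro ballI impI)
  fix j x assume j: "j \<in> {1..n}" and x: "x \<in> carrier (free T k)"
    and z: "unit 1 j \<one> \<odot>\<^bsub>free T k\<^esub> x = \<zero>\<^bsub>free T k\<^esub>"
  have xi: "x i \<in> carrier T" if "i < k" for i using x that by (auto simp: free_simps)
  have "unit j j \<one> \<otimes>\<^bsub>T\<^esub> x i = \<zero>\<^bsub>T\<^esub>" if i: "i < k" for i
  proof -
    have "unit 1 j \<one> \<otimes>\<^bsub>T\<^esub> x i = \<zero>\<^bsub>T\<^esub>" using fun_cong[OF z, of i] i by (simp add: free_simps)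
    then have "(unit 1 j \<one> \<otimes>\<^bsub>T\<^esub> x i) 1 l = \<zero>" for l by simp
    then have "x i j l = \<zero>" for l
      unfolding unit_mult_left[OF j one_closed xi[OF i]] using T_entry[OF xi[OF i]] by simp
    then show ?thesis using j xi[OF i] by (simp add: unit_mult_left fun_eq_iff)
  qed
  then show "unit j j \<one> \<odot>\<^bsub>free T k\<^esub> x = \<zero>\<^bsub>free T k\<^esub>"
    by (auto simp: free_simps intro!: restrict_ext)
qed

end


section \<open>Modules over triangular matrix rings\<close>

locale triangular_object = triangular A n for A :: "('a, 'p) ring_scheme" (structure) and n +
  fixes Y :: "('a, 'x) mor_obj"
  assumes branch: "i \<in> {1..n} \<Longrightarrow> left_module A (branch Y i)"
    and str: "i \<in> {1..<n} \<Longrightarrow> str Y i \<in> lin_maps A (branch Y (Suc i)) (branch Y i)"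
begin

abbreviation "X \<equiv> T_module n Y"

lemma str_comp_same [simp]: "str_comp Y i i = id"
  by (simp add: str_comp_def)

lemma str_comp_step: "i < j \<Longrightarrow> str_comp Y i j = str Y i \<circ> str_comp Y (Suc i) j"
  by (simp add: str_comp_def upt_conv_Cons)

lemma str_comp_trans:
  assumes "i \<le> j" "j \<le> k" shows "str_comp Y i j (str_comp Y j k x) = str_comp Y i k x"
  using assms(1)
proof (induct rule: inc_induct)
  case base show ?case by simp
next
  case (step m)
  then show ?case using assms(2) by (simp add: str_comp_step)
qed

lemma str_comp_lin:
  assumes "1 \<le> i" "i \<le> j" "j \<le> n" shows "str_comp Y i j \<in> lin_maps A (branch Y j) (branch Y i)"
  using assms(2,1)
proof (induct rule: inc_induct)
  case base show ?case by (intro lin_mapsI) auto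
next
  case (step m)
  note l = lin_mapsD[OF step(3)]
  have m: "str Y m \<in> lin_maps A (branch Y (Suc m)) (branch Y m)" using step assms(3) by (intro str) auto
  show ?case using step(2) l lin_mapsD[OF m] by (intro lin_mapsI) (auto simp: str_comp_step)
qed

lemmas str_compD = lin_mapsD[OF str_comp_lin]

text \<open>
  The composite structure maps, extended by zero to the indices below the diagonal.  They allow the
  action of \<open>T\<close> to be written with sums over the full range of indices.
\<close>

definition \<psi> :: "nat \<Rightarrow> nat \<Rightarrow> 'x \<Rightarrow> 'x" where
  "\<psi> i j y = (if i \<le> j then str_comp Y i j y else \<zero>\<^bsub>branch Y i\<^esub>)"

lemma \<psi>_lin:
  assumes "i \<in> {1..n}" "j \<in> {1..n}" shows "\<psi> i j \<in> lin_maps A (branch Y j) (branch Y i)"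
proof -
  interpret B: left_module A "branch Y i" by (rule branch[OF assms(1)])
  show ?thesis
    using assms str_compD[of i j] by (intro lin_mapsI) (auto simp: \<psi>_def)
qed

lemma X_dsum:
  "carrier X = carrier (dsum {1..n} (branch Y))" "\<zero>\<^bsub>X\<^esub> = \<zero>\<^bsub>dsum {1..n} (branch Y)\<^esub>"
  "x \<oplus>\<^bsub>X\<^esub> y = x \<oplus>\<^bsub>dsum {1..n} (branch Y)\<^esub> y"
  by (simp_all add: T_module_def Let_def)

lemma X_simps:
  "carrier X = (\<Pi>\<^sub>E i \<in> {1..n}. carrier (branch Y i))"
  "\<zero>\<^bsub>X\<^esub> = (\<lambda>i \<in> {1..n}. \<zero>\<^bsub>branch Y i\<^esub>)"
  "x \<oplus>\<^bsub>X\<^esub> y = (\<lambda>i \<in> {1..n}. x i \<oplus>\<^bsub>branch Y i\<^esub> y i)"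
  by (simp_all add: T_module_def dsum_def)

lemma X_smult:
  assumes a: "a \<in> carrier T" and x: "x \<in> carrier X"
  shows "a \<odot>\<^bsub>X\<^esub> x = (\<lambda>i \<in> {1..n}. \<Oplus>\<^bsub>branch Y i\<^esub> j \<in> {1..n}. a i j \<odot>\<^bsub>branch Y i\<^esub> \<psi> i j (x j))"
proof -
  have "a \<odot>\<^bsub>X\<^esub> x = (\<lambda>i \<in> {1..n}. a i i \<odot>\<^bsub>branch Y i\<^esub> x i \<oplus>\<^bsub>branch Y i\<^esub>
      (\<Oplus>\<^bsub>branch Y i\<^esub> j \<in> {i<..n}. a i j \<odot>\<^bsub>branch Y i\<^esub> str_comp Y i j (x j)))"
    by (simp add: T_module_def Let_def)
  also have "\<dots> = (\<lambda>i \<in> {1..n}. \<Oplus>\<^bsub>branch Y i\<^esub> j \<in> {1..n}. a i j \<odot>\<^bsub>branch Y i\<^esub> \<psi> i j (x j))"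
  proof (rule restrict_ext)
    fix i assume i: "i \<in> {1..n}"
    interpret B: left_module A "branch Y i" using i by (intro branch) auto
    have xj: "x j \<in> carrier (branch Y j)" if "j \<in> {1..n}" for j using x that by (auto simp: X_simps)
    have cl: "a i j \<odot>\<^bsub>branch Y i\<^esub> \<psi> i j (x j) \<in> carrier (branch Y i)" if "j \<in> {1..n}" for j
      using T_entry[OF a] lin_mapsD(1)[OF \<psi>_lin xj] that i by simp
    have cl': "a i j \<odot>\<^bsub>branch Y i\<^esub> str_comp Y i j (x j) \<in> carrier (branch Y i)" if "j \<in> {i<..n}" for j
      using cl[of j] that i by (simp add: \<psi>_def)
    have "(\<Oplus>\<^bsub>branch Y i\<^esub> j \<in> {1..n}. a i j \<odot>\<^bsub>branch Y i\<^esub> \<psi> i j (x j))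
        = (\<Oplus>\<^bsub>branch Y i\<^esub> j \<in> insert i {i<..n}. a i j \<odot>\<^bsub>branch Y i\<^esub> \<psi> i j (x j))"
    proof (rule B.M.add.finprod_mono_neutral_cong_right[OF _ _ _ refl])
      show "insert i {i<..n} \<subseteq> {1..n}" using i by auto
      show "a i j \<odot>\<^bsub>branch Y i\<^esub> \<psi> i j (x j) = \<zero>\<^bsub>branch Y i\<^esub>" if "j \<in> {1..n} - insert i {i<..n}" for j
        using T_entry[OF a] that by (auto simp: \<psi>_def)
    qed (use cl in auto)
    also have "\<dots> = a i i \<odot>\<^bsub>branch Y i\<^esub> \<psi> i i (x i) \<oplus>\<^bsub>branch Y i\<^esub>
        (\<Oplus>\<^bsub>branch Y i\<^esub> j \<in> {i<..n}. a i j \<odot>\<^bsub>branch Y i\<^esub> \<psi> i j (x j))"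
      using cl i by (intro B.M.finsum_insert) auto
    also have "(\<Oplus>\<^bsub>branch Y i\<^esub> j \<in> {i<..n}. a i j \<odot>\<^bsub>branch Y i\<^esub> \<psi> i j (x j))
        = (\<Oplus>\<^bsub>branch Y i\<^esub> j \<in> {i<..n}. a i j \<odot>\<^bsub>branch Y i\<^esub> str_comp Y i j (x j))"
      using cl' by (intro B.M.finsum_cong') (auto simp: \<psi>_def)
    finally show "a i i \<odot>\<^bsub>branch Y i\<^esub> x i \<oplus>\<^bsub>branch Y i\<^esub>
        (\<Oplus>\<^bsub>branch Y i\<^esub> j \<in> {i<..n}. a i j \<odot>\<^bsub>branch Y i\<^esub> str_comp Y i j (x j))
      = (\<Oplus>\<^bsub>branch Y i\<^esub> j \<in> {1..n}. a i j \<odot>\<^bsub>branch Y i\<^esub> \<psi> i j (x j))"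
      by (simp add: \<psi>_def)
  qed
  finally show ?thesis .
qed

lemma diag_smult:
  assumes a: "a \<in> carrier A" and x: "x \<in> carrier X"
  shows "diag a \<odot>\<^bsub>X\<^esub> x = (\<lambda>i \<in> {1..n}. a \<odot>\<^bsub>branch Y i\<^esub> x i)"
proof -
  note sm = X_smult[OF diag_closed[OF a] x]
  show ?thesis
    unfolding sm
  proof (rule restrict_ext)
    fix i assume i: "i \<in> {1..n}"
    interpret B: left_module A "branch Y i" by (rule branch[OF i])
    have xj: "x j \<in> carrier (branch Y j)" if "j \<in> {1..n}" for j using x that by (auto simp: X_simps)
    note c = lin_mapsD(1)[OF \<psi>_lin[OF i] xj]
    have "(\<Oplus>\<^bsub>branch Y i\<^esub> j \<in> {1..n}. diag a i j \<odot>\<^bsub>branch Y i\<^esub> \<psi> i j (x j))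
        = (\<Oplus>\<^bsub>branch Y i\<^esub> j \<in> {1..n}. if i = j then a \<odot>\<^bsub>branch Y i\<^esub> \<psi> i j (x j) else \<zero>\<^bsub>branch Y i\<^esub>)"
      using c a i by (intro B.M.finsum_cong') (auto simp: diag_def)
    also have "\<dots> = a \<odot>\<^bsub>branch Y i\<^esub> \<psi> i i (x i)" using c a i by (intro B.M.finsum_singleton) auto
    finally show "(\<Oplus>\<^bsub>branch Y i\<^esub> j \<in> {1..n}. diag a i j \<odot>\<^bsub>branch Y i\<^esub> \<psi> i j (x j))
        = a \<odot>\<^bsub>branch Y i\<^esub> x i" by (simp add: \<psi>_def)
  qed
qed

text \<open>
  Compatibility with the product of matrices is a change of the order of summation together with
  \<open>str_comp_trans\<close>.  The terms with indices outside \<open>i \<le> k \<le> j\<close>, where the composites do not match,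
  have a zero coefficient.
\<close>

lemma left_module_X: "left_module T X"
proof -
  define D where "D = dsum {1..n} (branch Y)"
  have "left_module A D"
    unfolding D_def using branch by (intro left_module_dsum ring_axioms) auto
  then interpret D: left_module A D .
  have eq: "carrier X = carrier D" "\<zero>\<^bsub>X\<^esub> = \<zero>\<^bsub>D\<^esub>" "\<And>x y. x \<oplus>\<^bsub>X\<^esub> y = x \<oplus>\<^bsub>D\<^esub> y"
    by (simp_all add: X_dsum D_def)
  have ab: "abelian_group X"
  proof (rule abelian_groupI)
    show "\<exists>y \<in> carrier X. y \<oplus>\<^bsub>X\<^esub> x = \<zero>\<^bsub>X\<^esub>" if "x \<in> carrier X" for x
      using that D.M.l_neg[of x] D.M.a_inv_closed[of x] by (auto simp: eq)
  qed (auto simp: eq D.M.a_ac)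
  have xj: "x j \<in> carrier (branch Y j)" if "x \<in> carrier X" "j \<in> {1..n}" for x j
    using that by (auto simp: X_simps)
  have summand: "a i j \<odot>\<^bsub>branch Y i\<^esub> \<psi> i j (x j) \<in> carrier (branch Y i)"
    if "a \<in> carrier T" "x \<in> carrier X" "i \<in> {1..n}" "j \<in> {1..n}" for a x i j
    using left_module.smult_closed[OF branch[OF that(3)] T_entry[OF that(1)]]
      lin_mapsD(1)[OF \<psi>_lin[OF that(3,4)] xj[OF that(2,4)]] .
  have closed: "a \<odot>\<^bsub>X\<^esub> x \<in> carrier X" if "a \<in> carrier T" "x \<in> carrier X" for a x
  proof -
    have "(\<Oplus>\<^bsub>branch Y i\<^esub> j \<in> {1..n}. a i j \<odot>\<^bsub>branch Y i\<^esub> \<psi> i j (x j)) \<in> carrier (branch Y i)"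
      if i: "i \<in> {1..n}" for i
    proof -
      interpret B: left_module A "branch Y i" by (rule branch[OF i])
      show ?thesis using summand \<open>a \<in> carrier T\<close> \<open>x \<in> carrier X\<close> i by (intro B.M.finsum_closed) auto
    qed
    then show ?thesis using X_smult[OF that] by (simp add: X_simps)
  qed
  show ?thesis
  proof (intro left_module.intro ring_T ab left_module_axioms.intro closed)
    fix a b x assume a: "a \<in> carrier T" and b: "b \<in> carrier T" and x: "x \<in> carrier X"
    have ab': "a \<oplus>\<^bsub>T\<^esub> b \<in> carrier T" "a \<otimes>\<^bsub>T\<^esub> b \<in> carrier T"
      using a b ring.ring_simprules(1,5)[OF ring_T] by auto
    note e = T_entry[OF a] T_entry[OF b]
    show "(a \<oplus>\<^bsub>T\<^esub> b) \<odot>\<^bsub>X\<^esub> x = a \<odot>\<^bsub>X\<^esub> x \<oplus>\<^bsub>X\<^esub> b \<odot>\<^bsub>X\<^esub> x"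
      unfolding X_smult[OF ab'(1) x] X_smult[OF a x] X_smult[OF b x] X_simps
    proof (rule restrict_ext)
      fix i assume i: "i \<in> {1..n}"
      interpret B: left_module A "branch Y i" by (rule branch[OF i])
      have "(\<Oplus>\<^bsub>branch Y i\<^esub> j \<in> {1..n}. (a \<oplus>\<^bsub>T\<^esub> b) i j \<odot>\<^bsub>branch Y i\<^esub> \<psi> i j (x j))
          = (\<Oplus>\<^bsub>branch Y i\<^esub> j \<in> {1..n}. a i j \<odot>\<^bsub>branch Y i\<^esub> \<psi> i j (x j) \<oplus>\<^bsub>branch Y i\<^esub> b i j \<odot>\<^bsub>branch Y i\<^esub> \<psi> i j (x j))"
        using e lin_mapsD(1)[OF \<psi>_lin[OF i] xj[OF x]] by (intro B.M.finsum_cong') (auto simp: B.smult_l_distr)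
      also have "\<dots> = (\<Oplus>\<^bsub>branch Y i\<^esub> j \<in> {1..n}. a i j \<odot>\<^bsub>branch Y i\<^esub> \<psi> i j (x j)) \<oplus>\<^bsub>branch Y i\<^esub>
          (\<Oplus>\<^bsub>branch Y i\<^esub> j \<in> {1..n}. b i j \<odot>\<^bsub>branch Y i\<^esub> \<psi> i j (x j))"
        using summand[OF a x i] summand[OF b x i] by (intro B.M.finsum_addf) auto
      finally show "(\<Oplus>\<^bsub>branch Y i\<^esub> j \<in> {1..n}. (a \<oplus>\<^bsub>T\<^esub> b) i j \<odot>\<^bsub>branch Y i\<^esub> \<psi> i j (x j)) =
          (\<lambda>i \<in> {1..n}. \<Oplus>\<^bsub>branch Y i\<^esub> j \<in> {1..n}. a i j \<odot>\<^bsub>branch Y i\<^esub> \<psi> i j (x j)) i \<oplus>\<^bsub>branch Y i\<^esub>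
          (\<lambda>i \<in> {1..n}. \<Oplus>\<^bsub>branch Y i\<^esub> j \<in> {1..n}. b i j \<odot>\<^bsub>branch Y i\<^esub> \<psi> i j (x j)) i"
        using i by simp
    qed
    show "(a \<otimes>\<^bsub>T\<^esub> b) \<odot>\<^bsub>X\<^esub> x = a \<odot>\<^bsub>X\<^esub> (b \<odot>\<^bsub>X\<^esub> x)"
      unfolding X_smult[OF ab'(2) x] X_smult[OF a closed[OF b x]]
    proof (rule restrict_ext)
      fix i assume i: "i \<in> {1..n}"
      interpret B: left_module A "branch Y i" by (rule branch[OF i])
      have \<psi>c: "\<psi> i j (x j) \<in> carrier (branch Y i)" if "j \<in> {1..n}" for j
        using lin_mapsD(1)[OF \<psi>_lin[OF i that] xj[OF x that]] .
      have "(\<Oplus>\<^bsub>branch Y i\<^esub> j \<in> {1..n}. (a \<otimes>\<^bsub>T\<^esub> b) i j \<odot>\<^bsub>branch Y i\<^esub> \<psi> i j (x j))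
          = (\<Oplus>\<^bsub>branch Y i\<^esub> j \<in> {1..n}. \<Oplus>\<^bsub>branch Y i\<^esub> k \<in> {1..n}. (a i k \<otimes> b k j) \<odot>\<^bsub>branch Y i\<^esub> \<psi> i j (x j))"
        unfolding T_mult using e \<psi>c by (intro B.M.finsum_cong') (auto simp: B.finsum_smult_left Pi_iff
          intro!: B.M.finsum_closed)
      also have "\<dots> = (\<Oplus>\<^bsub>branch Y i\<^esub> k \<in> {1..n}. \<Oplus>\<^bsub>branch Y i\<^esub> j \<in> {1..n}. (a i k \<otimes> b k j) \<odot>\<^bsub>branch Y i\<^esub> \<psi> i j (x j))"
        using e \<psi>c by (intro B.M.finsum_swap) auto
      also have "\<dots> = (\<Oplus>\<^bsub>branch Y i\<^esub> k \<in> {1..n}. a i k \<odot>\<^bsub>branch Y i\<^esub> \<psi> i k ((b \<odot>\<^bsub>X\<^esub> x) k))"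
      proof (rule B.M.finsum_cong')
        show "(\<lambda>k. a i k \<odot>\<^bsub>branch Y i\<^esub> \<psi> i k ((b \<odot>\<^bsub>X\<^esub> x) k)) \<in> {1..n} \<rightarrow> carrier (branch Y i)"
          using summand[OF a closed[OF b x] i] by auto
        fix k assume k: "k \<in> {1..n}"
        have t: "b k j \<odot>\<^bsub>branch Y k\<^esub> \<psi> k j (x j) \<in> carrier (branch Y k)" if "j \<in> {1..n}" for j
          using summand[OF b x k that] .
        have "\<psi> i k ((b \<odot>\<^bsub>X\<^esub> x) k) = (\<Oplus>\<^bsub>branch Y i\<^esub> j \<in> {1..n}. \<psi> i k (b k j \<odot>\<^bsub>branch Y k\<^esub> \<psi> k j (x j)))"
          using X_smult[OF b x] k t lin_maps_finsum[OF branch[OF k] branch[OF i] \<psi>_lin[OF i k], of "{1..n}"]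
          by simp
        also have "a i k \<odot>\<^bsub>branch Y i\<^esub> \<dots> = (\<Oplus>\<^bsub>branch Y i\<^esub> j \<in> {1..n}. a i k \<odot>\<^bsub>branch Y i\<^esub> \<psi> i k (b k j \<odot>\<^bsub>branch Y k\<^esub> \<psi> k j (x j)))"
          using e lin_mapsD(1)[OF \<psi>_lin[OF i k] t] by (intro B.finsum_smult) auto
        also have "\<dots> = (\<Oplus>\<^bsub>branch Y i\<^esub> j \<in> {1..n}. (a i k \<otimes> b k j) \<odot>\<^bsub>branch Y i\<^esub> \<psi> i j (x j))"
        proof (rule B.M.finsum_cong')
          show "(\<lambda>j. (a i k \<otimes> b k j) \<odot>\<^bsub>branch Y i\<^esub> \<psi> i j (x j)) \<in> {1..n} \<rightarrow> carrier (branch Y i)"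
            using e \<psi>c by auto
          fix j assume j: "j \<in> {1..n}"
          have \<psi>k: "\<psi> k j (x j) \<in> carrier (branch Y k)" using lin_mapsD(1)[OF \<psi>_lin[OF k j] xj[OF x j]] .
          note \<psi>ik = lin_mapsD[OF \<psi>_lin[OF i k]]
          have "a i k \<odot>\<^bsub>branch Y i\<^esub> \<psi> i k (b k j \<odot>\<^bsub>branch Y k\<^esub> \<psi> k j (x j))
              = (a i k \<otimes> b k j) \<odot>\<^bsub>branch Y i\<^esub> \<psi> i k (\<psi> k j (x j))"
            using e \<psi>k \<psi>ik by (simp add: B.smult_assoc1)
          also have "\<dots> = (a i k \<otimes> b k j) \<odot>\<^bsub>branch Y i\<^esub> \<psi> i j (x j)"
          proof (cases "i \<le> k \<and> k \<le> j")
            case True then show ?thesis using str_comp_trans[of i k j] by (simp add: \<psi>_def)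
          next
            case False
            then have "a i k = \<zero> \<or> b k j = \<zero>" using T_entry_zero[OF a, of i k] T_entry_zero[OF b, of k j] by auto
            then have "a i k \<otimes> b k j = \<zero>" using e by auto
            then show ?thesis using \<psi>c[OF j] \<psi>ik(1)[OF \<psi>k] by simp
          qed
          finally show "a i k \<odot>\<^bsub>branch Y i\<^esub> \<psi> i k (b k j \<odot>\<^bsub>branch Y k\<^esub> \<psi> k j (x j))
              = (a i k \<otimes> b k j) \<odot>\<^bsub>branch Y i\<^esub> \<psi> i j (x j)" .
        qed simp
        finally show "(\<Oplus>\<^bsub>branch Y i\<^esub> j \<in> {1..n}. (a i k \<otimes> b k j) \<odot>\<^bsub>branch Y i\<^esub> \<psi> i j (x j))
            = a i k \<odot>\<^bsub>branch Y i\<^esub> \<psi> i k ((b \<odot>\<^bsub>X\<^esub> x) k)" by simp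
      qed simp
      finally show "(\<Oplus>\<^bsub>branch Y i\<^esub> j \<in> {1..n}. (a \<otimes>\<^bsub>T\<^esub> b) i j \<odot>\<^bsub>branch Y i\<^esub> \<psi> i j (x j))
          = (\<Oplus>\<^bsub>branch Y i\<^esub> j \<in> {1..n}. a i j \<odot>\<^bsub>branch Y i\<^esub> \<psi> i j ((b \<odot>\<^bsub>X\<^esub> x) j))" .
    qed
  next
    fix a x y assume a: "a \<in> carrier T" and x: "x \<in> carrier X" and y: "y \<in> carrier X"
    have xy: "x \<oplus>\<^bsub>X\<^esub> y \<in> carrier X" using x y ab by (simp add: abelian_monoid.a_closed abelian_group.axioms)
    show "a \<odot>\<^bsub>X\<^esub> (x \<oplus>\<^bsub>X\<^esub> y) = a \<odot>\<^bsub>X\<^esub> x \<oplus>\<^bsub>X\<^esub> a \<odot>\<^bsub>X\<^esub> y"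
      unfolding X_smult[OF a xy] X_smult[OF a x] X_smult[OF a y] X_simps(3)[of "restrict _ _"]
    proof (rule restrict_ext)
      fix i assume i: "i \<in> {1..n}"
      interpret B: left_module A "branch Y i" by (rule branch[OF i])
      have "(\<Oplus>\<^bsub>branch Y i\<^esub> j \<in> {1..n}. a i j \<odot>\<^bsub>branch Y i\<^esub> \<psi> i j ((x \<oplus>\<^bsub>X\<^esub> y) j))
          = (\<Oplus>\<^bsub>branch Y i\<^esub> j \<in> {1..n}. a i j \<odot>\<^bsub>branch Y i\<^esub> \<psi> i j (x j) \<oplus>\<^bsub>branch Y i\<^esub> a i j \<odot>\<^bsub>branch Y i\<^esub> \<psi> i j (y j))"
      proof (rule B.M.finsum_cong')
        fix j assume j: "j \<in> {1..n}"
        show "a i j \<odot>\<^bsub>branch Y i\<^esub> \<psi> i j ((x \<oplus>\<^bsub>X\<^esub> y) j)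
          = a i j \<odot>\<^bsub>branch Y i\<^esub> \<psi> i j (x j) \<oplus>\<^bsub>branch Y i\<^esub> a i j \<odot>\<^bsub>branch Y i\<^esub> \<psi> i j (y j)"
          using T_entry[OF a] lin_mapsD[OF \<psi>_lin[OF i j]] xj[OF x j] xj[OF y j] j
          by (simp add: X_simps B.smult_r_distr)
      qed (use summand[OF a x i] summand[OF a y i] in auto)
      also have "\<dots> = (\<Oplus>\<^bsub>branch Y i\<^esub> j \<in> {1..n}. a i j \<odot>\<^bsub>branch Y i\<^esub> \<psi> i j (x j)) \<oplus>\<^bsub>branch Y i\<^esub>
          (\<Oplus>\<^bsub>branch Y i\<^esub> j \<in> {1..n}. a i j \<odot>\<^bsub>branch Y i\<^esub> \<psi> i j (y j))"
        using summand[OF a x i] summand[OF a y i] by (intro B.M.finsum_addf) auto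
      finally show "(\<Oplus>\<^bsub>branch Y i\<^esub> j \<in> {1..n}. a i j \<odot>\<^bsub>branch Y i\<^esub> \<psi> i j ((x \<oplus>\<^bsub>X\<^esub> y) j)) =
          (\<lambda>i \<in> {1..n}. \<Oplus>\<^bsub>branch Y i\<^esub> j \<in> {1..n}. a i j \<odot>\<^bsub>branch Y i\<^esub> \<psi> i j (x j)) i \<oplus>\<^bsub>branch Y i\<^esub>
          (\<lambda>i \<in> {1..n}. \<Oplus>\<^bsub>branch Y i\<^esub> j \<in> {1..n}. a i j \<odot>\<^bsub>branch Y i\<^esub> \<psi> i j (y j)) i"
        using i by simp
    qed
  next
    fix x assume x: "x \<in> carrier X"
    have "\<one>\<^bsub>T\<^esub> \<odot>\<^bsub>X\<^esub> x = (\<lambda>i \<in> {1..n}. \<one> \<odot>\<^bsub>branch Y i\<^esub> x i)"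
      using diag_smult[OF one_closed x] by simp
    also have "\<dots> = (\<lambda>i \<in> {1..n}. x i)"
      using left_module.smult_one[OF branch xj[OF x]] by (intro restrict_ext) simp
    also have "\<dots> = x" using x unfolding X_simps by (simp add: PiE_restrict)
    finally show "\<one>\<^bsub>T\<^esub> \<odot>\<^bsub>X\<^esub> x = x" .
  qed
qed

lemma unit_smult:
  assumes ij: "1 \<le> i" "i \<le> j" "j \<le> n" and a: "a \<in> carrier A" and x: "x \<in> carrier X"
  shows "unit i j a \<odot>\<^bsub>X\<^esub> x =
    (\<lambda>k \<in> {1..n}. if k = i then a \<odot>\<^bsub>branch Y i\<^esub> str_comp Y i j (x j) else \<zero>\<^bsub>branch Y k\<^esub>)"
  unfolding X_smult[OF unit_closed[OF ij a] x]
proof (rule restrict_ext)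
  fix k assume k: "k \<in> {1..n}"
  interpret B: left_module A "branch Y k" by (rule branch[OF k])
  have xl: "x l \<in> carrier (branch Y l)" if "l \<in> {1..n}" for l using x that by (auto simp: X_simps)
  note c = lin_mapsD(1)[OF \<psi>_lin[OF k] xl]
  show "(\<Oplus>\<^bsub>branch Y k\<^esub> l \<in> {1..n}. unit i j a k l \<odot>\<^bsub>branch Y k\<^esub> \<psi> k l (x l))
      = (if k = i then a \<odot>\<^bsub>branch Y i\<^esub> str_comp Y i j (x j) else \<zero>\<^bsub>branch Y k\<^esub>)"
  proof (cases "i = k")
    case i: True
    have "(\<Oplus>\<^bsub>branch Y k\<^esub> l \<in> {1..n}. unit k j a k l \<odot>\<^bsub>branch Y k\<^esub> \<psi> k l (x l))
        = (\<Oplus>\<^bsub>branch Y k\<^esub> l \<in> {1..n}. if j = l then a \<odot>\<^bsub>branch Y k\<^esub> \<psi> k l (x l) else \<zero>\<^bsub>branch Y k\<^esub>)"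
      using c a by (intro B.M.finsum_cong') (auto simp: unit_def)
    also have "\<dots> = a \<odot>\<^bsub>branch Y k\<^esub> \<psi> k j (x j)"
      using c a ij by (intro B.M.finsum_singleton) auto
    finally show ?thesis using ij i by (simp add: \<psi>_def)
  next
    case False
    then show ?thesis using c by (auto simp: unit_def intro!: B.M.add.finprod_one_eqI)
  qed
qed

lemma fin_gen_X:
  assumes fg: "\<And>i. i \<in> {1..n} \<Longrightarrow> fin_gen A (branch Y i)"
  shows "fin_gen T X"
proof -
  interpret X: left_module T X by (rule left_module_X)
  have "\<exists>G. finite G \<and> G \<subseteq> carrier (branch Y i) \<and> lin_span A (branch Y i) G = carrier (branch Y i)"
    if "i \<in> {1..n}" for i using fg[OF that] left_module.fin_gen_iff_lin_span[OF branch[OF that]] by blast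
  then obtain G where G: "\<And>i. i \<in> {1..n} \<Longrightarrow> finite (G i) \<and> G i \<subseteq> carrier (branch Y i) \<and>
      lin_span A (branch Y i) (G i) = carrier (branch Y i)" by metis
  define single where "single i y = (\<lambda>k \<in> {1..n}. if k = i then y else \<zero>\<^bsub>branch Y k\<^esub>)" for i y
  have z: "\<zero>\<^bsub>branch Y k\<^esub> \<in> carrier (branch Y k)" if "k \<in> {1..n}" for k
  proof -
    interpret B: left_module A "branch Y k" by (rule branch[OF that])
    show ?thesis by simp
  qed
  have sc: "single i y \<in> carrier X" if "i \<in> {1..n}" "y \<in> carrier (branch Y i)" for i y
    using that z by (auto simp: single_def X_simps)
  define S where "S = lin_span T X (\<Union>i \<in> {1..n}. single i ` G i)"
  have gens: "(\<Union>i \<in> {1..n}. single i ` G i) \<subseteq> carrier X" using G sc by blast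
  have S: "submodule S T X" unfolding S_def by (rule X.submodule_lin_span[OF gens])
  note s = X.submoduleD[OF S]
  have singleS: "single i y \<in> S" if i: "i \<in> {1..n}" and y: "y \<in> carrier (branch Y i)" for i y
  proof -
    interpret B: left_module A "branch Y i" by (rule branch[OF i])
    have "submodule {y \<in> carrier (branch Y i). single i y \<in> S} A (branch Y i)"
    proof (rule B.submoduleI)
      have "single i \<zero>\<^bsub>branch Y i\<^esub> = \<zero>\<^bsub>X\<^esub>" by (auto simp: single_def X_simps)
      then show "\<zero>\<^bsub>branch Y i\<^esub> \<in> {y \<in> carrier (branch Y i). single i y \<in> S}" using s(2) by simp
    next
      fix u v assume uv: "u \<in> {y \<in> carrier (branch Y i). single i y \<in> S}"
        "v \<in> {y \<in> carrier (branch Y i). single i y \<in> S}"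
      have "single i (u \<oplus>\<^bsub>branch Y i\<^esub> v) = single i u \<oplus>\<^bsub>X\<^esub> single i v"
        unfolding single_def X_simps
      proof (rule restrict_ext)
        fix k assume k: "k \<in> {1..n}"
        interpret K: left_module A "branch Y k" by (rule branch[OF k])
        show "(if k = i then u \<oplus>\<^bsub>branch Y i\<^esub> v else \<zero>\<^bsub>branch Y k\<^esub>)
          = (\<lambda>k \<in> {1..n}. if k = i then u else \<zero>\<^bsub>branch Y k\<^esub>) k \<oplus>\<^bsub>branch Y k\<^esub>
            (\<lambda>k \<in> {1..n}. if k = i then v else \<zero>\<^bsub>branch Y k\<^esub>) k" using k by simp
      qed
      then show "u \<oplus>\<^bsub>branch Y i\<^esub> v \<in> {y \<in> carrier (branch Y i). single i y \<in> S}" using uv s(4) by simp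
    next
      fix a u assume a: "a \<in> carrier A" and u: "u \<in> {y \<in> carrier (branch Y i). single i y \<in> S}"
      have "single i (a \<odot>\<^bsub>branch Y i\<^esub> u) = unit i i a \<odot>\<^bsub>X\<^esub> single i u"
        using i a u sc[OF i, of u] by (subst unit_smult) (auto simp: single_def)
      then show "a \<odot>\<^bsub>branch Y i\<^esub> u \<in> {y \<in> carrier (branch Y i). single i y \<in> S}"
        using a u s(5) i by simp
    qed auto
    moreover have "G i \<subseteq> {y \<in> carrier (branch Y i). single i y \<in> S}"
      using G[OF i] i lin_span_incl[of "\<Union>i \<in> {1..n}. single i ` G i" T X] unfolding S_def by blast
    ultimately have "lin_span A (branch Y i) (G i) \<subseteq> {y \<in> carrier (branch Y i). single i y \<in> S}"
      by (rule lin_span_least)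
    then show ?thesis using G[OF i] y by blast
  qed
  have "x \<in> S" if x: "x \<in> carrier X" for x
    using ring_axioms finite_atLeastAtMost x[unfolded X_dsum]
  proof (induct rule: dsum_induct)
    case (single i y)
    show ?case using singleS[OF single] unfolding single_def .
  qed (use branch s(2,4) in \<open>simp_all add: X_dsum\<close>)
  then have "S = carrier X" using s(1) by blast
  then show ?thesis
    unfolding X.fin_gen_iff_lin_span S_def using gens G
    by (intro exI[of _ "\<Union>i \<in> {1..n}. single i ` G i"]) auto
qed

lemma str_comp_zero:
  assumes "1 \<le> i" "i \<le> j" "j \<le> n" shows "str_comp Y i j \<zero>\<^bsub>branch Y j\<^esub> = \<zero>\<^bsub>branch Y i\<^esub>"
  using assms by (intro lin_maps_zero[OF branch branch str_comp_lin]) auto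

text \<open>
  If \<open>\<phi>\<^sub>1 \<dots> \<phi>\<^sub>i\<close> is injective, then so is its first factor to be applied, \<open>\<phi>\<^sub>i\<close>; and a composite of
  injective maps is injective.
\<close>

lemma mono_type_iff_inj_on_str:
  "mono_type X \<longleftrightarrow> (\<forall>i \<in> {1..<n}. inj_on (str Y i) (carrier (branch Y (Suc i))))"
proof -
  have z: "\<zero>\<^bsub>branch Y k\<^esub> \<in> carrier (branch Y k)" if "k \<in> {1..n}" for k
  proof -
    interpret B: left_module A "branch Y k" by (rule branch[OF that])
    show ?thesis by simp
  qed
  have unit0: "unit i j \<one> \<odot>\<^bsub>X\<^esub> x = \<zero>\<^bsub>X\<^esub> \<longleftrightarrow> str_comp Y i j (x j) = \<zero>\<^bsub>branch Y i\<^esub>"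
    if ij: "1 \<le> i" "i \<le> j" "j \<le> n" and x: "x \<in> carrier X" for i j x
  proof -
    interpret B: left_module A "branch Y i" using ij by (intro branch) auto
    have "x j \<in> carrier (branch Y j)" using x ij by (auto simp: X_simps)
    then have one: "\<one> \<odot>\<^bsub>branch Y i\<^esub> str_comp Y i j (x j) = str_comp Y i j (x j)"
      using str_compD(1)[OF ij] by simp
    have eq: "unit i j \<one> \<odot>\<^bsub>X\<^esub> x = (\<lambda>k \<in> {1..n}. if k = i then str_comp Y i j (x j) else \<zero>\<^bsub>branch Y k\<^esub>)"
      unfolding unit_smult[OF ij one_closed x] one by (rule refl)
    show ?thesis
    proof
      assume "unit i j \<one> \<odot>\<^bsub>X\<^esub> x = \<zero>\<^bsub>X\<^esub>"
      then have "(unit i j \<one> \<odot>\<^bsub>X\<^esub> x) i = \<zero>\<^bsub>X\<^esub> i" by simp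
      then show "str_comp Y i j (x j) = \<zero>\<^bsub>branch Y i\<^esub>" using ij unfolding eq X_simps by simp
    next
      assume "str_comp Y i j (x j) = \<zero>\<^bsub>branch Y i\<^esub>"
      then show "unit i j \<one> \<odot>\<^bsub>X\<^esub> x = \<zero>\<^bsub>X\<^esub>" unfolding eq X_simps by (intro restrict_ext) simp
    qed
  qed
  have "mono_type X \<longleftrightarrow> (\<forall>j \<in> {1..n}. \<forall>y \<in> carrier (branch Y j).
      str_comp Y 1 j y = \<zero>\<^bsub>branch Y 1\<^esub> \<longrightarrow> y = \<zero>\<^bsub>branch Y j\<^esub>)"
  proof -
    have "(\<forall>x \<in> carrier X. unit 1 j \<one> \<odot>\<^bsub>X\<^esub> x = \<zero>\<^bsub>X\<^esub> \<longrightarrow> unit j j \<one> \<odot>\<^bsub>X\<^esub> x = \<zero>\<^bsub>X\<^esub>) \<longleftrightarrow>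
      (\<forall>y \<in> carrier (branch Y j). str_comp Y 1 j y = \<zero>\<^bsub>branch Y 1\<^esub> \<longrightarrow> y = \<zero>\<^bsub>branch Y j\<^esub>)" (is "?l \<longleftrightarrow> ?r")
      if j: "j \<in> {1..n}" for j
    proof
      assume l: ?l
      show ?r
      proof (intro ballI impI)
        fix y assume y: "y \<in> carrier (branch Y j)" "str_comp Y 1 j y = \<zero>\<^bsub>branch Y 1\<^esub>"
        define x where "x = (\<lambda>k \<in> {1..n}. if k = j then y else \<zero>\<^bsub>branch Y k\<^esub>)"
        have x: "x \<in> carrier X" "x j = y" using y j z by (auto simp: x_def X_simps)
        have "unit 1 j \<one> \<odot>\<^bsub>X\<^esub> x = \<zero>\<^bsub>X\<^esub>" using unit0[of 1 j x] x y(2) j by simp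
        then have "unit j j \<one> \<odot>\<^bsub>X\<^esub> x = \<zero>\<^bsub>X\<^esub>" using l x(1) by blast
        then show "y = \<zero>\<^bsub>branch Y j\<^esub>" using unit0[of j j x] x j by simp
      qed
    next
      assume r: ?r
      show ?l
      proof (intro ballI impI)
        fix x assume x: "x \<in> carrier X" "unit 1 j \<one> \<odot>\<^bsub>X\<^esub> x = \<zero>\<^bsub>X\<^esub>"
        have "x j \<in> carrier (branch Y j)" using x(1) j by (auto simp: X_simps)
        moreover have "str_comp Y 1 j (x j) = \<zero>\<^bsub>branch Y 1\<^esub>" using unit0[of 1 j x] x j by simp
        ultimately have "x j = \<zero>\<^bsub>branch Y j\<^esub>" using r by blast
        then show "unit j j \<one> \<odot>\<^bsub>X\<^esub> x = \<zero>\<^bsub>X\<^esub>" using unit0[of j j x] x(1) j by simp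
      qed
    qed
    then show ?thesis unfolding mono_type_def by (intro ball_cong refl)
  qed
  also have "\<dots> \<longleftrightarrow> (\<forall>i \<in> {1..<n}. inj_on (str Y i) (carrier (branch Y (Suc i))))" (is "?l \<longleftrightarrow> ?r")
  proof
    assume l: ?l
    show ?r
    proof (intro ballI inj_onI)
      fix i y y' assume i: "i \<in> {1..<n}" and y: "y \<in> carrier (branch Y (Suc i))" "y' \<in> carrier (branch Y (Suc i))"
        and e: "str Y i y = str Y i y'"
      have ii: "i \<in> {1..n}" "Suc i \<in> {1..n}" using i by auto
      interpret S: left_module A "branch Y (Suc i)" by (rule branch[OF ii(2)])
      interpret B: left_module A "branch Y i" by (rule branch[OF ii(1)])
      let ?d = "y \<oplus>\<^bsub>branch Y (Suc i)\<^esub> \<ominus>\<^bsub>branch Y (Suc i)\<^esub> y'"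
      note st = lin_mapsD[OF str[OF i]] lin_maps_minus[OF branch[OF ii(2)] branch[OF ii(1)] str[OF i]]
      have "str Y i ?d = \<zero>\<^bsub>branch Y i\<^esub>" using st y e by (simp add: B.M.r_neg)
      moreover have "str_comp Y 1 (Suc i) ?d = str_comp Y 1 i (str Y i ?d)"
        using str_comp_trans[of 1 i "Suc i" ?d] ii by (simp add: str_comp_step)
      ultimately have "str_comp Y 1 (Suc i) ?d = \<zero>\<^bsub>branch Y 1\<^esub>" using str_comp_zero[of 1 i] ii by simp
      then have "?d = \<zero>\<^bsub>branch Y (Suc i)\<^esub>" using l ii(2) y by blast
      then have "\<ominus>\<^bsub>branch Y (Suc i)\<^esub> (\<ominus>\<^bsub>branch Y (Suc i)\<^esub> y') = y"
        using y by (intro S.M.minus_equality) auto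
      then show "y = y'" using y by simp
    qed
  next
    assume r: ?r
    have "y = \<zero>\<^bsub>branch Y j\<^esub>" if "1 \<le> j" "j \<le> n" "y \<in> carrier (branch Y j)" "str_comp Y 1 j y = \<zero>\<^bsub>branch Y 1\<^esub>" for j y
      using that
    proof (induct j arbitrary: y rule: dec_induct)
      case base then show ?case by simp
    next
      case (step i)
      have i: "i \<in> {1..<n}" "i \<in> {1..n}" "Suc i \<in> {1..n}" using step by auto
      note st = lin_mapsD[OF str[OF i(1)]]
      have "str_comp Y 1 (Suc i) y = str_comp Y 1 i (str Y i y)"
        using str_comp_trans[of 1 i "Suc i" y] i by (simp add: str_comp_step)
      then have "str Y i y = \<zero>\<^bsub>branch Y i\<^esub>" using step st(1) by simp
      also have "\<dots> = str Y i \<zero>\<^bsub>branch Y (Suc i)\<^esub>"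
        using lin_maps_zero[OF branch[OF i(3)] branch[OF i(2)] str[OF i(1)]] by simp
      finally show ?case using r i(1) step(5) z[OF i(3)] by (auto dest: inj_onD)
    qed
    then show ?l by simp
  qed
  finally show ?thesis .
qed

end


section \<open>Triangular matrices over an Artin algebra\<close>

locale triangular_artin = triangular A n for A :: "('r, 'a, 'q) module_scheme" (structure) and n +
  fixes R :: "('r, 'p) ring_scheme" and J :: "('r, 'j) module"
  assumes artin: "artin_algebra R A"
    and envelope: "injective_envelope R (quotient_module R (jacobson_radical R)) J"
begin

lemma module_RA: "module R A"
  using artin by (simp add: artin_algebra_def)

lemma cring_R: "cring R"
  using module_RA by (simp add: module_def)

lemma artinian_R: "artinian R"
  using artin by (simp add: artin_algebra_def artin_algebra_axioms_def)

lemma left_module_RA: "left_module R A"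
  using module_RA by (simp add: module_iff_left_module)

lemma injective_J: "injective_module R J"
  using envelope by (simp add: injective_envelope_def)

lemma left_module_J: "left_module R J"
  using injective_J by (simp add: injective_module_def module_iff_left_module)

lemma scalar_mult:
  assumes "r \<in> carrier R" "a \<in> carrier A" "b \<in> carrier A"
  shows "(r \<odot>\<^bsub>A\<^esub> a) \<otimes> b = r \<odot>\<^bsub>A\<^esub> (a \<otimes> b)" "a \<otimes> (r \<odot>\<^bsub>A\<^esub> b) = r \<odot>\<^bsub>A\<^esub> (a \<otimes> b)"
  using artin_algebra.smult_mult_left[OF artin] artin_algebra.smult_mult_right[OF artin] assms by blast+

section \<open>The dual of the regular right module\<close>

definition D :: "('a, 'a \<Rightarrow> 'j) module" where
  "D = dual R A J (regular (op_ring A))"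

lemma D_carrier: "f \<in> carrier D \<longleftrightarrow> f \<in> extensional (carrier A) \<and> (\<forall>x \<in> carrier A. f x \<in> carrier J) \<and>
    (\<forall>x \<in> carrier A. \<forall>y \<in> carrier A. f (x \<oplus> y) = f x \<oplus>\<^bsub>J\<^esub> f y) \<and>
    (\<forall>r \<in> carrier R. \<forall>x \<in> carrier A. f (r \<odot>\<^bsub>A\<^esub> x) = r \<odot>\<^bsub>J\<^esub> f x)"
proof -
  have "x \<otimes> (r \<odot>\<^bsub>A\<^esub> \<one>) = r \<odot>\<^bsub>A\<^esub> x" if "r \<in> carrier R" "x \<in> carrier A" for r x
    using scalar_mult(2)[OF that one_closed] that by simp
  then show ?thesis
    by (auto simp: D_def dual_def Let_def Hom_def lin_maps_def restrict_scalars_def op_ring_def regular_def)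
qed

lemma D_simps:
  "\<zero>\<^bsub>D\<^esub> = (\<lambda>x \<in> carrier A. \<zero>\<^bsub>J\<^esub>)"
  "f \<oplus>\<^bsub>D\<^esub> g = (\<lambda>x \<in> carrier A. f x \<oplus>\<^bsub>J\<^esub> g x)"
  "a \<odot>\<^bsub>D\<^esub> f = (\<lambda>x \<in> carrier A. f (x \<otimes> a))"
  by (simp_all add: D_def dual_def Let_def Hom_def restrict_scalars_def op_ring_def regular_def)

lemma left_module_D: "left_module A D"
proof -
  interpret RA: left_module R A by (rule left_module_RA)
  interpret RJ: left_module R J by (rule left_module_J)
  show ?thesis
  proof (intro left_module.intro abelian_groupI left_module_axioms.intro ring_axioms)
    fix f assume f: "f \<in> carrier D"
    have "(\<lambda>x \<in> carrier A. \<ominus>\<^bsub>J\<^esub> f x) \<in> carrier D"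
      using f by (auto simp: D_carrier RJ.M.minus_add RJ.M.a_comm RJ.smult_r_minus)
    moreover have "(\<lambda>x \<in> carrier A. \<ominus>\<^bsub>J\<^esub> f x) \<oplus>\<^bsub>D\<^esub> f = \<zero>\<^bsub>D\<^esub>"
      using f by (auto simp: D_simps D_carrier RJ.M.l_neg intro!: restrict_ext)
    ultimately show "\<exists>g \<in> carrier D. g \<oplus>\<^bsub>D\<^esub> f = \<zero>\<^bsub>D\<^esub>" by blast
  qed (auto simp: D_simps D_carrier RJ.M.a_ac RJ.smult_r_distr l_distr r_distr m_assoc scalar_mult
      extensional_def fun_eq_iff)
qed

lemma D_zero_closed: "\<zero>\<^bsub>D\<^esub> \<in> carrier D"
proof -
  interpret D: left_module A D by (rule left_module_D)
  show ?thesis by simp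
qed

section \<open>The triangular module built from the dual\<close>

abbreviation "M \<equiv> m_sum n D"
abbreviation "N \<equiv> T_module n M"

lemma branch_m_obj: "branch (m_obj D i) j = (if j \<le> i then D else D\<lparr>carrier := {\<zero>\<^bsub>D\<^esub>}\<rparr>)"
  by (simp add: m_obj_def)

lemma branch_M: "branch M j = dsum {1..n} (\<lambda>i. branch (m_obj D i) j)"
  by (simp add: m_sum_def mor_dsum_def)

lemma branch_M_simps:
  "carrier (branch M j) = (\<Pi>\<^sub>E i \<in> {1..n}. if j \<le> i then carrier D else {\<zero>\<^bsub>D\<^esub>})"
  "\<zero>\<^bsub>branch M j\<^esub> = (\<lambda>i \<in> {1..n}. \<zero>\<^bsub>D\<^esub>)"
  "x \<oplus>\<^bsub>branch M j\<^esub> y = (\<lambda>i \<in> {1..n}. x i \<oplus>\<^bsub>D\<^esub> y i)"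
  "a \<odot>\<^bsub>branch M j\<^esub> x = (\<lambda>i \<in> {1..n}. a \<odot>\<^bsub>D\<^esub> x i)"
  by (auto simp: branch_M dsum_def branch_m_obj intro!: PiE_cong restrict_ext)

text \<open>
  The entries that the structure map of \<open>m\<^sub>i(D)\<close> kills are zero anyway, as they lie in a zero branch.
  So all structure maps of \<open>M\<close> are inclusions.
\<close>

lemma str_M:
  assumes x: "x \<in> carrier (branch M (Suc j))" shows "str M j x = x"
proof
  fix i
  have xi: "x i \<in> (if Suc j \<le> i then carrier D else {\<zero>\<^bsub>D\<^esub>})" if "i \<in> {1..n}"
    using PiE_mem[OF x[unfolded branch_M_simps] that] .
  have ext: "x i = undefined" if "i \<notin> {1..n}"
    using PiE_arb[OF x[unfolded branch_M_simps] that] .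
  have "str M j x = (\<lambda>i \<in> {1..n}. if j < i then x i else \<zero>\<^bsub>D\<^esub>)"
    by (auto simp: m_sum_def mor_dsum_def m_obj_def intro!: restrict_ext)
  then show "str M j x i = x i"
    using xi ext by (cases "i \<in> {1..n}"; cases "j < i") simp_all
qed

lemma branch_M_antimono: "i \<le> j \<Longrightarrow> carrier (branch M j) \<subseteq> carrier (branch M i)"
  unfolding branch_M_simps using D_zero_closed by (intro PiE_mono) auto

lemma triangular_object_M: "triangular_object A n M"
proof (intro triangular_object.intro triangular_object_axioms.intro triangular_axioms)
  fix i
  interpret D: left_module A D by (rule left_module_D)
  show "left_module A (branch M i)"
    unfolding branch_M branch_m_obj
    using D.left_module D.left_module_submodule[OF D.submodule_zero]
    by (intro left_module_dsum ring_axioms) auto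
  show "str M i \<in> lin_maps A (branch M (Suc i)) (branch M i)"
  proof (rule lin_mapsI)
    interpret S: left_module A "branch M (Suc i)"
      unfolding branch_M branch_m_obj
      using D.left_module D.left_module_submodule[OF D.submodule_zero]
      by (intro left_module_dsum ring_axioms) auto
    fix x assume x: "x \<in> carrier (branch M (Suc i))"
    have "x \<in> carrier (branch M i)" using x branch_M_antimono[of i "Suc i"] by auto
    then show "str M i x \<in> carrier (branch M i)" by (simp add: str_M[OF x])
    show "str M i (x \<oplus>\<^bsub>branch M (Suc i)\<^esub> y) = str M i x \<oplus>\<^bsub>branch M i\<^esub> str M i y"
      if y: "y \<in> carrier (branch M (Suc i))" for y
      using str_M[OF S.M.a_closed[OF x y]] by (simp add: str_M[OF x] str_M[OF y] branch_M_simps)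
    show "str M i (a \<odot>\<^bsub>branch M (Suc i)\<^esub> x) = a \<odot>\<^bsub>branch M i\<^esub> str M i x"
      if a: "a \<in> carrier A" for a
      using str_M[OF S.smult_closed[OF a x]] by (simp add: str_M[OF x] branch_M_simps)
  qed
qed

sublocale N: triangular_object A n M
  by (rule triangular_object_M)

lemma str_comp_M:
  assumes "i \<le> j" "x \<in> carrier (branch M j)" shows "str_comp M i j x = x"
  using assms(1)
proof (induct rule: inc_induct)
  case base show ?case by simp
next
  case (step m)
  have "x \<in> carrier (branch M (Suc m))" using assms(2) branch_M_antimono[of "Suc m" j] step(2) by auto
  then show ?case using step str_M by (simp add: N.str_comp_step)
qed

end


context triangular_artin
begin

section \<open>Restriction to the ground ring\<close>

definition scal :: "'r \<Rightarrow> nat \<Rightarrow> nat \<Rightarrow> 'a" where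
  "scal r = diag (r \<odot>\<^bsub>A\<^esub> \<one>)"

lemma scal_closed: "r \<in> carrier R \<Longrightarrow> scal r \<in> carrier T"
  unfolding scal_def by (intro diag_closed left_module.smult_closed[OF left_module_RA] one_closed)

lemma scal_mult:
  assumes r: "r \<in> carrier R" and t: "t \<in> carrier T"
  shows "scal r \<otimes>\<^bsub>T\<^esub> t = (\<lambda>i j. r \<odot>\<^bsub>A\<^esub> t i j)" "t \<otimes>\<^bsub>T\<^esub> scal r = (\<lambda>i j. r \<odot>\<^bsub>A\<^esub> t i j)"
proof -
  interpret RA: left_module R A by (rule left_module_RA)
  have r1: "(r \<odot>\<^bsub>A\<^esub> \<one>) \<otimes> x = r \<odot>\<^bsub>A\<^esub> x" "x \<otimes> (r \<odot>\<^bsub>A\<^esub> \<one>) = r \<odot>\<^bsub>A\<^esub> x" if "x \<in> carrier A" for x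
    using scalar_mult[OF r one_closed that] scalar_mult[OF r that one_closed] that by simp_all
  show "scal r \<otimes>\<^bsub>T\<^esub> t = (\<lambda>i j. r \<odot>\<^bsub>A\<^esub> t i j)" "t \<otimes>\<^bsub>T\<^esub> scal r = (\<lambda>i j. r \<odot>\<^bsub>A\<^esub> t i j)"
    unfolding scal_def diag_mult[OF RA.smult_closed[OF r one_closed] t] r1[OF T_entry[OF t]] by (rule refl)+
qed

lemma scal_commute: "r \<in> carrier R \<Longrightarrow> t \<in> carrier T \<Longrightarrow> scal r \<otimes>\<^bsub>T\<^esub> t = t \<otimes>\<^bsub>T\<^esub> scal r"
  by (simp add: scal_mult)

lemma scal_unit:
  assumes "1 \<le> i" "i \<le> j" "j \<le> n" "r \<in> carrier R" "a \<in> carrier A"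
  shows "unit i j (r \<odot>\<^bsub>A\<^esub> a) = scal r \<otimes>\<^bsub>T\<^esub> unit i j a"
proof -
  interpret RA: left_module R A by (rule left_module_RA)
  show ?thesis using assms by (simp add: scal_mult fun_eq_iff) (simp add: unit_def)
qed

text \<open>
  \<open>T\<close> is an \<open>R\<close>-algebra through the scalar matrices \<open>scal r\<close>; \<open>ground P\<close> is \<open>P\<close> as an \<open>R\<close>-module.
\<close>

definition ground :: "(nat \<Rightarrow> nat \<Rightarrow> 'a, 'y, 's) module_scheme \<Rightarrow> ('r, 'y) module" where
  "ground P = \<lparr>carrier = carrier P, monoid.mult = undefined, monoid.one = undefined,
     ring.zero = \<zero>\<^bsub>P\<^esub>, ring.add = (\<oplus>\<^bsub>P\<^esub>), smult = (\<lambda>r x. scal r \<odot>\<^bsub>P\<^esub> x)\<rparr>"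

lemma ground_simps [simp]:
  "carrier (ground P) = carrier P" "\<zero>\<^bsub>ground P\<^esub> = \<zero>\<^bsub>P\<^esub>"
  "x \<oplus>\<^bsub>ground P\<^esub> y = x \<oplus>\<^bsub>P\<^esub> y" "r \<odot>\<^bsub>ground P\<^esub> x = scal r \<odot>\<^bsub>P\<^esub> x"
  by (simp_all add: ground_def)

lemma left_module_ground:
  assumes "left_module T P" shows "left_module R (ground P)"
proof -
  interpret P: left_module T P by fact
  interpret RA: left_module R A by (rule left_module_RA)
  have add: "scal (r \<oplus>\<^bsub>R\<^esub> s) = scal r \<oplus>\<^bsub>T\<^esub> scal s" if "r \<in> carrier R" "s \<in> carrier R" for r s
    using that by (simp add: scal_def diag_def RA.smult_l_distr fun_eq_iff)
  have mult: "scal (r \<otimes>\<^bsub>R\<^esub> s) = scal r \<otimes>\<^bsub>T\<^esub> scal s" if "r \<in> carrier R" "s \<in> carrier R" for r s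
    unfolding scal_mult(1)[OF that(1) scal_closed[OF that(2)]]
    using that by (simp add: scal_def diag_def RA.smult_assoc1 fun_eq_iff)
  have one: "scal \<one>\<^bsub>R\<^esub> = \<one>\<^bsub>T\<^esub>"
    unfolding scal_def RA.smult_one[OF one_closed] T_simps by (rule refl)
  show ?thesis
  proof (intro left_module.intro abelian_groupI left_module_axioms.intro RA.R.ring_axioms)
    show "\<exists>y \<in> carrier (ground P). y \<oplus>\<^bsub>ground P\<^esub> x = \<zero>\<^bsub>ground P\<^esub>" if "x \<in> carrier (ground P)" for x
      using that P.M.l_neg[of x] P.M.a_inv_closed[of x] by auto
  qed (simp_all del: T_simps add: P.M.a_ac scal_closed add mult one P.smult_l_distr P.smult_r_distr P.smult_assoc1)
qed

lemma lin_maps_ground: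
  assumes "f \<in> lin_maps T P Q" shows "f \<in> lin_maps R (ground P) (ground Q)"
  by (intro lin_mapsI) (simp_all add: lin_mapsD[OF assms] scal_closed)

lemma unit_act_lin:
  assumes "left_module T P" "1 \<le> i" "i \<le> j" "j \<le> n" "a \<in> carrier A"
  shows "(\<lambda>p. unit i j a \<odot>\<^bsub>P\<^esub> p) \<in> lin_maps R (ground P) (ground P)"
proof -
  interpret P: left_module T P by fact
  have u: "unit i j a \<in> carrier T" using assms by simp
  show ?thesis
  proof (rule lin_mapsI)
    fix r p assume "r \<in> carrier R" "p \<in> carrier (ground P)"
    then show "unit i j a \<odot>\<^bsub>P\<^esub> (r \<odot>\<^bsub>ground P\<^esub> p) = r \<odot>\<^bsub>ground P\<^esub> (unit i j a \<odot>\<^bsub>P\<^esub> p)"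
      using u scal_commute[OF _ u] by (simp add: scal_closed flip: P.smult_assoc1)
  qed (use u in \<open>auto simp: P.smult_r_distr\<close>)
qed

lemma unit_act:
  assumes "left_module T P" "1 \<le> i" "i \<le> j" "j \<le> l" "l \<le> n" "a \<in> carrier A" "b \<in> carrier A" "p \<in> carrier P"
  shows "unit i j a \<odot>\<^bsub>P\<^esub> (unit j l b \<odot>\<^bsub>P\<^esub> p) = unit i l (a \<otimes> b) \<odot>\<^bsub>P\<^esub> p"
proof -
  interpret P: left_module T P by fact
  show ?thesis using assms unit_mult[of i j j l a b] by (simp add: unit_closed flip: P.smult_assoc1)
qed


section \<open>Linear maps into \<open>N\<close> as families of functionals\<close>

lemma N_carrierD:
  assumes y: "y \<in> carrier N" and j: "j \<in> {1..n}" and i: "i \<in> {1..n}"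
  shows "y j \<in> carrier (branch M j)" "y j i \<in> carrier D" "i < j \<Longrightarrow> y j i = \<zero>\<^bsub>D\<^esub>"
proof -
  show yj: "y j \<in> carrier (branch M j)" using y j unfolding N.X_simps by (rule PiE_mem)
  have "y j i \<in> (if j \<le> i then carrier D else {\<zero>\<^bsub>D\<^esub>})" using yj i unfolding branch_M_simps by (rule PiE_mem)
  then show "y j i \<in> carrier D" "i < j \<Longrightarrow> y j i = \<zero>\<^bsub>D\<^esub>" using D_zero_closed by (auto split: if_splits)
qed

lemma N_ext:
  assumes y: "y \<in> carrier N" and z: "z \<in> carrier N"
    and eq: "\<And>j i a. j \<in> {1..n} \<Longrightarrow> i \<in> {1..n} \<Longrightarrow> a \<in> carrier A \<Longrightarrow> y j i a = z j i a"
  shows "y = z"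
proof (rule PiE_ext)
  show "y \<in> (\<Pi>\<^sub>E i \<in> {1..n}. carrier (branch M i))" "z \<in> (\<Pi>\<^sub>E i \<in> {1..n}. carrier (branch M i))"
    using y z by (simp_all add: N.X_simps)
  fix j assume j: "j \<in> {1..n}"
  show "y j = z j"
  proof (rule PiE_ext)
    show "y j \<in> (\<Pi>\<^sub>E i \<in> {1..n}. if j \<le> i then carrier D else {\<zero>\<^bsub>D\<^esub>})"
      using N_carrierD(1)[OF y j j] unfolding branch_M_simps .
    show "z j \<in> (\<Pi>\<^sub>E i \<in> {1..n}. if j \<le> i then carrier D else {\<zero>\<^bsub>D\<^esub>})"
      using N_carrierD(1)[OF z j j] unfolding branch_M_simps .
    fix i assume i: "i \<in> {1..n}"
    show "y j i = z j i"
      using N_carrierD(2)[OF y j i] N_carrierD(2)[OF z j i] eq[OF j i]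
      by (intro extensionalityI[of _ "carrier A"]) (auto simp: D_carrier)
  qed
qed

lemma N_unit_smult:
  assumes ij: "1 \<le> i" "i \<le> j" "j \<le> n" and a: "a \<in> carrier A" and y: "y \<in> carrier N"
    and k: "k \<in> {1..n}" "l \<in> {1..n}" and b: "b \<in> carrier A"
  shows "(unit i j a \<odot>\<^bsub>N\<^esub> y) k l b = (if k = i then y j l (b \<otimes> a) else \<zero>\<^bsub>J\<^esub>)"
proof -
  have "y j \<in> carrier (branch M j)" using N_carrierD(1)[OF y, of j j] ij by auto
  then have "str_comp M i j (y j) = y j" using str_comp_M ij by blast
  then show ?thesis
    unfolding N.unit_smult[OF ij a y] using k b by (simp add: branch_M_simps D_simps)
qed

lemma N_scal:
  assumes r: "r \<in> carrier R" and y: "y \<in> carrier N" and k: "k \<in> {1..n}" "l \<in> {1..n}" and b: "b \<in> carrier A"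
  shows "(scal r \<odot>\<^bsub>N\<^esub> y) k l b = r \<odot>\<^bsub>J\<^esub> y k l b"
proof -
  interpret RA: left_module R A by (rule left_module_RA)
  have r1: "r \<odot>\<^bsub>A\<^esub> \<one> \<in> carrier A" using r by simp
  have "b \<otimes> (r \<odot>\<^bsub>A\<^esub> \<one>) = r \<odot>\<^bsub>A\<^esub> b" using scalar_mult(2)[OF r b one_closed] b by simp
  moreover have "y k l (r \<odot>\<^bsub>A\<^esub> b) = r \<odot>\<^bsub>J\<^esub> y k l b" using N_carrierD(2)[OF y k] r b by (simp add: D_carrier)
  ultimately show ?thesis
    unfolding scal_def N.diag_smult[OF r1 y] using k b by (simp add: branch_M_simps D_simps)
qed

lemma N_add: "k \<in> {1..n} \<Longrightarrow> l \<in> {1..n} \<Longrightarrow> b \<in> carrier A \<Longrightarrow> (y \<oplus>\<^bsub>N\<^esub> z) k l b = y k l b \<oplus>\<^bsub>J\<^esub> z k l b"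
  by (simp add: N.X_simps branch_M_simps D_simps)

lemma N_zero: "k \<in> {1..n} \<Longrightarrow> l \<in> {1..n} \<Longrightarrow> b \<in> carrier A \<Longrightarrow> \<zero>\<^bsub>N\<^esub> k l b = \<zero>\<^bsub>J\<^esub>"
  by (simp add: N.X_simps branch_M_simps D_simps)

text \<open>
  An element \<open>y\<close> of \<open>N\<close> has entries \<open>y j i\<close>, the component in the \<open>j\<close>-th branch of \<open>m\<^sub>i(D)\<close>, which are
  functionals on \<open>A\<close>.  The functional attached to a map \<open>f\<close> and an index \<open>i\<close> evaluates the component in
  the first branch of \<open>m\<^sub>i(D)\<close> at the unit of \<open>A\<close>.  These functionals determine \<open>f\<close>, by \<open>functional_unit\<close>.
\<close>

lemma functional_lin:
  assumes "n \<ge> 1" "f \<in> lin_maps T P N" "i \<in> {1..n}"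
  shows "(\<lambda>p. f p 1 i \<one>) \<in> lin_maps R (ground P) J"
proof (rule lin_mapsI)
  note f = lin_mapsD[OF assms(2)]
  have one: "1 \<in> {1..n}" using assms(1) by simp
  show "f p 1 i \<one> \<in> carrier J" if "p \<in> carrier (ground P)" for p
    using N_carrierD(2)[OF f(1) one assms(3), of p] that by (simp add: D_carrier)
  show "f (p \<oplus>\<^bsub>ground P\<^esub> q) 1 i \<one> = f p 1 i \<one> \<oplus>\<^bsub>J\<^esub> f q 1 i \<one>"
    if "p \<in> carrier (ground P)" "q \<in> carrier (ground P)" for p q
    using that f(2) N_add[OF one assms(3) one_closed] by simp
  show "f (r \<odot>\<^bsub>ground P\<^esub> p) 1 i \<one> = r \<odot>\<^bsub>J\<^esub> f p 1 i \<one>"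
    if "r \<in> carrier R" "p \<in> carrier (ground P)" for r p
    using that f(1,3) N_scal[OF that(1) _ one assms(3) one_closed] scal_closed by simp
qed

lemma functional_unit:
  assumes f: "f \<in> lin_maps T P N" and p: "p \<in> carrier P" and j: "j \<in> {1..n}" and i: "i \<in> {1..n}"
    and a: "a \<in> carrier A"
  shows "f (unit 1 j a \<odot>\<^bsub>P\<^esub> p) 1 i \<one> = f p j i a"
proof -
  have "f (unit 1 j a \<odot>\<^bsub>P\<^esub> p) = unit 1 j a \<odot>\<^bsub>N\<^esub> f p"
    using lin_mapsD(3)[OF f _ p] j a by simp
  then show ?thesis
    using N_unit_smult[OF _ _ _ a lin_mapsD(1)[OF f p], of 1 j 1 i \<one>] i j a by simp
qed

text \<open>
  The image of the \<open>j\<close>-th branch is killed since \<open>m\<^sub>i(D)\<close> has zero \<open>j\<close>-th branch for \<open>j > i\<close>.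
\<close>

lemma functional_vanish:
  assumes f: "f \<in> lin_maps T P N" and p: "p \<in> carrier P" and i: "i \<in> {1..n}" and j: "i < j" "j \<le> n"
  shows "f (unit 1 j \<one> \<odot>\<^bsub>P\<^esub> p) 1 i \<one> = \<zero>\<^bsub>J\<^esub>"
  using functional_unit[OF f p, of j i \<one>] N_carrierD(3)[OF lin_mapsD(1)[OF f p], of j i] i j
  by (simp add: D_simps)

text \<open>
  The inverse construction, prescribed by \<open>functional_unit\<close>.
\<close>

definition from_functionals ::
    "(nat \<Rightarrow> nat \<Rightarrow> 'a, 'y, 's) module_scheme \<Rightarrow> (nat \<Rightarrow> 'y \<Rightarrow> 'j) \<Rightarrow> 'y \<Rightarrow> nat \<Rightarrow> nat \<Rightarrow> 'a \<Rightarrow> 'j" where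
  "from_functionals P lam p = (\<lambda>j \<in> {1..n}. \<lambda>i \<in> {1..n}. \<lambda>a \<in> carrier A. lam i (unit 1 j a \<odot>\<^bsub>P\<^esub> p))"

text \<open>
  The vanishing condition makes the components in the zero branches of \<open>m\<^sub>i(D)\<close> zero.  Linearity
  over \<open>T\<close> is checked on matrix units, where both sides are \<open>lam i\<close> at \<open>e\<^sub>1\<^sub>m (a b) p\<close>
  if the inner indices agree, and zero otherwise.
\<close>

lemma from_functionals_lin:
  assumes P: "left_module T P"
    and lin: "\<And>i. i \<in> {1..n} \<Longrightarrow> lam i \<in> lin_maps R (ground P) J"
    and vanish: "\<And>i j p. \<lbrakk>i \<in> {1..n}; i < j; j \<le> n; p \<in> carrier P\<rbrakk> \<Longrightarrow> lam i (unit 1 j \<one> \<odot>\<^bsub>P\<^esub> p) = \<zero>\<^bsub>J\<^esub>"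
  shows "from_functionals P lam \<in> lin_maps T P N"
proof -
  interpret P: left_module T P by fact
  interpret G: left_module R "ground P" by (rule left_module_ground[OF P])
  interpret RA: left_module R A by (rule left_module_RA)
  interpret RJ: left_module R J by (rule left_module_J)
  interpret NN: left_module T N by (rule N.left_module_X)
  let ?f = "from_functionals P lam"
  note l = lin_mapsD[OF lin, simplified ground_simps]
  have u: "unit 1 j a \<in> carrier T" if "j \<in> {1..n}" "a \<in> carrier A" for j a using that by simp
  have up: "unit 1 j a \<odot>\<^bsub>P\<^esub> p \<in> carrier P" if "j \<in> {1..n}" "a \<in> carrier A" "p \<in> carrier P" for j a p
    using u[OF that(1,2)] that(3) by simp
  have ap: "?f p j i a = lam i (unit 1 j a \<odot>\<^bsub>P\<^esub> p)" if "j \<in> {1..n}" "i \<in> {1..n}" "a \<in> carrier A" for p j i a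
    using that by (simp add: from_functionals_def)
  have vanish': "lam i (unit 1 j a \<odot>\<^bsub>P\<^esub> p) = \<zero>\<^bsub>J\<^esub>"
    if "i \<in> {1..n}" "i < j" "j \<le> n" "p \<in> carrier P" "a \<in> carrier A" for i j p a
    using vanish[OF that(1-3), of "unit j j a \<odot>\<^bsub>P\<^esub> p"] unit_act[OF P, of 1 j j \<one> a p] that by simp
  have D: "?f p j i \<in> carrier D" if j: "j \<in> {1..n}" and i: "i \<in> {1..n}" and p: "p \<in> carrier P" for p j i
    unfolding D_carrier
  proof (intro conjI ballI)
    show "?f p j i \<in> extensional (carrier A)" using i j by (simp add: from_functionals_def)
    fix a assume a: "a \<in> carrier A"
    show "?f p j i a \<in> carrier J" using ap[OF j i a] l(1)[OF i up[OF j a p]] by simp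
    show "?f p j i (a \<oplus> b) = ?f p j i a \<oplus>\<^bsub>J\<^esub> ?f p j i b" if b: "b \<in> carrier A" for b
      using ap[OF j i] a b l(2)[OF i up[OF j a p] up[OF j b p]] u[OF j] p
      by (simp del: T_simps add: unit_add P.smult_l_distr)
    show "?f p j i (r \<odot>\<^bsub>A\<^esub> a) = r \<odot>\<^bsub>J\<^esub> ?f p j i a" if r: "r \<in> carrier R" for r
      using ap[OF j i] a r l(3)[OF i r up[OF j a p]] u[OF j a] p j scal_closed[OF r]
      by (simp add: scal_unit P.smult_assoc1)
  qed
  have closed: "?f p \<in> carrier N" if p: "p \<in> carrier P" for p
    unfolding N.X_simps branch_M_simps
  proof (intro PiE_I)
    fix j i assume j: "j \<in> {1..n}" and i: "i \<in> {1..n}"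
    show "?f p j i \<in> (if j \<le> i then carrier D else {\<zero>\<^bsub>D\<^esub>})"
    proof (cases "j \<le> i")
      case True then show ?thesis using D[OF j i p] by simp
    next
      case False
      then have "?f p j i = \<zero>\<^bsub>D\<^esub>"
        using i j vanish'[of i j p] p unfolding from_functionals_def D_simps by (auto intro!: restrict_ext)
      then show ?thesis using False by simp
    qed
  qed (auto simp: from_functionals_def)
  have add: "?f (p \<oplus>\<^bsub>P\<^esub> q) = ?f p \<oplus>\<^bsub>N\<^esub> ?f q" if p: "p \<in> carrier P" and q: "q \<in> carrier P" for p q
  proof (rule N_ext)
    show "?f (p \<oplus>\<^bsub>P\<^esub> q) \<in> carrier N" "?f p \<oplus>\<^bsub>N\<^esub> ?f q \<in> carrier N" using closed p q by auto
    fix j i a assume j: "j \<in> {1..n}" and i: "i \<in> {1..n}" and a: "a \<in> carrier A"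
    show "?f (p \<oplus>\<^bsub>P\<^esub> q) j i a = (?f p \<oplus>\<^bsub>N\<^esub> ?f q) j i a"
      unfolding N_add[OF j i a] ap[OF j i a] using u[OF j a] p q l(2)[OF i up[OF j a p] up[OF j a q]]
      by (simp add: P.smult_r_distr)
  qed
  have zero: "?f \<zero>\<^bsub>P\<^esub> = \<zero>\<^bsub>N\<^esub>"
    using add[of "\<zero>\<^bsub>P\<^esub>" "\<zero>\<^bsub>P\<^esub>"] closed[of "\<zero>\<^bsub>P\<^esub>"] by (simp add: NN.M.add.r_cancel_one')
  have smult: "?f (t \<odot>\<^bsub>P\<^esub> p) = t \<odot>\<^bsub>N\<^esub> ?f p" if t: "t \<in> carrier T" and p: "p \<in> carrier P" for t p
    using t
  proof (induct rule: T_induct)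
    case zero
    then show ?case using p closed[OF p] \<open>?f \<zero>\<^bsub>P\<^esub> = \<zero>\<^bsub>N\<^esub>\<close> by (simp del: T_simps)
  next
    case (add s t)
    then show ?case using p closed[OF p] \<open>\<And>p q. p \<in> carrier P \<Longrightarrow> q \<in> carrier P \<Longrightarrow> ?f (p \<oplus>\<^bsub>P\<^esub> q) = ?f p \<oplus>\<^bsub>N\<^esub> ?f q\<close>
      by (simp del: T_simps add: P.smult_l_distr NN.smult_l_distr)
  next
    case (unit k m b)
    have ub: "unit k m b \<in> carrier T" using unit by simp
    show ?case
    proof (rule N_ext)
      show "?f (unit k m b \<odot>\<^bsub>P\<^esub> p) \<in> carrier N" "unit k m b \<odot>\<^bsub>N\<^esub> ?f p \<in> carrier N"
        using closed ub p by auto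
      fix j i a assume j: "j \<in> {1..n}" and i: "i \<in> {1..n}" and a: "a \<in> carrier A"
      have "unit 1 j a \<odot>\<^bsub>P\<^esub> (unit k m b \<odot>\<^bsub>P\<^esub> p) = (if j = k then unit 1 m (a \<otimes> b) \<odot>\<^bsub>P\<^esub> p else \<zero>\<^bsub>P\<^esub>)"
        using unit_mult[of 1 j k m a b] unit j a ub u[OF j a] p by (simp del: T_simps flip: P.smult_assoc1)
      moreover have "(unit k m b \<odot>\<^bsub>N\<^esub> ?f p) j i a = (if j = k then ?f p m i (a \<otimes> b) else \<zero>\<^bsub>J\<^esub>)"
        using unit by (intro N_unit_smult closed p j i a) auto
      ultimately show "?f (unit k m b \<odot>\<^bsub>P\<^esub> p) j i a = (unit k m b \<odot>\<^bsub>N\<^esub> ?f p) j i a"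
        unfolding ap[OF j i a]
        using ap[of m i "a \<otimes> b" p] unit i a lin_maps_zero[OF G.left_module RJ.left_module lin[OF i]] by auto
    qed
  qed
  show ?thesis using closed add smult by (rule lin_mapsI)
qed


section \<open>Exactness of linear maps into \<open>N\<close>\<close>

text \<open>
  A cocycle \<open>f\<close> has functionals on \<open>P1\<close>, which are to be extended along \<open>d1\<close> to functionals on \<open>P0\<close> that
  vanish on the image \<open>K i\<close> of the branch \<open>i + 1\<close>.  By \<open>injective_factor\<close> this is possible if the
  functional kills every \<open>p\<close> with \<open>d1 p\<close> in \<open>K i\<close>.  For such \<open>p\<close>, say \<open>d1 p = e\<^sub>1\<^sub>,\<^sub>i\<^sub>+\<^sub>1 q\<close>, injectivity of
  the structure maps of \<open>X\<close> shows that the part of \<open>q\<close> in branch \<open>i + 1\<close> is a boundary \<open>d1 q'\<close>; so \<open>p\<close> and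
  \<open>e\<^sub>1\<^sub>,\<^sub>i\<^sub>+\<^sub>1 q'\<close> differ by an element of the image of \<open>d2\<close>, and the functional kills both.
\<close>

theorem Hom_N_exact:
  assumes n: "n \<ge> 1"
    and P2: "left_module T P2" and P1: "left_module T P1" and P0: "left_module T P0" and X: "left_module T X"
    and d2: "d2 \<in> lin_maps T P2 P1" and d1: "d1 \<in> lin_maps T P1 P0" and d0: "d0 \<in> lin_maps T P0 X"
    and ex1: "\<And>p. p \<in> carrier P1 \<Longrightarrow> d1 p = \<zero>\<^bsub>P0\<^esub> \<Longrightarrow> p \<in> d2 ` carrier P2"
    and ex0: "\<And>p. p \<in> carrier P0 \<Longrightarrow> d0 p = \<zero>\<^bsub>X\<^esub> \<Longrightarrow> p \<in> d1 ` carrier P1"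
    and cx: "\<And>p. p \<in> carrier P1 \<Longrightarrow> d0 (d1 p) = \<zero>\<^bsub>X\<^esub>"
    and mono: "mono_type X"
    and f: "f \<in> lin_maps T P1 N" and cocycle: "\<And>p. p \<in> carrier P2 \<Longrightarrow> f (d2 p) = \<zero>\<^bsub>N\<^esub>"
  shows "\<exists>g \<in> lin_maps T P0 N. \<forall>p \<in> carrier P1. f p = g (d1 p)"
proof -
  interpret P1: left_module T P1 by fact
  interpret P0: left_module T P0 by fact
  interpret X: left_module T X by fact
  interpret G0: left_module R "ground P0" by (rule left_module_ground[OF P0])
  interpret G1: left_module R "ground P1" by (rule left_module_ground[OF P1])
  interpret RJ: left_module R J by (rule left_module_J)
  note D2 = lin_mapsD[OF d2] and D1 = lin_mapsD[OF d1] and D0 = lin_mapsD[OF d0] and ff = lin_mapsD[OF f]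
  have one: "1 \<in> {1..n}" using n by simp
  \<comment> \<open>the image of branch \<open>i + 1\<close>, which for \<open>i = n\<close> does not exist\<close>
  define K where "K i = (if i < n then (\<lambda>p. unit 1 (Suc i) \<one> \<odot>\<^bsub>P0\<^esub> p) ` carrier P0 else {\<zero>\<^bsub>P0\<^esub>})" for i
  have K: "submodule (K i) R (ground P0)" if "i \<in> {1..n}" for i
  proof (cases "i < n")
    case True
    have "submodule ((\<lambda>p. unit 1 (Suc i) \<one> \<odot>\<^bsub>P0\<^esub> p) ` carrier (ground P0)) R (ground P0)"
      using True by (intro submodule_image[OF G0.left_module G0.left_module] unit_act_lin P0 G0.submodule_carrier) auto
    then show ?thesis using True by (simp add: K_def)
  next
    case False then show ?thesis using G0.submodule_zero by (simp add: K_def)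
  qed
  have compat: "f p 1 i \<one> = \<zero>\<^bsub>J\<^esub>" if i: "i \<in> {1..n}" and p: "p \<in> carrier P1" and dp: "d1 p \<in> K i" for i p
  proof (cases "i < n")
    case True
    let ?u = "unit 1 (Suc i) \<one>" and ?e = "unit (Suc i) (Suc i) \<one>"
    have u: "?u \<in> carrier T" "?e \<in> carrier T" using True by auto
    obtain q where q: "q \<in> carrier P0" "d1 p = ?u \<odot>\<^bsub>P0\<^esub> q" using dp True by (auto simp: K_def)
    have "?u \<odot>\<^bsub>X\<^esub> d0 q = \<zero>\<^bsub>X\<^esub>" using cx[OF p] D0(3)[OF u(1) q(1)] q(2) by simp
    then have "?e \<odot>\<^bsub>X\<^esub> d0 q = \<zero>\<^bsub>X\<^esub>" using mono True D0(1)[OF q(1)] by (auto simp: mono_type_def)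
    then have "d0 (?e \<odot>\<^bsub>P0\<^esub> q) = \<zero>\<^bsub>X\<^esub>" using D0(3)[OF u(2) q(1)] by simp
    then obtain q' where q': "q' \<in> carrier P1" "?e \<odot>\<^bsub>P0\<^esub> q = d1 q'" using ex0[of "?e \<odot>\<^bsub>P0\<^esub> q"] u q by auto
    have "d1 p = ?u \<odot>\<^bsub>P0\<^esub> (?e \<odot>\<^bsub>P0\<^esub> q)"
      using q unit_act[OF P0, of 1 "Suc i" "Suc i" \<one> \<one> q] True by simp
    also have "\<dots> = d1 (?u \<odot>\<^bsub>P1\<^esub> q')" using q' D1(3)[OF u(1) q'(1)] by simp
    finally have dd: "d1 p = d1 (?u \<odot>\<^bsub>P1\<^esub> q')" .
    have uq: "?u \<odot>\<^bsub>P1\<^esub> q' \<in> carrier P1" using u q' by simp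
    have "d1 (p \<oplus>\<^bsub>P1\<^esub> \<ominus>\<^bsub>P1\<^esub> (?u \<odot>\<^bsub>P1\<^esub> q')) = \<zero>\<^bsub>P0\<^esub>"
      using D1(2)[OF p, of "\<ominus>\<^bsub>P1\<^esub> (?u \<odot>\<^bsub>P1\<^esub> q')"] uq lin_maps_minus[OF P1 P0 d1 uq] dd D1(1)[OF uq]
      by (simp add: P0.M.r_neg)
    then obtain q'' where q'': "q'' \<in> carrier P2" "p \<oplus>\<^bsub>P1\<^esub> \<ominus>\<^bsub>P1\<^esub> (?u \<odot>\<^bsub>P1\<^esub> q') = d2 q''"
      using ex1[of "p \<oplus>\<^bsub>P1\<^esub> \<ominus>\<^bsub>P1\<^esub> (?u \<odot>\<^bsub>P1\<^esub> q')"] p uq by auto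
    have "p = d2 q'' \<oplus>\<^bsub>P1\<^esub> ?u \<odot>\<^bsub>P1\<^esub> q'"
      using p uq by (simp add: P1.M.a_assoc P1.M.l_neg flip: q''(2))
    then have "f p = f (d2 q'') \<oplus>\<^bsub>N\<^esub> f (?u \<odot>\<^bsub>P1\<^esub> q')" using ff(2)[OF D2(1)[OF q''(1)] uq] by simp
    then have "f p 1 i \<one> = \<zero>\<^bsub>N\<^esub> 1 i \<one> \<oplus>\<^bsub>J\<^esub> f (?u \<odot>\<^bsub>P1\<^esub> q') 1 i \<one>"
      using N_add[OF one i one_closed] cocycle[OF q''(1)] by simp
    then show ?thesis
      using N_zero[OF one i one_closed] functional_vanish[OF f q'(1) i, of "Suc i"] True by simp
  next
    case False
    then have "d1 p = \<zero>\<^bsub>P0\<^esub>" using dp by (simp add: K_def)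
    then obtain q where "q \<in> carrier P2" "p = d2 q" using ex1[OF p] by blast
    then show ?thesis using cocycle N_zero[OF one i one_closed] by simp
  qed
  have "\<exists>g \<in> lin_maps R (ground P0) J. (\<forall>p \<in> carrier P1. g (d1 p) = f p 1 i \<one>) \<and> (\<forall>x \<in> K i. g x = \<zero>\<^bsub>J\<^esub>)"
    if i: "i \<in> {1..n}" for i
    using cring.injective_factor[OF cring_R injective_J G1.left_module G0.left_module
      lin_maps_ground[OF d1] functional_lin[OF n f i] K[OF i]] compat[OF i] by simp
  then obtain g where g: "\<And>i. i \<in> {1..n} \<Longrightarrow> g i \<in> lin_maps R (ground P0) J"
    "\<And>i p. i \<in> {1..n} \<Longrightarrow> p \<in> carrier P1 \<Longrightarrow> g i (d1 p) = f p 1 i \<one>"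
    "\<And>i x. i \<in> {1..n} \<Longrightarrow> x \<in> K i \<Longrightarrow> g i x = \<zero>\<^bsub>J\<^esub>" by metis
  have "from_functionals P0 g \<in> lin_maps T P0 N"
  proof (rule from_functionals_lin[OF P0 g(1)])
    fix i j p assume i: "i \<in> {1..n}" and j: "i < j" "j \<le> n" and p: "p \<in> carrier P0"
    have "unit 1 j \<one> \<odot>\<^bsub>P0\<^esub> p = unit 1 (Suc i) \<one> \<odot>\<^bsub>P0\<^esub> (unit (Suc i) j \<one> \<odot>\<^bsub>P0\<^esub> p)"
      using unit_act[OF P0, of 1 "Suc i" j \<one> \<one> p] j p by simp
    then have "unit 1 j \<one> \<odot>\<^bsub>P0\<^esub> p \<in> K i" using j p by (auto simp: K_def)
    then show "g i (unit 1 j \<one> \<odot>\<^bsub>P0\<^esub> p) = \<zero>\<^bsub>J\<^esub>" using g(3) i by blast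
  qed
  moreover have "f p = from_functionals P0 g (d1 p)" if p: "p \<in> carrier P1" for p
  proof (rule N_ext)
    show "f p \<in> carrier N" "from_functionals P0 g (d1 p) \<in> carrier N"
      using ff(1)[OF p] lin_mapsD(1)[OF calculation D1(1)[OF p]] by auto
    fix j i a assume j: "j \<in> {1..n}" and i: "i \<in> {1..n}" and a: "a \<in> carrier A"
    have u: "unit 1 j a \<in> carrier T" using j a by simp
    have "from_functionals P0 g (d1 p) j i a = g i (unit 1 j a \<odot>\<^bsub>P0\<^esub> d1 p)"
      using i j a by (simp add: from_functionals_def)
    also have "\<dots> = g i (d1 (unit 1 j a \<odot>\<^bsub>P1\<^esub> p))" using D1(3)[OF u p] by simp
    also have "\<dots> = f p j i a" using g(2)[OF i] functional_unit[OF f p j i a] u p by simp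
    finally show "f p j i a = from_functionals P0 g (d1 p) j i a" by simp
  qed
  ultimately show ?thesis by blast
qed

text \<open>
  Suppose that \<open>x\<close> in branch \<open>j = i + 1\<close> of \<open>X\<close> is nonzero but dies in the first branch.  Choose a
  functional \<open>h\<close> on \<open>X\<close> with \<open>h x \<noteq> 0\<close>.  Its pullback to branch \<open>j\<close> of \<open>P0\<close> extends along the injective
  structure map to a functional \<open>g\<close> on the first branch, and \<open>g\<close> composed with \<open>d1\<close> vanishes on the
  image of branch \<open>j\<close> of \<open>P1\<close>, so that it defines a cocycle.  It is not a coboundary: a preimage of \<open>x\<close> in
  branch \<open>j\<close> of \<open>P0\<close> maps to a boundary in the first branch, where the cocycle takes the value \<open>h x\<close>,
  whereas functionals coming from \<open>P0\<close> vanish on the image of branch \<open>j\<close>.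
\<close>

theorem mono_type_if_cocycles_are_coboundaries:
  assumes P2: "left_module T P2" and P1: "left_module T P1" and P0: "left_module T P0" and X: "left_module T X"
    and d2: "d2 \<in> lin_maps T P2 P1" and d1: "d1 \<in> lin_maps T P1 P0" and d0: "d0 \<in> lin_maps T P0 X"
    and surj: "d0 ` carrier P0 = carrier X"
    and cx1: "\<And>p. p \<in> carrier P2 \<Longrightarrow> d1 (d2 p) = \<zero>\<^bsub>P0\<^esub>"
    and ex0: "\<And>p. p \<in> carrier P0 \<Longrightarrow> d0 p = \<zero>\<^bsub>X\<^esub> \<Longrightarrow> p \<in> d1 ` carrier P1"
    and cx0: "\<And>p. p \<in> carrier P1 \<Longrightarrow> d0 (d1 p) = \<zero>\<^bsub>X\<^esub>"
    and mono: "mono_type P0"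
    and cob: "\<And>f. f \<in> lin_maps T P1 N \<Longrightarrow> (\<And>p. p \<in> carrier P2 \<Longrightarrow> f (d2 p) = \<zero>\<^bsub>N\<^esub>) \<Longrightarrow>
      \<exists>g \<in> lin_maps T P0 N. \<forall>p \<in> carrier P1. f p = g (d1 p)"
  shows "mono_type X"
  unfolding mono_type_def
proof (intro ballI impI)
  fix j x assume j: "j \<in> {1..n}" and x: "x \<in> carrier X" and ux: "unit 1 j \<one> \<odot>\<^bsub>X\<^esub> x = \<zero>\<^bsub>X\<^esub>"
  interpret P2: left_module T P2 by fact
  interpret P1: left_module T P1 by fact
  interpret P0: left_module T P0 by fact
  interpret X: left_module T X by fact
  interpret G0: left_module R "ground P0" by (rule left_module_ground[OF P0])
  interpret G1: left_module R "ground P1" by (rule left_module_ground[OF P1])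
  interpret GX: left_module R "ground X" by (rule left_module_ground[OF X])
  interpret RJ: left_module R J by (rule left_module_J)
  note D2 = lin_mapsD[OF d2] and D1 = lin_mapsD[OF d1] and D0 = lin_mapsD[OF d0]
  show "unit j j \<one> \<odot>\<^bsub>X\<^esub> x = \<zero>\<^bsub>X\<^esub>"
  proof (rule ccontr)
    assume nz: "unit j j \<one> \<odot>\<^bsub>X\<^esub> x \<noteq> \<zero>\<^bsub>X\<^esub>"
    \<comment> \<open>the summand \<open>m\<^sub>i(D)\<close> to be used is the last one whose branch \<open>j\<close> is zero\<close>
    define i where "i = j - 1"
    have "j \<noteq> 1" using ux nz by auto
    then have i: "i \<in> {1..n}" "i < j" "Suc i = j" and jn: "1 \<le> j" "j \<le> n" and one: "1 \<in> {1..n}"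
      using j by (auto simp: i_def)
    have u: "unit 1 j \<one> \<in> carrier T" "unit j j \<one> \<in> carrier T" using jn by auto
    obtain h where h: "h \<in> lin_maps R (ground X) J" "h (unit j j \<one> \<odot>\<^bsub>X\<^esub> x) \<noteq> \<zero>\<^bsub>J\<^esub>"
      using cring.injective_envelope_cogenerator[OF cring_R artinian_R envelope GX.left_module,
        of "unit j j \<one> \<odot>\<^bsub>X\<^esub> x"] nz x u by auto
    note hh = lin_mapsD[OF h(1), simplified ground_simps]
    define f0 where "f0 p = h (d0 (unit j j \<one> \<odot>\<^bsub>P0\<^esub> p))" for p
    have "f0 \<in> lin_maps R (ground P0) J"
      using lin_mapsD[OF unit_act_lin[OF P0 jn(1) order.refl jn(2) one_closed], simplified ground_simps]
        lin_mapsD[OF lin_maps_ground[OF d0], simplified ground_simps] hh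
      unfolding f0_def by (intro lin_mapsI) auto
    moreover have "f0 p = \<zero>\<^bsub>J\<^esub>" if p: "p \<in> carrier P0" and z: "unit 1 j \<one> \<odot>\<^bsub>P0\<^esub> p = \<zero>\<^bsub>P0\<^esub>" for p
    proof -
      have "unit j j \<one> \<odot>\<^bsub>P0\<^esub> p = \<zero>\<^bsub>P0\<^esub>" using mono j p z by (auto simp: mono_type_def)
      then show ?thesis
        using lin_maps_zero[OF P0 X d0] lin_maps_zero[OF GX.left_module RJ.left_module h(1)] by (simp add: f0_def)
    qed
    ultimately have "\<exists>g \<in> lin_maps R (ground P0) J.
        (\<forall>p \<in> carrier P0. g (unit 1 j \<one> \<odot>\<^bsub>P0\<^esub> p) = f0 p) \<and> (\<forall>x \<in> {\<zero>\<^bsub>P0\<^esub>}. g x = \<zero>\<^bsub>J\<^esub>)"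
      using cring.injective_factor[OF cring_R injective_J G0.left_module G0.left_module
        unit_act_lin[OF P0 order.refl jn one_closed] _ G0.submodule_zero, of f0] by simp
    then obtain g where g: "g \<in> lin_maps R (ground P0) J"
      "\<And>p. p \<in> carrier P0 \<Longrightarrow> g (unit 1 j \<one> \<odot>\<^bsub>P0\<^esub> p) = f0 p" by blast
    note gg = lin_mapsD[OF g(1), simplified ground_simps]
    have g0: "g \<zero>\<^bsub>P0\<^esub> = \<zero>\<^bsub>J\<^esub>" using lin_maps_zero[OF G0.left_module RJ.left_module g(1)] by simp
    define lam where "lam l p = (if l = i then g (d1 p) else \<zero>\<^bsub>J\<^esub>)" for l p
    have "from_functionals P1 lam \<in> lin_maps T P1 N"
    proof (rule from_functionals_lin[OF P1])
      fix l
      show "lam l \<in> lin_maps R (ground P1) J"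
        unfolding lam_def using gg lin_mapsD[OF lin_maps_ground[OF d1], simplified ground_simps]
        by (intro lin_mapsI) auto
      fix m p assume l: "l \<in> {1..n}" and m: "l < m" "m \<le> n" and p: "p \<in> carrier P1"
      show "lam l (unit 1 m \<one> \<odot>\<^bsub>P1\<^esub> p) = \<zero>\<^bsub>J\<^esub>"
      proof (cases "l = i")
        case True
        then have jm: "j \<le> m" using m i by simp
        have um: "unit 1 m \<one> \<in> carrier T" "unit j m \<one> \<in> carrier T" using jm jn m by auto
        have dp: "d1 p \<in> carrier P0" using D1(1)[OF p] .
        have "d1 (unit 1 m \<one> \<odot>\<^bsub>P1\<^esub> p) = unit 1 j \<one> \<odot>\<^bsub>P0\<^esub> (unit j m \<one> \<odot>\<^bsub>P0\<^esub> d1 p)"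
          using D1(3)[OF um(1) p] unit_act[OF P0, of 1 j m \<one> \<one> "d1 p"] jm jn m dp by simp
        then have "g (d1 (unit 1 m \<one> \<odot>\<^bsub>P1\<^esub> p)) = f0 (unit j m \<one> \<odot>\<^bsub>P0\<^esub> d1 p)" using g(2) um dp by simp
        also have "\<dots> = h (d0 (unit j m \<one> \<odot>\<^bsub>P0\<^esub> d1 p))"
          using unit_act[OF P0, of j j m \<one> \<one> "d1 p"] jm jn m dp by (simp add: f0_def)
        also have "\<dots> = h \<zero>\<^bsub>X\<^esub>" using D0(3)[OF um(2) dp] cx0[OF p] um by simp
        finally show ?thesis
          using True lin_maps_zero[OF GX.left_module RJ.left_module h(1)] by (simp add: lam_def)
      qed (simp add: lam_def)
    qed
    moreover have "from_functionals P1 lam (d2 p) = \<zero>\<^bsub>N\<^esub>" if p: "p \<in> carrier P2" for p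
    proof (rule N_ext)
      interpret NN: left_module T N by (rule N.left_module_X)
      show "from_functionals P1 lam (d2 p) \<in> carrier N" "\<zero>\<^bsub>N\<^esub> \<in> carrier N"
        using lin_mapsD(1)[OF calculation D2(1)[OF p]] by auto
      fix k l a assume k: "k \<in> {1..n}" and l: "l \<in> {1..n}" and a: "a \<in> carrier A"
      have uk: "unit 1 k a \<in> carrier T" using k a by simp
      have "d1 (unit 1 k a \<odot>\<^bsub>P1\<^esub> d2 p) = \<zero>\<^bsub>P0\<^esub>"
        using D1(3)[OF uk D2(1)[OF p]] cx1[OF p] uk by simp
      then show "from_functionals P1 lam (d2 p) k l a = \<zero>\<^bsub>N\<^esub> k l a"
        unfolding N_zero[OF k l a] using k l a g0 by (simp add: from_functionals_def lam_def)
    qed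
    ultimately obtain G where G: "G \<in> lin_maps T P0 N"
      "\<And>p. p \<in> carrier P1 \<Longrightarrow> from_functionals P1 lam p = G (d1 p)" using cob by blast
    have "x \<in> d0 ` carrier P0" using surj x by simp
    then obtain p where p: "p \<in> carrier P0" "d0 p = x" by (elim imageE) simp
    have up: "unit 1 j \<one> \<odot>\<^bsub>P0\<^esub> p \<in> carrier P0" using u p by simp
    have "d0 (unit 1 j \<one> \<odot>\<^bsub>P0\<^esub> p) = \<zero>\<^bsub>X\<^esub>" using D0(3)[OF u(1) p(1)] p(2) ux by simp
    then obtain q where q: "q \<in> carrier P1" "unit 1 j \<one> \<odot>\<^bsub>P0\<^esub> p = d1 q" using ex0[OF up] by blast
    have u11: "unit 1 1 \<one> \<in> carrier T" using one by simp
    have "from_functionals P1 lam q 1 i \<one> = g (d1 (unit 1 1 \<one> \<odot>\<^bsub>P1\<^esub> q))"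
      using one i by (simp add: from_functionals_def lam_def)
    also have "\<dots> = g (unit 1 1 \<one> \<odot>\<^bsub>P0\<^esub> (unit 1 j \<one> \<odot>\<^bsub>P0\<^esub> p))" using D1(3)[OF u11 q(1)] q(2) by simp
    also have "\<dots> = f0 p" using unit_act[OF P0, of 1 1 j \<one> \<one> p] jn p(1) g(2) by simp
    also have "\<dots> = h (unit j j \<one> \<odot>\<^bsub>X\<^esub> x)" using D0(3)[OF u(2) p(1)] p(2) by (simp add: f0_def)
    finally have "G (unit 1 j \<one> \<odot>\<^bsub>P0\<^esub> p) 1 i \<one> \<noteq> \<zero>\<^bsub>J\<^esub>" using G(2)[OF q(1)] q(2) h(2) by simp
    then show False using functional_vanish[OF G(1) p(1) i(1,2) jn(2)] by simp
  qed
qed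

end


section \<open>Ext and free resolutions\<close>

lemma trivial_quotient_iff:
  assumes "comm_group G" "subgroup H G" shows "trivial_group (G Mod H) \<longleftrightarrow> carrier G \<subseteq> H"
proof -
  interpret comm_group G by fact
  interpret H: subgroup H G by fact
  interpret H: normal H G using assms(2) by (simp add: normal_iff_subgroup)
  have grp: "group (G Mod H)" by (rule H.factorgroup_is_group)
  have one: "\<one>\<^bsub>G Mod H\<^esub> = H" and car: "carrier (G Mod H) = (\<lambda>x. H #>\<^bsub>G\<^esub> x) ` carrier G"
    by (auto simp: FactGroup_def RCOSETS_def)
  show ?thesis
  proof
    assume "trivial_group (G Mod H)"
    then have "H #>\<^bsub>G\<^esub> x = H" if "x \<in> carrier G" for x
      using that one car unfolding trivial_group_def by auto
    then show "carrier G \<subseteq> H" using rcos_self[OF _ assms(2)] by blast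
  next
    assume "carrier G \<subseteq> H"
    then have "H #>\<^bsub>G\<^esub> x = H" if "x \<in> carrier G" for x
      using that coset_join2[OF that assms(2)] by blast
    then show "trivial_group (G Mod H)"
      unfolding trivial_group_def using grp one car one_closed by auto
  qed
qed

lemma Hom_simps:
  "f \<in> carrier (Hom B P Q) \<longleftrightarrow> f \<in> lin_maps B P Q \<and> f \<in> extensional (carrier P)"
  "f \<otimes>\<^bsub>Hom B P Q\<^esub> g = (\<lambda>x \<in> carrier P. f x \<oplus>\<^bsub>Q\<^esub> g x)"
  "\<one>\<^bsub>Hom B P Q\<^esub> = (\<lambda>x \<in> carrier P. \<zero>\<^bsub>Q\<^esub>)"
  by (simp_all add: Hom_def)

lemma lin_maps_restrict:
  assumes "left_module B P" "f \<in> lin_maps B P Q"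
  shows "restrict f (carrier P) \<in> lin_maps B P Q"
proof -
  interpret P: left_module B P by fact
  show ?thesis by (intro lin_mapsI) (auto simp: lin_mapsD[OF assms(2)])
qed

lemma comm_group_Hom:
  assumes P: "left_module B P" and Q: "left_module B Q" shows "comm_group (Hom B P Q)"
proof -
  interpret P: left_module B P by fact
  interpret Q: left_module B Q by fact
  have cl: "f x \<in> carrier Q" if "f \<in> carrier (Hom B P Q)" "x \<in> carrier P" for f x
    using that lin_mapsD(1) by (auto simp: Hom_simps)
  show ?thesis
  proof (rule comm_groupI)
    fix f g assume f: "f \<in> carrier (Hom B P Q)" and g: "g \<in> carrier (Hom B P Q)"
    have fl: "f \<in> lin_maps B P Q" and gl: "g \<in> lin_maps B P Q" using f g by (auto simp: Hom_simps)
    show "f \<otimes>\<^bsub>Hom B P Q\<^esub> g \<in> carrier (Hom B P Q)"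
      unfolding Hom_simps
      by (intro conjI lin_mapsI)
        (auto simp: lin_mapsD[OF fl] lin_mapsD[OF gl] Q.M.a_ac Q.smult_r_distr)
    show "f \<otimes>\<^bsub>Hom B P Q\<^esub> g = g \<otimes>\<^bsub>Hom B P Q\<^esub> f"
      unfolding Hom_simps using cl[OF f] cl[OF g] by (intro restrict_ext) (simp add: Q.M.a_comm)
    fix h assume h: "h \<in> carrier (Hom B P Q)"
    show "f \<otimes>\<^bsub>Hom B P Q\<^esub> g \<otimes>\<^bsub>Hom B P Q\<^esub> h = f \<otimes>\<^bsub>Hom B P Q\<^esub> (g \<otimes>\<^bsub>Hom B P Q\<^esub> h)"
      unfolding Hom_simps using cl[OF f] cl[OF g] cl[OF h]
      by (intro restrict_ext) (simp add: Q.M.a_assoc)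
  next
    show "\<one>\<^bsub>Hom B P Q\<^esub> \<in> carrier (Hom B P Q)"
      unfolding Hom_simps by (intro conjI lin_mapsI) auto
  next
    fix f assume f: "f \<in> carrier (Hom B P Q)"
    have fl: "f \<in> lin_maps B P Q" using f by (auto simp: Hom_simps)
    show "\<one>\<^bsub>Hom B P Q\<^esub> \<otimes>\<^bsub>Hom B P Q\<^esub> f = f"
      using f cl[OF f] by (auto simp: Hom_simps intro!: extensionalityI[of _ "carrier P"])
    have "(\<lambda>x \<in> carrier P. \<ominus>\<^bsub>Q\<^esub> f x) \<in> carrier (Hom B P Q)"
      unfolding Hom_simps
      by (intro conjI lin_mapsI)
        (auto simp: lin_mapsD[OF fl] Q.M.minus_add Q.M.a_comm Q.smult_r_minus)
    moreover have "(\<lambda>x \<in> carrier P. \<ominus>\<^bsub>Q\<^esub> f x) \<otimes>\<^bsub>Hom B P Q\<^esub> f = \<one>\<^bsub>Hom B P Q\<^esub>"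
      unfolding Hom_simps using cl[OF f] by (intro restrict_ext) (simp add: Q.M.l_neg)
    ultimately show "\<exists>g \<in> carrier (Hom B P Q). g \<otimes>\<^bsub>Hom B P Q\<^esub> f = \<one>\<^bsub>Hom B P Q\<^esub>" by blast
  qed
qed

lemma group_hom_compose:
  assumes P: "left_module B P" and P': "left_module B P'" and Q: "left_module B Q"
    and d: "d \<in> lin_maps B P' P"
  shows "group_hom (Hom B P Q) (Hom B P' Q) (\<lambda>f. compose (carrier P') f d)"
proof -
  interpret P': left_module B P' by fact
  interpret G: comm_group "Hom B P Q" by (rule comm_group_Hom[OF P Q])
  interpret G': comm_group "Hom B P' Q" by (rule comm_group_Hom[OF P' Q])
  show ?thesis
  proof (intro group_hom.intro group_hom_axioms.intro homI G.is_group G'.is_group)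
    fix f assume "f \<in> carrier (Hom B P Q)"
    then have f: "f \<in> lin_maps B P Q" by (simp add: Hom_simps)
    show "compose (carrier P') f d \<in> carrier (Hom B P' Q)"
      unfolding Hom_simps compose_def
      by (intro conjI lin_mapsI) (auto simp: lin_mapsD[OF f] lin_mapsD[OF d])
    fix g
    show "compose (carrier P') (f \<otimes>\<^bsub>Hom B P Q\<^esub> g) d
        = compose (carrier P') f d \<otimes>\<^bsub>Hom B P' Q\<^esub> compose (carrier P') g d"
      unfolding Hom_simps compose_def by (intro restrict_ext) (simp add: lin_mapsD[OF d])
  qed
qed

lemma trivial_Ext_Suc_iff:
  assumes B: "ring B" and Q: "left_module B Q" and Y: "left_module B Y"
    and kde: "(SOME P. free_resolution B Y P) = (k, d, e)" and res: "free_resolution B Y (k, d, e)"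
  shows "trivial_group (Ext B (Suc j) Y Q) \<longleftrightarrow>
    (\<forall>f \<in> lin_maps B (free B (k (Suc j))) Q.
       (\<forall>p \<in> carrier (free B (k (Suc (Suc j)))). f (d (Suc j) p) = \<zero>\<^bsub>Q\<^esub>) \<longrightarrow>
       (\<exists>g \<in> lin_maps B (free B (k j)) Q. \<forall>p \<in> carrier (free B (k (Suc j))). f p = g (d j p)))"
proof -
  let ?P = "\<lambda>i. free B (k i)"
  let ?C = "\<lambda>i. Hom B (?P i) Q"
  let ?\<delta> = "\<lambda>i f. compose (carrier (?P (Suc i))) f (d i)"
  have P: "left_module B (?P i)" for i by (rule left_module_free[OF B])
  have d: "d i \<in> lin_maps B (?P (Suc i)) (?P i)" for i using res by (simp add: free_resolution_def)
  have dd: "d i (d (Suc i) p) = \<zero>\<^bsub>?P i\<^esub>" if "p \<in> carrier (?P (Suc (Suc i)))" for i p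
  proof -
    have "d (Suc i) ` carrier (?P (Suc (Suc i))) = a_kernel (?P (Suc i)) (?P i) (d i)"
      using res by (simp add: free_resolution_def)
    then have "d (Suc i) p \<in> a_kernel (?P (Suc i)) (?P i) (d i)" using that by blast
    then show ?thesis by (simp add: a_kernel_def')
  qed
  interpret C: comm_group "?C i" for i by (rule comm_group_Hom[OF P Q])
  have hom: "group_hom (?C i) (?C (Suc i)) (?\<delta> i)" for i by (rule group_hom_compose[OF P P Q d])
  define Z where "Z = kernel (?C (Suc j)) (?C (Suc (Suc j))) (?\<delta> (Suc j))"
  define Im where "Im = ?\<delta> j ` carrier (?C j)"
  have Z: "subgroup Z (?C (Suc j))" unfolding Z_def by (rule group_hom.subgroup_kernel[OF hom])
  have Im: "subgroup Im (?C (Suc j))" unfolding Im_def by (rule group_hom.img_is_subgroup[OF hom])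
  have Z_iff: "f \<in> Z \<longleftrightarrow> f \<in> carrier (?C (Suc j)) \<and>
      (\<forall>p \<in> carrier (?P (Suc (Suc j))). f (d (Suc j) p) = \<zero>\<^bsub>Q\<^esub>)" for f
    unfolding Z_def kernel_def Hom_simps(3) by (auto simp: compose_def restrict_def fun_eq_iff)
  have Im_iff: "f \<in> Im \<longleftrightarrow> (\<exists>g \<in> carrier (?C j). f = (\<lambda>p \<in> carrier (?P (Suc j)). g (d j p)))" for f
    unfolding Im_def compose_def by blast
  have ImZ: "Im \<subseteq> Z"
  proof
    fix f assume f: "f \<in> Im"
    then obtain g where g: "g \<in> carrier (?C j)" "f = (\<lambda>p \<in> carrier (?P (Suc j)). g (d j p))"
      unfolding Im_iff by blast
    have gl: "g \<in> lin_maps B (?P j) Q" using g(1) by (simp add: Hom_simps)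
    have "f (d (Suc j) p) = \<zero>\<^bsub>Q\<^esub>" if "p \<in> carrier (?P (Suc (Suc j)))" for p
      using lin_mapsD(1)[OF d that] dd[OF that] lin_maps_zero[OF P Q gl] by (simp add: g(2))
    then show "f \<in> Z" using f subgroup.subset[OF Im] unfolding Z_iff by blast
  qed
  have comm: "comm_group ((?C (Suc j))\<lparr>carrier := Z\<rparr>)"
    using subgroup.subset[OF Z]
    by (intro group.group_comm_groupI C.subgroup_imp_group[OF Z]) (auto intro: C.m_comm)
  have sub: "subgroup Im ((?C (Suc j))\<lparr>carrier := Z\<rparr>)"
    using C.subgroup_incl[OF Im Z ImZ] .
  have "Ext B (Suc j) Y Q = (?C (Suc j))\<lparr>carrier := Z\<rparr> Mod Im"
    unfolding Ext_def kde by (simp add: Z_def Im_def)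
  then have "trivial_group (Ext B (Suc j) Y Q) \<longleftrightarrow> Z \<subseteq> Im"
    using trivial_quotient_iff[OF comm sub] by simp
  also have "\<dots> \<longleftrightarrow> (\<forall>f \<in> lin_maps B (?P (Suc j)) Q.
       (\<forall>p \<in> carrier (?P (Suc (Suc j))). f (d (Suc j) p) = \<zero>\<^bsub>Q\<^esub>) \<longrightarrow>
       (\<exists>g \<in> lin_maps B (?P j) Q. \<forall>p \<in> carrier (?P (Suc j)). f p = g (d j p)))" (is "_ \<longleftrightarrow> ?r")
  proof
    assume ZI: "Z \<subseteq> Im"
    show ?r
    proof (intro ballI impI)
      fix f assume f: "f \<in> lin_maps B (?P (Suc j)) Q"
        and c: "\<forall>p \<in> carrier (?P (Suc (Suc j))). f (d (Suc j) p) = \<zero>\<^bsub>Q\<^esub>"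
      have "restrict f (carrier (?P (Suc j))) \<in> Z"
        unfolding Z_iff Hom_simps using lin_maps_restrict[OF P f] c lin_mapsD(1)[OF d] by auto
      then obtain g where g: "g \<in> carrier (?C j)"
        "restrict f (carrier (?P (Suc j))) = (\<lambda>p \<in> carrier (?P (Suc j)). g (d j p))"
        using ZI Im_iff by blast
      have "f p = g (d j p)" if "p \<in> carrier (?P (Suc j))" for p
        using fun_cong[OF g(2), of p] that by simp
      then show "\<exists>g \<in> lin_maps B (?P j) Q. \<forall>p \<in> carrier (?P (Suc j)). f p = g (d j p)"
        using g(1) unfolding Hom_simps by blast
    qed
  next
    assume r: ?r
    show "Z \<subseteq> Im"
    proof
      fix f assume "f \<in> Z"
      then have f: "f \<in> lin_maps B (?P (Suc j)) Q" "f \<in> extensional (carrier (?P (Suc j)))"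
        "\<forall>p \<in> carrier (?P (Suc (Suc j))). f (d (Suc j) p) = \<zero>\<^bsub>Q\<^esub>" unfolding Z_iff Hom_simps by auto
      obtain g where g: "g \<in> lin_maps B (?P j) Q" "\<forall>p \<in> carrier (?P (Suc j)). f p = g (d j p)"
        using r f(1,3) by blast
      have "restrict g (carrier (?P j)) \<in> carrier (?C j)"
        unfolding Hom_simps using lin_maps_restrict[OF P g(1)] by simp
      moreover have "f = (\<lambda>p \<in> carrier (?P (Suc j)). restrict g (carrier (?P j)) (d j p))"
        using f(2) g(2) lin_mapsD(1)[OF d] by (intro extensionalityI[of _ "carrier (?P (Suc j))"]) auto
      ultimately show "f \<in> Im" unfolding Im_iff by blast
    qed
  qed
  finally show ?thesis .
qed

text \<open>
  A resolution is built by covering kernels successively.  The recursion carries the rank of the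
  current free module together with the submodule that is to be covered next.
\<close>

lemma free_resolution_exists:
  assumes B: "ring B" and Y: "left_module B Y" and fg: "fin_gen B Y"
    and noeth: "\<And>k H. submodule H B (free B k) \<Longrightarrow> fg_submodule B (free B k) H"
  shows "\<exists>P. free_resolution B Y P"
proof -
  interpret Y: left_module B Y by fact
  have P: "left_module B (free B k)" for k by (rule left_module_free[OF B])
  obtain G where "finite G" "G \<subseteq> carrier Y" "lin_span B Y G = carrier Y"
    using fg Y.fin_gen_iff_lin_span by blast
  then obtain k0 e where e: "e \<in> lin_maps B (free B k0) Y" "e ` carrier (free B k0) = carrier Y"
    using Y.free_cover by metis
  have ker: "submodule (a_kernel P' Q f) B P'" if "left_module B P'" "left_module B Q" "f \<in> lin_maps B P' Q"
    for f and P' :: "('a, 'x, 'y) module_scheme" and Q :: "('a, 'z, 'w) module_scheme"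
    using submodule_vimage[OF that left_module.submodule_zero[OF that(2)]] by (simp add: a_kernel_def')
  define next_map where "next_map k H q \<longleftrightarrow> (submodule H B (free B k) \<longrightarrow>
      snd q \<in> lin_maps B (free B (fst q)) (free B k) \<and> snd q ` carrier (free B (fst q)) = H)" for k H q
  have "\<exists>q. next_map k H q" for k H
  proof (cases "submodule H B (free B k)")
    case True
    obtain G where "finite G" "G \<subseteq> carrier (free B k)" "H = lin_span B (free B k) G"
      using noeth[OF True] unfolding fg_submodule_def by blast
    then obtain k' d where "d \<in> lin_maps B (free B k') (free B k)" "d ` carrier (free B k') = H"
      using left_module.free_cover[OF P, of G k] by metis
    then show ?thesis by (intro exI[of _ "(k', d)"]) (simp add: next_map_def)
  qed (simp add: next_map_def)
  then have F: "next_map k H (SOME q. next_map k H q)" for k H by (rule someI_ex)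
  define K where "K k H = fst (SOME q. next_map k H q)" for k H
  define D where "D k H = snd (SOME q. next_map k H q)" for k H
  have KD: "D k H \<in> lin_maps B (free B (K k H)) (free B k)" "D k H ` carrier (free B (K k H)) = H"
    if "submodule H B (free B k)" for k H
  proof -
    have "next_map k H (K k H, D k H)" unfolding K_def D_def using F[of k H] by simp
    then show "D k H \<in> lin_maps B (free B (K k H)) (free B k)" "D k H ` carrier (free B (K k H)) = H"
      using that by (simp_all add: next_map_def)
  qed
  define s where "s = rec_nat (k0, a_kernel (free B k0) Y e)
    (\<lambda>_ (k, H). (K k H, a_kernel (free B (K k H)) (free B k) (D k H)))"
  define k where "k i = fst (s i)" for i
  define H where "H i = snd (s i)" for i
  define d where "d i = D (k i) (H i)" for i
  have k0: "k 0 = k0" "H 0 = a_kernel (free B k0) Y e" by (simp_all add: k_def H_def s_def)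
  have kS: "k (Suc i) = K (k i) (H i)" "H (Suc i) = a_kernel (free B (k (Suc i))) (free B (k i)) (d i)" for i
    by (simp_all add: k_def H_def s_def d_def split_beta)
  have sub: "submodule (H i) B (free B (k i))" for i
  proof (induct i)
    case 0 show ?case using ker[OF P Y e(1)] by (simp add: k0)
  next
    case (Suc i)
    have "d i \<in> lin_maps B (free B (k (Suc i))) (free B (k i))" using KD[OF Suc] by (simp add: d_def kS)
    then show ?case unfolding kS(2) by (rule ker[OF P P])
  qed
  have d: "d i \<in> lin_maps B (free B (k (Suc i))) (free B (k i))" "d i ` carrier (free B (k (Suc i))) = H i" for i
    using KD[OF sub[of i]] by (simp_all add: d_def kS(1))
  have "free_resolution B Y (k, d, e)"
    unfolding free_resolution_def using e d k0 kS(2) by simp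
  then show ?thesis by blast
qed


section \<open>Ext over triangular matrix rings\<close>

context triangular_artin
begin

text \<open>
  Generators of \<open>A\<close> over \<open>R\<close>, placed in a single entry of a single coordinate, generate.
\<close>

lemma fg_ground_free:
  "\<exists>G. finite G \<and> G \<subseteq> carrier (free T k) \<and> lin_span R (ground (free T k)) G = carrier (free T k)"
proof -
  interpret RA: left_module R A by (rule left_module_RA)
  have PT: "left_module T (free T k)" by (rule left_module_free[OF ring_T])
  interpret P: left_module T "free T k" by (rule PT)
  interpret G: left_module R "ground (free T k)" by (rule left_module_ground[OF PT])
  interpret T: ring T by (rule ring_T)
  have "fin_gen R A" using artin by (simp add: artin_algebra_def artin_algebra_axioms_def)
  then obtain GA where GA: "finite GA" "GA \<subseteq> carrier A" "lin_span R A GA = carrier A"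
    using RA.fin_gen_iff_lin_span by blast
  \<comment> \<open>the tuple with \<open>t\<close> in position \<open>l\<close>\<close>
  define single where "single l t = (\<lambda>m \<in> {..<k}. if m = l then t else \<zero>\<^bsub>T\<^esub>)" for l t
  define G where "G = (\<lambda>(l, i, j, a). single l (unit i j a)) ` {(l, i, j, a). l < k \<and> 1 \<le> i \<and> i \<le> j \<and> j \<le> n \<and> a \<in> GA}"
  have sc: "single l t \<in> carrier (free T k)" if "t \<in> carrier T" for l t
    using that by (auto simp: single_def free_simps simp del: T_simps)
  have "{(l, i, j, a). l < k \<and> 1 \<le> i \<and> i \<le> j \<and> j \<le> n \<and> a \<in> GA} \<subseteq> {..<k} \<times> {..n} \<times> {..n} \<times> GA" by auto
  then have finG: "finite G" unfolding G_def using GA(1) by (intro finite_imageI) (rule finite_subset, auto)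
  have Gc: "G \<subseteq> carrier (free T k)" unfolding G_def using sc GA(2) by auto
  define S where "S = lin_span R (ground (free T k)) G"
  have S: "submodule S R (ground (free T k))" unfolding S_def using Gc by (intro G.submodule_lin_span) simp
  note s = G.submoduleD[OF S, simplified ground_simps]
  have single_add: "single l (t \<oplus>\<^bsub>T\<^esub> u) = single l t \<oplus>\<^bsub>free T k\<^esub> single l u"
    if "t \<in> carrier T" "u \<in> carrier T" for l t u
    using that unfolding single_def free_simps by (intro restrict_ext) (simp del: T_simps)
  have single_zero: "single l \<zero>\<^bsub>T\<^esub> = \<zero>\<^bsub>free T k\<^esub>" for l
    unfolding single_def free_simps by (intro restrict_ext) simp
  have single_scal: "single l (scal r \<otimes>\<^bsub>T\<^esub> t) = scal r \<odot>\<^bsub>free T k\<^esub> single l t"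
    if "r \<in> carrier R" "t \<in> carrier T" for l r t
    using that scal_closed[OF that(1)] unfolding single_def free_simps
    by (intro restrict_ext) (simp del: T_simps)
  have unitS: "single l (unit i j a) \<in> S"
    if l: "l < k" and ij: "1 \<le> i" "i \<le> j" "j \<le> n" and a: "a \<in> carrier A" for l i j a
  proof -
    have "submodule {a \<in> carrier A. single l (unit i j a) \<in> S} R A"
    proof (rule RA.submoduleI)
      show "\<zero> \<in> {a \<in> carrier A. single l (unit i j a) \<in> S}" using s(2) single_zero by (simp del: T_simps)
      show "a \<oplus> b \<in> {a \<in> carrier A. single l (unit i j a) \<in> S}"
        if "a \<in> {a \<in> carrier A. single l (unit i j a) \<in> S}" "b \<in> {a \<in> carrier A. single l (unit i j a) \<in> S}" for a b
        using that s(4) ij by (simp add: unit_add single_add del: T_simps)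
      show "r \<odot>\<^bsub>A\<^esub> a \<in> {a \<in> carrier A. single l (unit i j a) \<in> S}"
        if "r \<in> carrier R" "a \<in> {a \<in> carrier A. single l (unit i j a) \<in> S}" for r a
        using that s(5) ij by (simp add: scal_unit single_scal del: T_simps)
    qed auto
    moreover have "GA \<subseteq> {a \<in> carrier A. single l (unit i j a) \<in> S}"
    proof
      fix b assume b: "b \<in> GA"
      then have "single l (unit i j b) \<in> G" unfolding G_def using l ij by force
      then show "b \<in> {a \<in> carrier A. single l (unit i j a) \<in> S}"
        using b GA(2) lin_span_incl[of G R "ground (free T k)"] unfolding S_def by blast
    qed
    ultimately have "lin_span R A GA \<subseteq> {a \<in> carrier A. single l (unit i j a) \<in> S}" by (rule lin_span_least)
    then show ?thesis using GA(3) a by blast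
  qed
  have singleS: "single l t \<in> S" if l: "l < k" and t: "t \<in> carrier T" for l t
    using t
  proof (induct rule: T_induct)
    case zero show ?case using s(2) single_zero by simp
  next
    case (add t u) then show ?case using s(4) single_add by simp
  next
    case (unit i j a) then show ?case using unitS[OF l] by simp
  qed
  have "x \<in> S" if x: "x \<in> carrier (free T k)" for x
    using ring_T finite_lessThan x[unfolded free_def]
  proof (induct rule: dsum_induct)
    case (single l t)
    then show ?case using singleS[of l t] by (simp only: single_def lessThan_iff regular_simps)
  qed (use left_module_regular[OF ring_T] s(2,4) in \<open>simp_all add: free_def\<close>)
  then have "S = carrier (free T k)" using s(1) by blast
  then show ?thesis using finG Gc unfolding S_def by blast
qed

text \<open>
  A \<open>T\<close>-submodule is an \<open>R\<close>-submodule of a finitely generated \<open>R\<close>-module, and generators over \<open>R\<close> also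
  generate over \<open>T\<close>.
\<close>

lemma fg_submodule_free:
  assumes H: "submodule H T (free T k)" shows "fg_submodule T (free T k) H"
proof -
  have PT: "left_module T (free T k)" by (rule left_module_free[OF ring_T])
  interpret P: left_module T "free T k" by (rule PT)
  interpret G: left_module R "ground (free T k)" by (rule left_module_ground[OF PT])
  have ground: "submodule L R (ground (free T k))" if L: "submodule L T (free T k)" for L
    using P.submoduleD[OF L] scal_closed by (intro G.submoduleI) auto
  obtain G where G: "finite G" "G \<subseteq> carrier (free T k)" "lin_span R (ground (free T k)) G = carrier (free T k)"
    using fg_ground_free by blast
  have "fg_submodule R (ground (free T k)) H"
    using G P.submoduleD(1)[OF H]
    by (intro artinian_imp_fg_submodules[OF cring_R artinian_R G.left_module _ _ ground[OF H]]) auto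
  then obtain G' where G': "finite G'" "G' \<subseteq> carrier (free T k)" "H = lin_span R (ground (free T k)) G'"
    unfolding fg_submodule_def by auto
  have "H = lin_span T (free T k) G'"
  proof
    show "H \<subseteq> lin_span T (free T k) G'"
      unfolding G'(3) by (rule lin_span_least[OF ground[OF P.submodule_lin_span[OF G'(2)]] lin_span_incl])
    show "lin_span T (free T k) G' \<subseteq> H"
      using G'(3) lin_span_incl[of G'] by (intro lin_span_least[OF H]) simp
  qed
  then show ?thesis using G' unfolding fg_submodule_def by blast
qed

text \<open>
  In degree one, vanishing is equivalent to injectivity of the structure maps of \<open>X\<close>.  In higher
  degrees Ext always vanishes, since then the role of \<open>X\<close> in \<open>Hom_N_exact\<close> is played by a free module.
\<close>

theorem trivial_Ext_N_iff_mono_type: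
  assumes n: "n \<ge> 1" and X: "left_module T X" and fg: "fin_gen T X"
  shows "(\<forall>i \<ge> 1. trivial_group (Ext T i X N)) \<longleftrightarrow> mono_type X"
proof -
  obtain k d e where kde: "(SOME P. free_resolution T X P) = (k, d, e)" by (cases "SOME P. free_resolution T X P")
  have res: "free_resolution T X (k, d, e)"
    using someI_ex[OF free_resolution_exists[OF ring_T X fg fg_submodule_free]] unfolding kde .
  let ?P = "\<lambda>i. free T (k i)"
  have P: "left_module T (?P i)" for i by (rule left_module_free[OF ring_T])
  have d: "d i \<in> lin_maps T (?P (Suc i)) (?P i)" for i using res by (simp add: free_resolution_def)
  have e: "e \<in> lin_maps T (?P 0) X" "e ` carrier (?P 0) = carrier X" using res by (simp_all add: free_resolution_def)
  have imd: "d (Suc i) ` carrier (?P (Suc (Suc i))) = {p \<in> carrier (?P (Suc i)). d i p = \<zero>\<^bsub>?P i\<^esub>}" for i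
    using res by (simp add: free_resolution_def a_kernel_def')
  have im0: "d 0 ` carrier (?P (Suc 0)) = {p \<in> carrier (?P 0). e p = \<zero>\<^bsub>X\<^esub>}"
    using res by (simp add: free_resolution_def a_kernel_def')
  have NN: "left_module T N" by (rule N.left_module_X)
  note Ext_iff = trivial_Ext_Suc_iff[OF ring_T NN X kde res]
  show ?thesis
  proof
    assume "\<forall>i \<ge> 1. trivial_group (Ext T i X N)"
    then have E: "trivial_group (Ext T (Suc 0) X N)" by simp
    show "mono_type X"
    proof (rule mono_type_if_cocycles_are_coboundaries[OF P[of "Suc (Suc 0)"] P[of "Suc 0"] P[of 0] X
          d[of "Suc 0"] d[of 0] e _ _ _ mono_type_free])
      show "p \<in> d 0 ` carrier (?P (Suc 0))" if "p \<in> carrier (?P 0)" "e p = \<zero>\<^bsub>X\<^esub>" for p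
        using that unfolding im0 by blast
      show "e (d 0 p) = \<zero>\<^bsub>X\<^esub>" if "p \<in> carrier (?P (Suc 0))" for p using that im0 by blast
      show "d 0 (d (Suc 0) p) = \<zero>\<^bsub>?P 0\<^esub>" if "p \<in> carrier (?P (Suc (Suc 0)))" for p using that imd[of 0] by blast
    qed (use E in \<open>unfold Ext_iff, blast\<close>)
  next
    assume mono: "mono_type X"
    have "trivial_group (Ext T (Suc j) X N)" for j
      unfolding Ext_iff
    proof (intro ballI impI)
      fix f assume f: "f \<in> lin_maps T (?P (Suc j)) N"
        and c: "\<forall>p \<in> carrier (?P (Suc (Suc j))). f (d (Suc j) p) = \<zero>\<^bsub>N\<^esub>"
      have ex1: "p \<in> d (Suc j) ` carrier (?P (Suc (Suc j)))"
        if "p \<in> carrier (?P (Suc j))" "d j p = \<zero>\<^bsub>?P j\<^esub>" for p using that unfolding imd by blast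
      show "\<exists>g \<in> lin_maps T (?P j) N. \<forall>p \<in> carrier (?P (Suc j)). f p = g (d j p)"
      proof (cases j)
        case 0
        show ?thesis
          unfolding 0
        proof (rule Hom_N_exact[OF n P[of "Suc (Suc 0)"] P[of "Suc 0"] P[of 0] X
            d[of "Suc 0"] d[of 0] e(1) _ _ _ mono])
          show "p \<in> d 0 ` carrier (?P (Suc 0))" if "p \<in> carrier (?P 0)" "e p = \<zero>\<^bsub>X\<^esub>" for p
            using that unfolding im0 by blast
          show "e (d 0 p) = \<zero>\<^bsub>X\<^esub>" if "p \<in> carrier (?P (Suc 0))" for p using that im0 by blast
        qed (use f c ex1 in \<open>simp_all add: 0\<close>)
      next
        case (Suc i)
        show ?thesis
          unfolding Suc
        proof (rule Hom_N_exact[OF n P[of "Suc (Suc (Suc i))"] P[of "Suc (Suc i)"] P[of "Suc i"] P[of i]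
            d[of "Suc (Suc i)"] d[of "Suc i"] d[of i] _ _ _ mono_type_free])
          show "p \<in> d (Suc i) ` carrier (?P (Suc (Suc i)))" if "p \<in> carrier (?P (Suc i))" "d i p = \<zero>\<^bsub>?P i\<^esub>" for p
            using that unfolding imd by blast
          show "d i (d (Suc i) p) = \<zero>\<^bsub>?P i\<^esub>" if "p \<in> carrier (?P (Suc (Suc i)))" for p using that imd[of i] by blast
        qed (use f c ex1 in \<open>simp_all add: Suc\<close>)
      qed
    qed
    then show "\<forall>i \<ge> 1. trivial_group (Ext T i X N)" by (metis Suc_le_D One_nat_def)
  qed
qed

end

theorem corollary3p2:
  fixes R :: "('r, 'p) ring_scheme"
    and A :: "('r, 'a, 'q) module_scheme"
    and J :: "('r, 'j) module"
    and n :: nat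
  assumes "artin_algebra R A"
    and "injective_envelope R (quotient_module R (jacobson_radical R)) J"
    and "n \<ge> 2"
  shows "(S_cat n A :: ('a, 'x) mor_obj set) =
    {Y \<in> Mor n A. T_module n Y \<in>
       left_perp (T_ring n A) (T_module n (m_sum n (dual R A J (regular (op_ring A)))))}"
proof -
  have "ring A" using assms(1) by (simp add: artin_algebra_def)
  then interpret triangular_artin A n R J
    using assms(1,2) by (intro triangular_artin.intro triangular_artin_axioms.intro triangular.intro)
  have "Y \<in> S_cat n A \<longleftrightarrow> T_module n Y \<in> left_perp (T_ring n A) (T_module n (m_sum n D))"
    if Y: "Y \<in> Mor n A" for Y :: "('a, 'x) mor_obj"
  proof -
    interpret Y: triangular_object A n Y
      using Y by (intro triangular_object.intro triangular_object_axioms.intro triangular_axioms)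
        (auto simp: Mor_def)
    have fg: "fin_gen T Y.X" using Y by (intro Y.fin_gen_X) (auto simp: Mor_def)
    have "Y \<in> S_cat n A \<longleftrightarrow> mono_type Y.X"
      using Y Y.mono_type_iff_inj_on_str by (simp add: S_cat_def)
    also have "\<dots> \<longleftrightarrow> (\<forall>i \<ge> 1. trivial_group (Ext T i Y.X N))"
      using trivial_Ext_N_iff_mono_type[OF _ Y.left_module_X fg] assms(3) by simp
    also have "\<dots> \<longleftrightarrow> Y.X \<in> left_perp T N"
      using Y.left_module_X fg by (simp add: left_perp_def)
    finally show ?thesis .
  qed
  moreover have "S_cat n A \<subseteq> (Mor n A :: ('a, 'x) mor_obj set)" by (auto simp: S_cat_def)
  ultimately show ?thesis unfolding D_def[symmetric] by blast
qed

end
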